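(* Assume $s=1$ and let $(\pi,\lambda,\tau)$ be a typical point. For any sequence $\underline\xi=(\xi^{(n)})_{n\in\mathbb Z}$ compatible with $\xi^{(0)}\in I^{(0)}$ and for any integers $n\ge n'$, the special Birkhoff sum operator $S(n',n)$ is an isomorphism from $\Gamma^{(n')}$ onto $\Gamma^{(n)}$ and from $\Gamma^{(n')}(\xi)$ onto $\Gamma^{(n)}(\xi)$ (as affine spaces). Furthermore, there exists a unique sequence $(\chi^{(n)})_{n\in\mathbb Z}$ such that $\chi^{(n)}\in\Gamma^{(n)}(\xi)$ for every $n\in\mathbb Z$, $$S(n',n)(\chi^{(n')})=\chi^{(n)}\qquad\text{for all } n,n'\in\mathbb Z,\ n\ge n',$$ and $$\lim_{n\to\pm\infty}\frac1{Z(n)}\log\|\chi^{(n)}\|_\infty=0 .$$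
   Context: Interval exchange maps. Let $\mathcal A$ be an alphabet with $d\ge2$ letters. Combinatorial data is an irreducible pair $\pi=(\pi_t,\pi_b)$ of bijections $\mathcal A\to\{1,\dots,d\}$ (irreducible: $\pi_t^{-1}(\{1,\dots,k\})\ne\pi_b^{-1}(\{1,\dots,k\})$ for $1\le k<d$). For $\lambda\in(0,\infty)^{\mathcal A}$ the interval exchange map (i.e.m.) $T_{\pi,\lambda}$ acts on $I=(0,\sum_\alpha\lambda_\alpha)$: it translates the intervals $I_\alpha$ of length $\lambda_\alpha$, ordered from left to right by $\pi_t$, onto intervals $I^b_\alpha$ of the same lengths ordered by $\pi_b$ (extended by right-continuity). $\Omega_\pi$ is the antisymmetric matrix with $\Omega_{\alpha\beta}=1$ if $\pi_t(\alpha)<\pi_t(\beta),\pi_b(\alpha)>\pi_b(\beta)$, $-1$ if $\pi_t(\alpha)>\pi_t(\beta),\pi_b(\alpha)<\pi_b(\beta)$, $0$ otherwise; its rank is $2g$, and $s:=d-2g+1$. The cone of suspension vectors is $\Theta_\pi=\{\tau\in\mathbb R^{\mathcal A}:\sum_{\pi_t(\alpha)<k}\tau_\alpha>0,\ \sum_{\pi_b(\alpha)<k}\tau_\alpha<0,\ 1<k\le d\}$; for $\tau\in\Theta_\pi$, $M(\pi,\lambda,\tau)$ is the translation surface given by Veech's zippered rectangle construction. Two-sided Rauzy--Veech algorithm. A forward elementary step: let $\pi_t(\alpha_t)=\pi_b(\alpha_b)=d$. If $\lambda_{\alpha_t}>\lambda_{\alpha_b}$ (top type) the winner is $\alpha_t$,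 the loser $\alpha_b$, $\pi_t$ is unchanged and in the bottom row $\alpha_b$ is moved immediately after $\alpha_t$; if $\lambda_{\alpha_t}<\lambda_{\alpha_b}$ (bottom type) the winner is $\alpha_b$, the loser $\alpha_t$, $\pi_b$ is unchanged and in the top row $\alpha_t$ is moved immediately after $\alpha_b$; in both cases the winner's $\lambda$ and $\tau$ entries are diminished by the loser's. The matrix of the step is $B_\gamma=\mathrm{Id}+E_{\text{loser},\text{winner}}$. The backward step (inverse) is of top type if $\sum_\alpha\tau_\alpha<0$ and of bottom type if $\sum_\alpha\tau_\alpha>0$. If $M(\pi,\lambda,\tau)$ has no vertical and no horizontal saddle connections one obtains a sequence $(\pi^{(n)},\lambda^{(n)},\tau^{(n)})_{n\in\mathbb Z}$ starting at $(\pi,\lambda,\tau)$ for $n=0$. $T^{(n)}$ is the i.e.m. with data $(\pi^{(n)},\lambda^{(n)})$, acting on $I^{(n)}$ and exchanging the intervals $I_\alpha^{(n)}$; for $m\le n$, $T^{(n)}$ is the first return map of $T^{(m)}$ to $I^{(n)}\subset I^{(m)}$. With $\gamma_n$ the step from index $n-1$ to $n$, $B(m,n)=B_{\gamma_n}\cdots B_{\gamma_{m+1}}$ ($m\le n$). For a function $\varphi$ on $I^{(m)}$ and $m\le n$, the special Birkhoff sum is $S(m,n)\varphi(x)=\sum_{0\le j<r(x)}\varphi((T^{(m)})^jx)$, $x\in I^{(n)}$, $r(x)$ being the return time of $x$ to $I^{(n)}$ under $T^{(m)}$. The Zorich time $Z(n)$ is the signed count (zero at $n=0$, negative for $n<0$)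 of maximal blocks of successive steps of the same type between index $0$ and index $n$. Typical point: $(\pi,\lambda,\tau)$ is typical for the natural extension of the Rauzy--Veech dynamics and Oseledets generic for the Kontsevich--Zorich cocycle $B(m,n)$ acting on $\mathbb R^{\mathcal A}$, with respect to Zorich time (for $s=1$ the Lyapunov spectrum consists of $g$ positive and $g$ negative exponents). Compatible sequences: $\underline\xi=(\xi^{(n)})_{n\in\mathbb Z}$ is compatible with $\xi^{(0)}$ if $\xi^{(n)}\in I^{(n)}$ for every $n\in\mathbb Z$ and, for $n\ge n'$, $\xi^{(n)}$ is the first entry point in $I^{(n)}$ when iterating $(T^{(n')})^{-1}$ from $\xi^{(n')}$ (the point $\xi^{(n')}$ itself if it already lies in $I^{(n)}$). $\widetilde\chi^{(n)}$ is the characteristic function of $(0,\xi^{(n)})$ on $I^{(n)}$. $\Gamma^{(n)}$ is the $d$-dimensional space of functions on $I^{(n)}$ constant on each $I_\alpha^{(n)}$, and $\Gamma^{(n)}(\xi)=\widetilde\chi^{(n)}+\Gamma^{(n)}$.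
   Formalization: Existence of (χ^(n)) is stated only when no ξ^(n) is an endpoint of an interval I_α^(n); otherwise Γ^(m)(ξ)=Γ^(m) for large m and the growth rate is a nonzero exponent or χ^(m)=0, so existence fails. Isomorphisms and uniqueness hold for all compatible sequences. *)

theory Defs
  imports "HOL-Analysis.Analysis"
begin

text \<open>
  The alphabet is a finite type \<open>'a\<close> and \<open>d = CARD('a)\<close>. A datum \<open>(\<pi>, \<lambda>, \<tau>)\<close> is a record whose
  fields are the two rows of \<open>\<pi>\<close>, the length vector and the suspension vector.
\<close>

record ('a::finite) rv_datum =
  ptop :: "'a \<Rightarrow> nat"
  pbot :: "'a \<Rightarrow> nat"
  lam :: "real ^ 'a"
  tau :: "real ^ 'a"

definition irreducible_pair :: "('a::finite \<Rightarrow> nat) \<Rightarrow> ('a \<Rightarrow> nat) \<Rightarrow> bool" where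
  "irreducible_pair pt pb \<longleftrightarrow>
     bij_betw pt UNIV {1..CARD('a)} \<and> bij_betw pb UNIV {1..CARD('a)} \<and>
     (\<forall>k. 1 \<le> k \<and> k < CARD('a) \<longrightarrow> pt -` {1..k} \<noteq> pb -` {1..k})"

definition suspension_cone :: "('a::finite \<Rightarrow> nat) \<Rightarrow> ('a \<Rightarrow> nat) \<Rightarrow> (real ^ 'a) set" where
  "suspension_cone pt pb =
     {t. \<forall>k. 1 < k \<and> k \<le> CARD('a) \<longrightarrow>
        (\<Sum>\<alpha> | pt \<alpha> < k. t $ \<alpha>) > 0 \<and> (\<Sum>\<alpha> | pb \<alpha> < k. t $ \<alpha>) < 0}"

definition valid_datum :: "('a::finite) rv_datum \<Rightarrow> bool" where
  "valid_datum P \<longleftrightarrow>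
     irreducible_pair (ptop P) (pbot P) \<and> (\<forall>\<alpha>. lam P $ \<alpha> > 0) \<and>
     tau P \<in> suspension_cone (ptop P) (pbot P)"

definition Omega :: "('a::finite) rv_datum \<Rightarrow> real ^ 'a ^ 'a" where
  "Omega P = (\<chi> \<alpha> \<beta>.
     if ptop P \<alpha> < ptop P \<beta> \<and> pbot P \<alpha> > pbot P \<beta> then 1
     else if ptop P \<alpha> > ptop P \<beta> \<and> pbot P \<alpha> < pbot P \<beta> then - 1 else 0)"

definition genus :: "('a::finite) rv_datum \<Rightarrow> nat" where
  "genus P = rank (Omega P) div 2"

text \<open>The number \<open>s = d - 2g + 1\<close>; the subtraction does not truncate since \<open>2g = rank \<Omega> \<le> d\<close>.\<close>

definition num_marked :: "('a::finite) rv_datum \<Rightarrow> nat" where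
  "num_marked P = CARD('a) + 1 - 2 * genus P"


subsection \<open>The interval exchange map\<close>

text \<open>
  Extending by right-continuity, all intervals are taken closed on the left and open on the right.
  In particular the map acts bijectively on \<open>[0, \<Sum>\<lambda>)\<close>, where the point 0 carries the right limits.
\<close>

definition base :: "('a::finite) rv_datum \<Rightarrow> real set" where
  "base P = {0..<(\<Sum>\<alpha>\<in>UNIV. lam P $ \<alpha>)}"

definition left_top :: "('a::finite) rv_datum \<Rightarrow> 'a \<Rightarrow> real" where
  "left_top P \<alpha> = (\<Sum>\<beta> | ptop P \<beta> < ptop P \<alpha>. lam P $ \<beta>)"

definition left_bot :: "('a::finite) rv_datum \<Rightarrow> 'a \<Rightarrow> real" where
  "left_bot P \<alpha> = (\<Sum>\<beta> | pbot P \<beta> < pbot P \<alpha>. lam P $ \<beta>)"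

definition int_top :: "('a::finite) rv_datum \<Rightarrow> 'a \<Rightarrow> real set" where
  "int_top P \<alpha> = {left_top P \<alpha>..<left_top P \<alpha> + lam P $ \<alpha>}"

definition iem :: "('a::finite) rv_datum \<Rightarrow> real \<Rightarrow> real" where
  "iem P x = (let \<alpha> = (THE \<alpha>. x \<in> int_top P \<alpha>) in x - left_top P \<alpha> + left_bot P \<alpha>)"

definition iem_inv :: "('a::finite) rv_datum \<Rightarrow> real \<Rightarrow> real" where
  "iem_inv P = inv_into (base P) (iem P)"


subsection \<open>The two-sided Rauzy--Veech algorithm\<close>

definition last_top :: "('a::finite) rv_datum \<Rightarrow> 'a" where
  "last_top P = (THE \<alpha>. ptop P \<alpha> = CARD('a))"

definition last_bot :: "('a::finite) rv_datum \<Rightarrow> 'a" where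
  "last_bot P = (THE \<alpha>. pbot P \<alpha> = CARD('a))"

definition top_type :: "('a::finite) rv_datum \<Rightarrow> bool" where
  "top_type P \<longleftrightarrow> lam P $ last_top P > lam P $ last_bot P"

definition winner :: "('a::finite) rv_datum \<Rightarrow> 'a" where
  "winner P = (if top_type P then last_top P else last_bot P)"

definition loser :: "('a::finite) rv_datum \<Rightarrow> 'a" where
  "loser P = (if top_type P then last_bot P else last_top P)"

text \<open>In a row \<open>p\<close> whose last letter is \<open>l\<close>, move \<open>l\<close> immediately after \<open>w\<close>.\<close>

definition move_last_after :: "('a \<Rightarrow> nat) \<Rightarrow> 'a \<Rightarrow> 'a \<Rightarrow> 'a \<Rightarrow> nat" where
  "move_last_after p w l \<beta> =
     (if \<beta> = l then p w + 1 else if p \<beta> > p w then p \<beta> + 1 else p \<beta>)"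

definition subtract_loser :: "('a::finite) rv_datum \<Rightarrow> real ^ 'a \<Rightarrow> real ^ 'a" where
  "subtract_loser P v = (\<chi> \<alpha>. if \<alpha> = winner P then v $ \<alpha> - v $ loser P else v $ \<alpha>)"

definition rv_step :: "('a::finite) rv_datum \<Rightarrow> 'a rv_datum" where
  "rv_step P =
     \<lparr> ptop = (if top_type P then ptop P else move_last_after (ptop P) (winner P) (loser P)),
       pbot = (if top_type P then move_last_after (pbot P) (winner P) (loser P) else pbot P),
       lam = subtract_loser P (lam P),
       tau = subtract_loser P (tau P) \<rparr>"

text \<open>
  The backward steps are encoded by requiring every \<open>D n\<close> with \<open>n < 0\<close> to be a datum from which
  the forward step leads to \<open>D (n + 1)\<close>. Since \<open>\<tau>\<close> lies in the suspension cone before the step, a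
  step of top (bottom) type ends at a datum with \<open>\<Sum>\<tau> < 0\<close> (\<open>\<Sum>\<tau> > 0\<close>), so this is the rule that
  chooses the type of the backward step by the sign of \<open>\<Sum>\<tau>\<close>.
\<close>

definition rv_orbit :: "('a::finite) rv_datum \<Rightarrow> (int \<Rightarrow> 'a rv_datum) \<Rightarrow> bool" where
  "rv_orbit P D \<longleftrightarrow> D 0 = P \<and>
     (\<forall>n. valid_datum (D n) \<and> lam (D n) $ last_top (D n) \<noteq> lam (D n) $ last_bot (D n) \<and>
          D (n + 1) = rv_step (D n))"

definition step_matrix :: "('a::finite) rv_datum \<Rightarrow> real ^ 'a ^ 'a" where
  "step_matrix P = mat 1 + (\<chi> \<alpha> \<beta>. if \<alpha> = loser P \<and> \<beta> = winner P then 1 else 0)"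

fun steps_matrix :: "(int \<Rightarrow> ('a::finite) rv_datum) \<Rightarrow> int \<Rightarrow> nat \<Rightarrow> real ^ 'a ^ 'a" where
  "steps_matrix D m 0 = mat 1"
| "steps_matrix D m (Suc k) = step_matrix (D (m + int k)) ** steps_matrix D m k"

text \<open>The cocycle \<open>B(m,n)\<close>, with \<open>B(m,n) = B(n,m)\<^sup>-\<^sup>1\<close> for \<open>n < m\<close>.\<close>

definition kz :: "(int \<Rightarrow> ('a::finite) rv_datum) \<Rightarrow> int \<Rightarrow> int \<Rightarrow> real ^ 'a ^ 'a" where
  "kz D m n = (if m \<le> n then steps_matrix D m (nat (n - m))
               else matrix_inv (steps_matrix D n (nat (m - n))))"

text \<open>
  The step from index \<open>i\<close> to \<open>i + 1\<close> has the type of \<open>D i\<close>. The number of maximal blocks in a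
  nonempty sequence of steps is one more than its number of changes of type.
\<close>

definition zorich :: "(int \<Rightarrow> ('a::finite) rv_datum) \<Rightarrow> int \<Rightarrow> int" where
  "zorich D n =
     (if n > 0 then 1 + int (card {i. 0 < i \<and> i < n \<and> top_type (D (i - 1)) \<noteq> top_type (D i)})
      else if n < 0 then
        - (1 + int (card {i. n < i \<and> i < 0 \<and> top_type (D (i - 1)) \<noteq> top_type (D i)}))
      else 0)"


subsection \<open>Typical points\<close>

definition min_angle :: "('b::real_inner) set \<Rightarrow> 'b set \<Rightarrow> real" where
  "min_angle U W = Inf {arccos (u \<bullet> w) | u w. u \<in> U \<and> w \<in> W \<and> norm u = 1 \<and> norm w = 1}"

text \<open>
  The conclusions of the two-sided multiplicative ergodic theorem for the cocycle \<open>kz\<close> in Zorich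
  time: a splitting of \<open>\<real>\<^sup>A\<close> into subspaces \<open>E \<theta>\<close>, indexed by the finite set \<open>\<Lambda>\<close> of Lyapunov
  exponents, with growth rate \<open>\<theta>\<close> on \<open>E \<theta>\<close> (uniformly on the unit sphere) in both time directions and
  with subexponential angles. The last two clauses say that, with multiplicity, there are \<open>g\<close>
  positive and \<open>g\<close> negative exponents; the remaining \<open>s - 1\<close> are then zero.
\<close>

definition oseledets_generic :: "(int \<Rightarrow> ('a::finite) rv_datum) \<Rightarrow> bool" where
  "oseledets_generic D \<longleftrightarrow>
     (\<exists>(\<Lambda> :: real set) (E :: real \<Rightarrow> (real ^ 'a) set).
        finite \<Lambda> \<and> (\<forall>\<theta>\<in>\<Lambda>. subspace (E \<theta>) \<and> E \<theta> \<noteq> {0}) \<and>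
        (\<forall>v. \<exists>!w. (\<forall>\<theta>\<in>\<Lambda>. w \<theta> \<in> E \<theta>) \<and> (\<forall>\<theta>. \<theta> \<notin> \<Lambda> \<longrightarrow> w \<theta> = 0) \<and> v = (\<Sum>\<theta>\<in>\<Lambda>. w \<theta>)) \<and>
        (\<forall>F\<in>{at_top, at_bot}.
           (\<forall>\<theta>\<in>\<Lambda>. uniform_limit (E \<theta> \<inter> sphere 0 1)
              (\<lambda>n v. ln (norm (kz D 0 n *v v)) / real_of_int (zorich D n)) (\<lambda>v. \<theta>) F) \<and>
           (\<forall>J K. J \<subseteq> \<Lambda> \<and> K \<subseteq> \<Lambda> \<and> J \<noteq> {} \<and> K \<noteq> {} \<and> J \<inter> K = {} \<longrightarrow>
              ((\<lambda>n. ln (min_angle ((*v) (kz D 0 n) ` span (\<Union>\<theta>\<in>J. E \<theta>))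
                                   ((*v) (kz D 0 n) ` span (\<Union>\<theta>\<in>K. E \<theta>)))
                    / real_of_int (zorich D n)) \<longlongrightarrow> 0) F)) \<and>
        (\<Sum>\<theta> | \<theta> \<in> \<Lambda> \<and> \<theta> > 0. dim (E \<theta>)) = genus (D 0) \<and>
        (\<Sum>\<theta> | \<theta> \<in> \<Lambda> \<and> \<theta> < 0. dim (E \<theta>)) = genus (D 0))"

definition typical_point :: "('a::finite) rv_datum \<Rightarrow> bool" where
  "typical_point P \<longleftrightarrow> (\<exists>D. rv_orbit P D \<and> oseledets_generic D)"


subsection \<open>Function spaces and special Birkhoff sums\<close>

text \<open>Functions on \<open>base P\<close> are represented by functions on the reals that vanish outside \<open>base P\<close>.\<close>

definition Gam :: "('a::finite) rv_datum \<Rightarrow> (real \<Rightarrow> real) set" where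
  "Gam P = {f. (\<forall>\<alpha>. \<exists>c. \<forall>x\<in>int_top P \<alpha>. f x = c) \<and> (\<forall>x. x \<notin> base P \<longrightarrow> f x = 0)}"

text \<open>The characteristic function of \<open>(0,x)\<close>, extended to 0 by right-continuity.\<close>

definition chi_tilde :: "('a::finite) rv_datum \<Rightarrow> real \<Rightarrow> real \<Rightarrow> real" where
  "chi_tilde P x = indicator (base P \<inter> {0..<x})"

definition Gam_at :: "('a::finite) rv_datum \<Rightarrow> real \<Rightarrow> (real \<Rightarrow> real) set" where
  "Gam_at P x = {\<lambda>y. chi_tilde P x y + f y | f. f \<in> Gam P}"

definition return_time :: "('a::finite) rv_datum \<Rightarrow> 'a rv_datum \<Rightarrow> real \<Rightarrow> nat" where
  "return_time P Q x = (LEAST k. k > 0 \<and> (iem P ^^ k) x \<in> base Q)"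

definition special_birkhoff ::
    "(int \<Rightarrow> ('a::finite) rv_datum) \<Rightarrow> int \<Rightarrow> int \<Rightarrow> (real \<Rightarrow> real) \<Rightarrow> real \<Rightarrow> real" where
  "special_birkhoff D m n f x =
     (if x \<in> base (D n) then (\<Sum>j<return_time (D m) (D n) x. f ((iem (D m) ^^ j) x)) else 0)"

definition linear_iso :: "((real \<Rightarrow> real) \<Rightarrow> real \<Rightarrow> real) \<Rightarrow> (real \<Rightarrow> real) set \<Rightarrow> (real \<Rightarrow> real) set \<Rightarrow> bool" where
  "linear_iso S V W \<longleftrightarrow> bij_betw S V W \<and>
     (\<forall>f\<in>V. \<forall>g\<in>V. \<forall>a b. S (\<lambda>x. a * f x + b * g x) = (\<lambda>x. a * S f x + b * S g x))"

definition affine_iso :: "((real \<Rightarrow> real) \<Rightarrow> real \<Rightarrow> real) \<Rightarrow> (real \<Rightarrow> real) set \<Rightarrow> (real \<Rightarrow> real) set \<Rightarrow> bool" where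
  "affine_iso S V W \<longleftrightarrow> bij_betw S V W \<and>
     (\<forall>f\<in>V. \<forall>g\<in>V. \<forall>a. S (\<lambda>x. (1 - a) * f x + a * g x) = (\<lambda>x. (1 - a) * S f x + a * S g x))"

definition sup_norm :: "('a::finite) rv_datum \<Rightarrow> (real \<Rightarrow> real) \<Rightarrow> real" where
  "sup_norm P f = (SUP x\<in>base P. \<bar>f x\<bar>)"


subsection \<open>Compatible sequences\<close>

text \<open>
  The intervals containing the points \<open>\<xi> n\<close> are open: \<open>\<xi> n = 0\<close> is not allowed. So no sequence is
  compatible with a point from which some backward iteration would enter at 0.
\<close>

definition compatible :: "(int \<Rightarrow> ('a::finite) rv_datum) \<Rightarrow> real \<Rightarrow> (int \<Rightarrow> real) \<Rightarrow> bool" where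
  "compatible D \<xi>0 \<xi> \<longleftrightarrow> \<xi> 0 = \<xi>0 \<and> (\<forall>n. \<xi> n \<in> base (D n) - {0}) \<and>
     (\<forall>n' n. n' \<le> n \<longrightarrow>
        (\<exists>k. \<xi> n = (iem_inv (D n') ^^ k) (\<xi> n') \<and>
             (\<forall>j<k. (iem_inv (D n') ^^ j) (\<xi> n') \<notin> base (D n))))"

text \<open>
  If some \<open>\<xi> n\<close> is an endpoint of an interval \<open>int_top (D n) \<alpha>\<close>, then \<open>Gam_at (D n) (\<xi> n) = Gam (D n)\<close>,
  and the same holds at all later indices \<open>m\<close>. Functions in \<open>Gam (D m)\<close> corresponding to each other
  under the special Birkhoff sums are zero or grow at a nonzero exponential rate when \<open>s = 1\<close>, so in
  this case there is no section of growth rate 0.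
\<close>

definition nonsingular :: "(int \<Rightarrow> ('a::finite) rv_datum) \<Rightarrow> (int \<Rightarrow> real) \<Rightarrow> bool" where
  "nonsingular D \<xi> \<longleftrightarrow> (\<forall>n \<alpha>. \<xi> n \<noteq> left_top (D n) \<alpha>)"

definition subexponential_section ::
    "(int \<Rightarrow> ('a::finite) rv_datum) \<Rightarrow> (int \<Rightarrow> real) \<Rightarrow> (int \<Rightarrow> real \<Rightarrow> real) \<Rightarrow> bool" where
  "subexponential_section D \<xi> \<phi> \<longleftrightarrow>
     (\<forall>n. \<phi> n \<in> Gam_at (D n) (\<xi> n)) \<and>
     (\<forall>n' n. n' \<le> n \<longrightarrow> special_birkhoff D n' n (\<phi> n') = \<phi> n) \<and>
     (\<forall>F\<in>{at_top, at_bot}.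
        ((\<lambda>n. ln (sup_norm (D n) (\<phi> n)) / real_of_int (zorich D n)) \<longlongrightarrow> 0) F)"

end

theory Submission
  imports Defs
begin

text \<open>
  One step of the Rauzy--Veech algorithm acts on functions that are constant on the exchanged
  intervals by the elementary matrix of the step (\<open>special_birkhoff_step_fun\<close>), so the special Birkhoff
  sums are invertible on these spaces. The characteristic function of \<open>(0, \<xi>)\<close> is mapped to the one of
  the next compatible point, up to a step function with values between 0 and 1
  (\<open>special_birkhoff_chi_tilde\<close>). Writing an element of the affine space as this characteristic function
  plus a step function with heights \<open>v n\<close>, equivariance becomes the inhomogeneous recursion
  \<open>v (n + 1) = A n v n + c n\<close> with bounded \<open>c\<close>, and the statement is about its solutions.

  For \<open>s = 1\<close> the positive and negative exponents fill the whole space, so 0 is not an exponent, and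
  Oseledets genericity makes the cocycle hyperbolic up to subexponential factors
  (\<open>expanding_cocycle_kz\<close>). A difference of two solutions is an orbit of the cocycle, and an orbit that is
  subexponential in both time directions vanishes (\<open>bounded_solution_zero\<close>); this is uniqueness.
  Existence comes from the Green function (\<open>bounded_perturbation_solution\<close>): each \<open>c n\<close> is carried to the
  future along the negative exponents and to the past along the positive ones.

  Growth is measured in Zorich time while an inhomogeneity enters at every elementary step, so
  the sums only converge if the number of elementary steps is subexponential in Zorich time
  (\<open>time_le\<close>). This again follows from the hyperbolic estimates: a product of \<open>k\<close> elementary matrices has
  entries of total size at least \<open>k\<close>, but within one block of the same type its norm is subexponential.

  The growth rate of the solution is exactly zero and not negative because the functions have a jump
  of height 1 in the interior of an interval, provided that \<open>\<xi> n\<close> is never a left end of an interval. The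
  orbit that witnesses typicality of the initial datum coincides with the given one, since the
  backward steps are determined by the signs of the suspension vectors (\<open>rv_orbit_unique\<close>).
\<close>

section \<open>Rows of intervals and the interval exchange map\<close>

lemma sum_row_le:
  fixes v :: "'a::finite \<Rightarrow> real"
  assumes "inj p"
  shows "(\<Sum>\<beta> | (p \<beta> :: nat) \<le> p \<alpha>. v \<beta>) = (\<Sum>\<beta> | p \<beta> < p \<alpha>. v \<beta>) + v \<alpha>"
proof -
  have "{\<beta>. p \<beta> \<le> p \<alpha>} = insert \<alpha> {\<beta>. p \<beta> < p \<alpha>}"
    using assms by (auto simp: le_less dest: injD)
  then show ?thesis by simp
qed

lemma row_disjoint:
  fixes v :: "'a::finite \<Rightarrow> real"
  assumes "inj p" "\<And>\<beta>. v \<beta> > 0" "(p \<alpha> :: nat) < p \<beta>"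
  shows "(\<Sum>\<gamma> | p \<gamma> < p \<alpha>. v \<gamma>) + v \<alpha> \<le> (\<Sum>\<gamma> | p \<gamma> < p \<beta>. v \<gamma>)"
  unfolding sum_row_le[OF assms(1), symmetric]
  by (rule sum_mono2) (use assms in \<open>auto intro: less_imp_le\<close>)

lemma row_le_total:
  fixes v :: "'a::finite \<Rightarrow> real"
  assumes "inj p" "\<And>\<beta>. v \<beta> > 0"
  shows "(\<Sum>\<gamma> | (p \<gamma> :: nat) < p \<alpha>. v \<gamma>) + v \<alpha> \<le> (\<Sum>\<gamma>\<in>UNIV. v \<gamma>)"
  unfolding sum_row_le[OF assms(1), symmetric]
  by (rule sum_mono2) (use assms in \<open>auto intro: less_imp_le\<close>)

text \<open>
  The interval containing \<open>x\<close> belongs to the first letter of the row whose right end exceeds \<open>x\<close>: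
  its left end is the right end of the preceding letter.
\<close>

lemma row_cover:
  fixes v :: "'a::finite \<Rightarrow> real"
  assumes "inj p" "0 \<le> x" "x < (\<Sum>\<gamma>\<in>UNIV. v \<gamma>)"
  shows "\<exists>\<alpha>. (\<Sum>\<gamma> | (p \<gamma> :: nat) < p \<alpha>. v \<gamma>) \<le> x \<and> x < (\<Sum>\<gamma> | p \<gamma> < p \<alpha>. v \<gamma>) + v \<alpha>"
proof -
  define R where "R \<alpha> = (\<Sum>\<gamma> | p \<gamma> \<le> p \<alpha>. v \<gamma>)" for \<alpha>
  obtain \<omega> where \<omega>: "\<And>\<beta>. p \<beta> \<le> p \<omega>"
    using ex_has_greatest_nat[of "\<lambda>_. True" undefined p "Suc (Max (range p))"] by (auto simp: le_imp_less_Suc)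
  have "{\<gamma>. p \<gamma> \<le> p \<omega>} = UNIV" using \<omega> by auto
  then have "x < R \<omega>" using assms by (simp add: R_def)
  then obtain \<alpha> where \<alpha>: "x < R \<alpha>" and min: "\<And>\<beta>. x < R \<beta> \<Longrightarrow> p \<alpha> \<le> p \<beta>"
    using ex_has_least_nat[of "\<lambda>\<alpha>. x < R \<alpha>" \<omega> p] by blast
  have "(\<Sum>\<gamma> | p \<gamma> < p \<alpha>. v \<gamma>) \<le> x"
  proof (cases "{\<beta>. p \<beta> < p \<alpha>} = {}")
    case True
    then show ?thesis using assms by (simp only: sum.empty)
  next
    case False
    then obtain \<beta> where \<beta>: "p \<beta> < p \<alpha>" "\<And>\<gamma>. p \<gamma> < p \<alpha> \<Longrightarrow> p \<gamma> \<le> p \<beta>"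
      using ex_has_greatest_nat[of "\<lambda>\<beta>. p \<beta> < p \<alpha>" _ p "p \<alpha>"] by (auto intro: less_imp_le)
    then have "{\<gamma>. p \<gamma> < p \<alpha>} = {\<gamma>. p \<gamma> \<le> p \<beta>}" by force
    then have "(\<Sum>\<gamma> | p \<gamma> < p \<alpha>. v \<gamma>) = R \<beta>" by (simp add: R_def)
    with min[of \<beta>] \<beta> show ?thesis by force
  qed
  with \<alpha> show ?thesis unfolding R_def sum_row_le[OF assms(1)] by blast
qed

lemma valid_inj:
  assumes "valid_datum P"
  shows "inj (ptop P)" "inj (pbot P)"
  using assms by (auto simp: valid_datum_def irreducible_pair_def dest: bij_betw_imp_inj_on)

lemma valid_lam_pos: "valid_datum P \<Longrightarrow> lam P $ \<alpha> > 0"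
  by (simp add: valid_datum_def)

lemma valid_le_card:
  fixes P :: "('a::finite) rv_datum"
  assumes "valid_datum P"
  shows "ptop P \<alpha> \<le> CARD('a)" "pbot P \<alpha> \<le> CARD('a)"
  using assms by (auto simp: valid_datum_def irreducible_pair_def bij_betw_def)

lemma last_unique:
  fixes p :: "'a::finite \<Rightarrow> nat"
  assumes "bij_betw p UNIV {1..CARD('a)}"
  shows "p (THE \<alpha>. p \<alpha> = CARD('a)) = CARD('a)"
proof -
  have "CARD('a) \<in> range p" using assms by (simp add: bij_betw_def Suc_leI)
  moreover have "inj p" using assms by (simp add: bij_betw_def)
  ultimately have "\<exists>!\<alpha>. p \<alpha> = CARD('a)" by (metis injD rangeE)
  then show ?thesis by (rule theI')
qed

lemma last_top_eq: "valid_datum (P :: ('a::finite) rv_datum) \<Longrightarrow> ptop P (last_top P) = CARD('a)"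
  and last_bot_eq: "valid_datum P \<Longrightarrow> pbot P (last_bot P) = CARD('a)"
  unfolding last_top_def last_bot_def
  by (auto intro!: last_unique simp: valid_datum_def irreducible_pair_def)

lemma int_top_unique:
  assumes "valid_datum P" "x \<in> int_top P \<alpha>" "x \<in> int_top P \<beta>"
  shows "\<alpha> = \<beta>"
proof (rule ccontr)
  assume "\<alpha> \<noteq> \<beta>"
  then have "ptop P \<alpha> < ptop P \<beta> \<or> ptop P \<beta> < ptop P \<alpha>"
    using valid_inj[OF assms(1)] by (metis injD linorder_neqE_nat)
  then show False
    using row_disjoint[OF valid_inj(1), of P "\<lambda>\<alpha>. lam P $ \<alpha>"] assms valid_lam_pos[OF assms(1)]
    by (force simp: int_top_def left_top_def)
qed

lemma base_eq_Union_int_top: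
  assumes "valid_datum P"
  shows "base P = (\<Union>\<alpha>. int_top P \<alpha>)"
proof
  show "base P \<subseteq> (\<Union>\<alpha>. int_top P \<alpha>)"
    using row_cover[OF valid_inj(1)[OF assms], of _ "\<lambda>\<alpha>. lam P $ \<alpha>"]
    by (auto simp: base_def int_top_def left_top_def)
  have "0 \<le> left_top P \<alpha>" for \<alpha>
    unfolding left_top_def using valid_lam_pos[OF assms] by (auto intro: sum_nonneg less_imp_le)
  moreover have "left_top P \<alpha> + lam P $ \<alpha> \<le> (\<Sum>\<alpha>\<in>UNIV. lam P $ \<alpha>)" for \<alpha>
    unfolding left_top_def using assms by (intro row_le_total valid_inj valid_lam_pos)
  ultimately show "(\<Union>\<alpha>. int_top P \<alpha>) \<subseteq> base P"
    by (fastforce simp: base_def int_top_def intro: order_trans less_le_trans)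
qed

lemma int_top_subset_base: "valid_datum P \<Longrightarrow> x \<in> int_top P \<alpha> \<Longrightarrow> x \<in> base P"
  using base_eq_Union_int_top by blast

lemma left_top_mem: "valid_datum P \<Longrightarrow> left_top P \<alpha> \<in> int_top P \<alpha>"
  using valid_lam_pos by (auto simp: int_top_def)

lemma iem_on_int_top:
  assumes "valid_datum P" "x \<in> int_top P \<alpha>"
  shows "iem P x = x - left_top P \<alpha> + left_bot P \<alpha>"
proof -
  have "(THE \<alpha>. x \<in> int_top P \<alpha>) = \<alpha>"
    using assms int_top_unique by (intro the_equality) auto
  then show ?thesis by (simp add: iem_def Let_def)
qed

lemma iem_in_base:
  assumes "valid_datum P" "x \<in> base P"
  shows "iem P x \<in> base P"
proof -
  obtain \<alpha> where \<alpha>: "x \<in> int_top P \<alpha>" using assms base_eq_Union_int_top by blast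
  have "0 \<le> left_bot P \<alpha>"
    unfolding left_bot_def using valid_lam_pos[OF assms(1)] by (auto intro: sum_nonneg less_imp_le)
  moreover have "left_bot P \<alpha> + lam P $ \<alpha> \<le> (\<Sum>\<alpha>\<in>UNIV. lam P $ \<alpha>)"
    unfolding left_bot_def using assms by (intro row_le_total valid_inj valid_lam_pos)
  ultimately show ?thesis
    using iem_on_int_top[OF assms(1) \<alpha>] \<alpha> by (auto simp: base_def int_top_def)
qed

lemma inj_on_iem:
  assumes "valid_datum P"
  shows "inj_on (iem P) (base P)"
proof (rule inj_onI)
  fix x y assume xy: "x \<in> base P" "y \<in> base P" "iem P x = iem P y"
  then obtain \<alpha> \<beta> where \<alpha>\<beta>: "x \<in> int_top P \<alpha>" "y \<in> int_top P \<beta>"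
    using assms base_eq_Union_int_top by blast
  have eq: "x - left_top P \<alpha> + left_bot P \<alpha> = y - left_top P \<beta> + left_bot P \<beta>"
    using xy(3) iem_on_int_top[OF assms] \<alpha>\<beta> by simp
  have "\<not> pbot P \<alpha> < pbot P \<beta>" "\<not> pbot P \<beta> < pbot P \<alpha>"
    using row_disjoint[OF valid_inj(2), of P "\<lambda>\<alpha>. lam P $ \<alpha>" \<alpha> \<beta>]
      row_disjoint[OF valid_inj(2), of P "\<lambda>\<alpha>. lam P $ \<alpha>" \<beta> \<alpha>] eq assms valid_lam_pos[OF assms] \<alpha>\<beta>
    by (auto simp: left_bot_def int_top_def)
  then have "\<alpha> = \<beta>" using valid_inj[OF assms] by (metis injD linorder_neqE_nat)
  with eq show "x = y" by simp
qed

lemma row_unchanged: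
  fixes v :: "real ^ 'a::finite"
  assumes "\<And>\<beta>. (p \<beta> :: nat) \<le> p (winner P)"
  shows "(\<Sum>\<beta> | p \<beta> < p \<alpha>. subtract_loser P v $ \<beta>) = (\<Sum>\<beta> | p \<beta> < p \<alpha>. v $ \<beta>)"
  using assms by (intro sum.cong) (auto simp: subtract_loser_def not_less[symmetric])

lemma sum_subtract_loser:
  fixes v :: "real ^ 'a::finite"
  shows "(\<Sum>\<beta>\<in>A. subtract_loser P v $ \<beta>) =
    (\<Sum>\<beta>\<in>A. v $ \<beta>) - (if winner P \<in> A then v $ loser P else 0)"
proof -
  have "(\<Sum>\<beta>\<in>A. subtract_loser P v $ \<beta>)
      = (\<Sum>\<beta>\<in>A. v $ \<beta> - (if \<beta> = winner P then v $ loser P else 0))"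
    by (intro sum.cong) (auto simp: subtract_loser_def)
  then show ?thesis by (simp add: sum_subtractf)
qed

text \<open>
  The loser is moved right behind the winner, and the winner gives up exactly the length of the
  loser. So winner and loser together occupy the former interval of the winner, the loser at its
  end, and no other interval moves.
\<close>

lemma row_moved:
  fixes v :: "real ^ 'a::finite"
  assumes "inj p" "\<And>\<beta>. (p \<beta> :: nat) \<le> p l" "winner P \<noteq> l" "l = loser P" "\<alpha> \<noteq> l"
    and p': "p' = move_last_after p (winner P) l"
  shows "(\<Sum>\<beta> | p' \<beta> < p' \<alpha>. subtract_loser P v $ \<beta>) = (\<Sum>\<beta> | p \<beta> < p \<alpha>. v $ \<beta>)"
proof -
  have l: "\<not> p l < p \<alpha>" using assms(2)[of \<alpha>] by simp
  have ne: "p \<alpha> \<noteq> p (winner P) \<longleftrightarrow> \<alpha> \<noteq> winner P" using assms(1) by (meson inj_eq)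
  have "{\<beta>. p' \<beta> < p' \<alpha>} =
      (if p (winner P) < p \<alpha> then insert l {\<beta>. p \<beta> < p \<alpha>} else {\<beta>. p \<beta> < p \<alpha>})"
    using assms l ne by (auto simp: move_last_after_def split: if_splits)
  then show ?thesis
    using l assms(3,4) by (auto simp: sum_subtract_loser)
qed

lemma row_moved_loser:
  fixes v :: "real ^ 'a::finite"
  assumes "inj p" "\<And>\<beta>. (p \<beta> :: nat) \<le> p l" "winner P \<noteq> l" "l = loser P"
    and p': "p' = move_last_after p (winner P) l"
  shows "(\<Sum>\<beta> | p' \<beta> < p' l. subtract_loser P v $ \<beta>) =
    (\<Sum>\<beta> | p \<beta> < p (winner P). v $ \<beta>) + v $ winner P - v $ l"
proof -
  have "p (winner P) < p l" using assms by (metis injD le_neq_implies_less)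
  then have "{\<beta>. p' \<beta> < p' l} = {\<beta>. p \<beta> \<le> p (winner P)}"
    using assms by (auto simp: move_last_after_def split: if_splits)
  then show ?thesis using assms(4) by (simp add: sum_subtract_loser flip: sum_row_le[OF assms(1)])
qed

section \<open>One Rauzy--Veech step\<close>

definition total_length :: "('a::finite) rv_datum \<Rightarrow> real" where
  "total_length P = (\<Sum>\<alpha>\<in>UNIV. lam P $ \<alpha>)"

text \<open>
  Validity of the new datum is included because it is part of the definition of an orbit.
\<close>

definition steppable :: "('a::finite) rv_datum \<Rightarrow> bool" where
  "steppable P \<longleftrightarrow> valid_datum P \<and> valid_datum (rv_step P) \<and>
     lam P $ last_top P \<noteq> lam P $ last_bot P"

lemma base_eq: "base P = {0..<total_length P}"
  by (simp add: base_def total_length_def)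

lemma winner_neq_loser: "steppable P \<Longrightarrow> winner P \<noteq> loser P"
  by (auto simp: steppable_def winner_def loser_def)

lemma loser_shorter: "steppable P \<Longrightarrow> lam P $ loser P < lam P $ winner P"
  by (auto simp: steppable_def winner_def loser_def top_type_def)

lemma total_length_step: "total_length (rv_step P) = total_length P - lam P $ loser P"
  by (simp add: total_length_def rv_step_def sum_subtract_loser)

lemma lam_step:
  "lam (rv_step P) $ \<alpha> = (if \<alpha> = winner P then lam P $ \<alpha> - lam P $ loser P else lam P $ \<alpha>)"
  by (simp add: rv_step_def subtract_loser_def)

lemma right_end_last:
  assumes "valid_datum P"
  shows "left_top P (last_top P) + lam P $ last_top P = total_length P"
    and "left_bot P (last_bot P) + lam P $ last_bot P = total_length P"
  using sum_row_le[OF valid_inj(1)[OF assms], of "\<lambda>\<alpha>. lam P $ \<alpha>" "last_top P"]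
    sum_row_le[OF valid_inj(2)[OF assms], of "\<lambda>\<alpha>. lam P $ \<alpha>" "last_bot P"]
  by (simp_all add: left_top_def left_bot_def total_length_def last_top_eq last_bot_eq assms
      valid_le_card)

lemma left_ends_step:
  assumes "steppable P" "\<alpha> \<noteq> loser P"
  shows "left_top (rv_step P) \<alpha> = left_top P \<alpha>" and "left_bot (rv_step P) \<alpha> = left_bot P \<alpha>"
proof -
  have v: "valid_datum P" using assms by (simp add: steppable_def)
  have w: "winner P \<noteq> loser P" using assms by (rule_tac winner_neq_loser)
  show "left_top (rv_step P) \<alpha> = left_top P \<alpha>"
  proof (cases "top_type P")
    case True
    then show ?thesis
      by (simp add: left_top_def rv_step_def row_unchanged winner_def last_top_eq v valid_le_card)
  next
    case False
    then show ?thesis using assms w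
      by (simp add: left_top_def rv_step_def)
        (rule row_moved[OF valid_inj(1)[OF v], where l = "loser P"];
         simp add: loser_def last_top_eq v valid_le_card)
  qed
  show "left_bot (rv_step P) \<alpha> = left_bot P \<alpha>"
  proof (cases "top_type P")
    case False
    then show ?thesis
      by (simp add: left_bot_def rv_step_def row_unchanged winner_def last_bot_eq v valid_le_card)
  next
    case True
    then show ?thesis using assms w
      by (simp add: left_bot_def rv_step_def)
        (rule row_moved[OF valid_inj(2)[OF v], where l = "loser P"];
         simp add: loser_def last_bot_eq v valid_le_card)
  qed
qed

lemma left_ends_step_loser:
  assumes "steppable P"
  shows "left_top (rv_step P) (loser P) = (if top_type P then left_top P (loser P)
      else left_top P (winner P) + lam P $ winner P - lam P $ loser P)"
    and "left_bot (rv_step P) (loser P) = (if top_type P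
      then left_bot P (winner P) + lam P $ winner P - lam P $ loser P else left_bot P (loser P))"
proof -
  have v: "valid_datum P" using assms by (simp add: steppable_def)
  have w: "winner P \<noteq> loser P" using assms by (rule_tac winner_neq_loser)
  show "left_top (rv_step P) (loser P) = (if top_type P then left_top P (loser P)
      else left_top P (winner P) + lam P $ winner P - lam P $ loser P)"
  proof (cases "top_type P")
    case True
    then show ?thesis
      by (simp add: left_top_def rv_step_def row_unchanged winner_def last_top_eq v valid_le_card)
  next
    case False
    then show ?thesis using assms w
      by (simp add: left_top_def rv_step_def)
        (rule row_moved_loser[OF valid_inj(1)[OF v]];
         simp add: loser_def last_top_eq v valid_le_card)
  qed
  show "left_bot (rv_step P) (loser P) = (if top_type P
      then left_bot P (winner P) + lam P $ winner P - lam P $ loser P else left_bot P (loser P))"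
  proof (cases "top_type P")
    case False
    then show ?thesis
      by (simp add: left_bot_def rv_step_def row_unchanged winner_def last_bot_eq v valid_le_card)
  next
    case True
    then show ?thesis using assms w
      by (simp add: left_bot_def rv_step_def)
        (rule row_moved_loser[OF valid_inj(2)[OF v]];
         simp add: loser_def last_bot_eq v valid_le_card)
  qed
qed

lemma iem_step_other:
  assumes "steppable P" "x \<in> int_top (rv_step P) \<alpha>" "\<alpha> \<noteq> loser P"
  shows "x \<in> int_top P \<alpha>" and "iem P x = iem (rv_step P) x"
proof -
  have v: "valid_datum P" "valid_datum (rv_step P)" using assms by (auto simp: steppable_def)
  show x: "x \<in> int_top P \<alpha>"
    using assms valid_lam_pos[OF v(1), of "loser P"]
    by (auto simp: int_top_def left_ends_step lam_step split: if_splits)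
  show "iem P x = iem (rv_step P) x"
    using iem_on_int_top[OF v(1) x] iem_on_int_top[OF v(2) assms(2)] assms
    by (simp add: left_ends_step)
qed

text \<open>
  The points over the loser in the new datum are those that leave the shortened interval. The first
  iteration translates them onto the part that was cut off, the second one brings them back. They
  visit the old intervals of the loser and of the winner, in this order for a step of top type and in
  the opposite order for a step of bottom type.
\<close>

lemma iem_step_loser:
  assumes "steppable P" "x \<in> int_top (rv_step P) (loser P)"
  shows "x \<in> int_top P (if top_type P then loser P else winner P)"
    and "iem P x = x - left_top (rv_step P) (loser P) + total_length (rv_step P)"
    and "iem P x \<in> int_top P (if top_type P then winner P else loser P)"
    and "iem P (iem P x) = iem (rv_step P) x"
proof -
  let ?Q = "rv_step P"
  have v: "valid_datum P" "valid_datum ?Q" using assms by (auto simp: steppable_def)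
  have w: "winner P \<noteq> loser P" using assms winner_neq_loser by blast
  have lt: "lam P $ loser P < lam P $ winner P" using assms loser_shorter by blast
  have lQ: "lam ?Q $ loser P = lam P $ loser P" using w by (simp add: lam_step)
  note left = left_ends_step_loser[OF assms(1)]
  have last: "left_top P (if top_type P then winner P else loser P) +
      lam P $ (if top_type P then winner P else loser P) = total_length P"
    "left_bot P (if top_type P then loser P else winner P) +
      lam P $ (if top_type P then loser P else winner P) = total_length P"
    using right_end_last[OF v(1)] by (auto simp: winner_def loser_def)
  show x: "x \<in> int_top P (if top_type P then loser P else winner P)"
    using assms(2) lt lQ by (auto simp: int_top_def left split: if_splits)
  show Tx: "iem P x = x - left_top ?Q (loser P) + total_length ?Q"
    using iem_on_int_top[OF v(1) x] last left by (auto simp: total_length_step split: if_splits)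
  show Tx': "iem P x \<in> int_top P (if top_type P then winner P else loser P)"
    using assms(2) last lt lQ unfolding Tx by (auto simp: int_top_def total_length_step split: if_splits)
  show "iem P (iem P x) = iem ?Q x"
    using iem_on_int_top[OF v(1) Tx'] iem_on_int_top[OF v(2) assms(2)] last left Tx
    by (auto simp: total_length_step split: if_splits)
qed

lemma base_step_subset: "steppable P \<Longrightarrow> base (rv_step P) \<subseteq> base P"
  using valid_lam_pos[of P "loser P"] by (auto simp: base_eq total_length_step steppable_def)

lemma steppable_base_cases:
  assumes "steppable P" "x \<in> base (rv_step P)"
  obtains \<alpha> where "x \<in> int_top (rv_step P) \<alpha>" "\<alpha> \<noteq> loser P" | "x \<in> int_top (rv_step P) (loser P)"
  using assms base_eq_Union_int_top[of "rv_step P"] by (auto simp: steppable_def)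

lemma iem_loser_notin:
  assumes "steppable P" "x \<in> int_top (rv_step P) (loser P)"
  shows "iem P x \<in> base P - base (rv_step P)"
proof -
  have "iem P x \<in> base P"
    using iem_step_loser(3)[OF assms] assms int_top_subset_base by (auto simp: steppable_def)
  moreover have "iem P x \<ge> total_length (rv_step P)"
    unfolding iem_step_loser(2)[OF assms] using assms(2) by (auto simp: int_top_def)
  ultimately show ?thesis by (auto simp: base_eq)
qed

text \<open>
  A point of the part that was cut off therefore enters the shortened interval after exactly one
  backward iteration, and it does so over the loser.
\<close>

lemma surj_loser:
  assumes "steppable P" "y \<in> base P - base (rv_step P)"
  shows "iem_inv P y \<in> int_top (rv_step P) (loser P)" "iem P (iem_inv P y) = y"
proof -
  define x where "x = y - total_length (rv_step P) + left_top (rv_step P) (loser P)"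
  have v: "valid_datum P" "valid_datum (rv_step P)" using assms by (auto simp: steppable_def)
  have "lam (rv_step P) $ loser P = lam P $ loser P"
    using winner_neq_loser[OF assms(1)] by (simp add: lam_step)
  then have x: "x \<in> int_top (rv_step P) (loser P)"
    using assms(2) valid_lam_pos[OF v(2)]
    by (auto simp: x_def base_eq total_length_step int_top_def)
  then have Tx: "iem P x = y" by (simp add: iem_step_loser(2)[OF assms(1)] x_def)
  have "x \<in> base P" using x int_top_subset_base[OF v(2)] base_step_subset[OF assms(1)] by blast
  with Tx inj_on_iem[OF v(1)] have "iem_inv P y = x"
    unfolding iem_inv_def by (metis inv_into_f_f)
  with x Tx show "iem_inv P y \<in> int_top (rv_step P) (loser P)" "iem P (iem_inv P y) = y" by auto
qed

section \<open>First returns and special Birkhoff sums\<close>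

definition rv_sequence :: "(int \<Rightarrow> ('a::finite) rv_datum) \<Rightarrow> bool" where
  "rv_sequence D \<longleftrightarrow> (\<forall>n. steppable (D n) \<and> D (n + 1) = rv_step (D n))"

lemma rv_orbit_imp_rv_sequence: "rv_orbit P D \<Longrightarrow> rv_sequence D"
  unfolding rv_orbit_def rv_sequence_def steppable_def by metis

lemma rv_sequenceD:
  assumes "rv_sequence D"
  shows "steppable (D n)" "valid_datum (D n)" "rv_step (D n) = D (n + 1)"
  using assms by (auto simp: rv_sequence_def steppable_def)

definition first_return :: "('b \<Rightarrow> 'b) \<Rightarrow> 'b set \<Rightarrow> 'b \<Rightarrow> nat \<Rightarrow> bool" where
  "first_return f A x k \<longleftrightarrow> k > 0 \<and> (f ^^ k) x \<in> A \<and> (\<forall>j. 0 < j \<and> j < k \<longrightarrow> (f ^^ j) x \<notin> A)"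

lemma return_time_eq: "first_return (iem P) (base Q) x k \<Longrightarrow> return_time P Q x = k"
  unfolding return_time_def first_return_def by (rule Least_equality) (auto simp: not_less[symmetric])

lemma first_return_add:
  assumes "first_return f A x k" "(f ^^ k) x = y" "y \<notin> B" "B \<subseteq> A" "first_return f A y l" "(f ^^ l) y \<in> B"
  shows "first_return f B x (k + l)"
  unfolding first_return_def
proof (intro conjI allI impI)
  have eq: "(f ^^ (k + i)) x = (f ^^ i) y" for i
    using assms(2) by (metis add.commute comp_apply funpow_add)
  show "0 < k + l" using assms by (simp add: first_return_def)
  show "(f ^^ (k + l)) x \<in> B" using eq assms by simp
  fix j assume j: "0 < j \<and> j < k + l"
  consider "j < k" | "j = k" | i where "j = k + i" "0 < i" "i < l"
    using j by (metis add_less_cancel_left less_imp_add_positive linorder_neqE_nat)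
  then show "(f ^^ j) x \<notin> B"
    using assms j eq by cases (auto simp: first_return_def)
qed

text \<open>
  By induction on \<open>n\<close>: the next first return repeats the present one, and a second return is
  appended for the points over the loser.
\<close>

lemma first_return_iem:
  assumes D: "rv_sequence D" and "m \<le> n" "x \<in> base (D n)"
  shows "\<exists>k. first_return (iem (D m)) (base (D n)) x k \<and> (iem (D m) ^^ k) x = iem (D n) x"
  using assms(2,3)
proof (induction n arbitrary: x rule: int_ge_induct)
  case base
  then show ?case
    using iem_in_base[OF rv_sequenceD(2)[OF D]] by (intro exI[of _ 1]) (auto simp: first_return_def)
next
  case (step n)
  note st = rv_sequenceD[OF D, of n]
  have sub: "base (D (n + 1)) \<subseteq> base (D n)" using base_step_subset[OF st(1)] st(3) by simp
  then obtain k where k: "first_return (iem (D m)) (base (D n)) x k"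
    "(iem (D m) ^^ k) x = iem (D n) x"
    using step by blast
  have inb: "iem (D (n + 1)) x \<in> base (D (n + 1))"
    using iem_in_base[OF rv_sequenceD(2)[OF D]] step by blast
  have "x \<in> base (rv_step (D n))" using step st by simp
  from steppable_base_cases[OF st(1) this] show ?case
  proof cases
    case (1 \<alpha>)
    then have "iem (D n) x = iem (D (n + 1)) x" using iem_step_other(2) st by metis
    with k inb sub show ?thesis by (intro exI[of _ k]) (auto simp: first_return_def)
  next
    case 2
    define y where "y = iem (D n) x"
    have y: "y \<in> base (D n)" "y \<notin> base (D (n + 1))"
      using iem_loser_notin[OF st(1) 2] st(3) by (auto simp: y_def)
    have Ty: "iem (D n) y = iem (D (n + 1)) x"
      using iem_step_loser(4)[OF st(1) 2] st(3) by (simp add: y_def)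
    obtain l where l: "first_return (iem (D m)) (base (D n)) y l"
      "(iem (D m) ^^ l) y = iem (D n) y"
      using step.IH[OF y(1)] by blast
    have "first_return (iem (D m)) (base (D (n + 1))) x (k + l)"
      using first_return_add[OF k(1) _ y(2) sub l(1)] k l inb Ty by (simp add: y_def)
    moreover have "(iem (D m) ^^ (k + l)) x = iem (D (n + 1)) x"
      using k l Ty unfolding y_def by (metis add.commute comp_apply funpow_add)
    ultimately show ?thesis by blast
  qed
qed

lemma special_birkhoff_refl:
  assumes "rv_sequence D" "\<And>x. x \<notin> base (D n) \<Longrightarrow> f x = 0"
  shows "special_birkhoff D n n f = f"
proof
  fix x
  show "special_birkhoff D n n f x = f x"
  proof (cases "x \<in> base (D n)")
    case True
    then have "first_return (iem (D n)) (base (D n)) x 1"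
      using iem_in_base[OF rv_sequenceD(2)[OF assms(1)]] by (auto simp: first_return_def)
    with True show ?thesis by (simp add: special_birkhoff_def return_time_eq)
  qed (simp add: special_birkhoff_def assms)
qed

lemma special_birkhoff_outside: "x \<notin> base (D n) \<Longrightarrow> special_birkhoff D m n f x = 0"
  by (simp add: special_birkhoff_def)

lemma special_birkhoff_eq:
  assumes "x \<in> base (D n)" "first_return (iem (D m)) (base (D n)) x k"
  shows "special_birkhoff D m n f x = (\<Sum>j<k. f ((iem (D m) ^^ j) x))"
  using assms by (simp add: special_birkhoff_def return_time_eq)

lemma special_birkhoff_extend:
  assumes D: "rv_sequence D" and "m \<le> n"
  shows "x \<in> int_top (D (n + 1)) \<alpha> \<Longrightarrow> \<alpha> \<noteq> loser (D n) \<Longrightarrow>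
      special_birkhoff D m (n + 1) f x = special_birkhoff D m n f x"
    and "x \<in> int_top (D (n + 1)) (loser (D n)) \<Longrightarrow>
      special_birkhoff D m (n + 1) f x =
        special_birkhoff D m n f x + special_birkhoff D m n f (iem (D n) x)"
proof -
  note st = rv_sequenceD[OF D, of n]
  have sub: "base (D (n + 1)) \<subseteq> base (D n)" using base_step_subset[OF st(1)] st(3) by simp
  have inb: "iem (D (n + 1)) x \<in> base (D (n + 1))" if "x \<in> base (D (n + 1))"
    using iem_in_base[OF rv_sequenceD(2)[OF D]] that by blast
  {
    assume 1: "x \<in> int_top (D (n + 1)) \<alpha>" "\<alpha> \<noteq> loser (D n)"
    then have x: "x \<in> base (D (n + 1))" using int_top_subset_base rv_sequenceD(2)[OF D] by blast
    obtain k where k: "first_return (iem (D m)) (base (D n)) x k" "(iem (D m) ^^ k) x = iem (D n) x"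
      using first_return_iem[OF assms] x sub by blast
    have "iem (D n) x = iem (D (n + 1)) x" using iem_step_other(2) 1 st by metis
    with k inb x sub have "first_return (iem (D m)) (base (D (n + 1))) x k"
      by (auto simp: first_return_def)
    with k x sub show "special_birkhoff D m (n + 1) f x = special_birkhoff D m n f x"
      by (simp add: special_birkhoff_eq subset_iff)
  }
  {
    assume 2: "x \<in> int_top (D (n + 1)) (loser (D n))"
    then have x: "x \<in> base (D (n + 1))" using int_top_subset_base rv_sequenceD(2)[OF D] by blast
    obtain k where k: "first_return (iem (D m)) (base (D n)) x k" "(iem (D m) ^^ k) x = iem (D n) x"
      using first_return_iem[OF assms] x sub by blast
    define y where "y = iem (D n) x"
    have y: "y \<in> base (D n)" "y \<notin> base (D (n + 1))"
      using iem_loser_notin[OF st(1)] 2 st(3) by (auto simp: y_def)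
    have Ty: "iem (D n) y = iem (D (n + 1)) x"
      using iem_step_loser(4)[OF st(1)] 2 st(3) by (simp add: y_def)
    obtain l where l: "first_return (iem (D m)) (base (D n)) y l" "(iem (D m) ^^ l) y = iem (D n) y"
      using first_return_iem[OF assms y(1)] by blast
    have "first_return (iem (D m)) (base (D (n + 1))) x (k + l)"
      using first_return_add[OF k(1) _ y(2) sub l(1)] k l inb x Ty by (simp add: y_def)
    then have "special_birkhoff D m (n + 1) f x = (\<Sum>j<k+l. f ((iem (D m) ^^ j) x))"
      using x by (simp add: special_birkhoff_eq)
    also have "\<dots> = (\<Sum>j<k. f ((iem (D m) ^^ j) x)) + (\<Sum>j<l. f ((iem (D m) ^^ (j + k)) x))"
      by (induction l) (simp_all add: add_ac)
    also have "(\<Sum>j<l. f ((iem (D m) ^^ (j + k)) x)) = (\<Sum>j<l. f ((iem (D m) ^^ j) y))"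
      using k by (simp add: funpow_add y_def)
    also have "(\<Sum>j<k. f ((iem (D m) ^^ j) x)) = special_birkhoff D m n f x"
      using k x sub by (simp add: special_birkhoff_eq subset_iff)
    also have "(\<Sum>j<l. f ((iem (D m) ^^ j) y)) = special_birkhoff D m n f y"
      using l y by (simp add: special_birkhoff_eq)
    finally show "special_birkhoff D m (n + 1) f x =
        special_birkhoff D m n f x + special_birkhoff D m n f (iem (D n) x)"
      by (simp add: y_def)
  }
qed

lemma special_birkhoff_self:
  assumes "rv_sequence D" "x \<in> base (D n)"
  shows "special_birkhoff D n n f x = f x"
  using special_birkhoff_eq[of x D n n 1 f] assms iem_in_base[OF rv_sequenceD(2)[OF assms(1)]]
  by (auto simp: first_return_def)

lemma special_birkhoff_step:
  assumes D: "rv_sequence D"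
  shows "x \<in> int_top (D (n + 1)) \<alpha> \<Longrightarrow> \<alpha> \<noteq> loser (D n) \<Longrightarrow> special_birkhoff D n (n + 1) f x = f x"
    and "x \<in> int_top (D (n + 1)) (loser (D n)) \<Longrightarrow>
      special_birkhoff D n (n + 1) f x = f x + f (iem (D n) x)"
proof -
  have sub: "int_top (D (n + 1)) \<alpha> \<subseteq> base (D n)" for \<alpha>
    using base_step_subset[OF rv_sequenceD(1)[OF D]] rv_sequenceD(3)[OF D]
      int_top_subset_base[OF rv_sequenceD(2)[OF D]] by (metis subset_iff)
  show "x \<in> int_top (D (n + 1)) \<alpha> \<Longrightarrow> \<alpha> \<noteq> loser (D n) \<Longrightarrow> special_birkhoff D n (n + 1) f x = f x"
    using special_birkhoff_extend(1)[OF D order_refl] special_birkhoff_self[OF D] sub by (metis subsetD)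
  assume *: "x \<in> int_top (D (n + 1)) (loser (D n))"
  then have "x \<in> base (D n)" using sub by blast
  moreover then have "iem (D n) x \<in> base (D n)" using iem_in_base[OF rv_sequenceD(2)[OF D]] by blast
  ultimately show "special_birkhoff D n (n + 1) f x = f x + f (iem (D n) x)"
    using special_birkhoff_extend(2)[OF D order_refl *] special_birkhoff_self[OF D] by metis
qed

lemma special_birkhoff_Suc:
  assumes D: "rv_sequence D" and "m \<le> n"
  shows "special_birkhoff D m (n + 1) f = special_birkhoff D n (n + 1) (special_birkhoff D m n f)"
proof
  fix x
  show "special_birkhoff D m (n + 1) f x = special_birkhoff D n (n + 1) (special_birkhoff D m n f) x"
  proof (cases "x \<in> base (D (n + 1))")
    case True
    then obtain \<alpha> where "x \<in> int_top (D (n + 1)) \<alpha>"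
      using base_eq_Union_int_top[OF rv_sequenceD(2)[OF D]] by auto
    then show ?thesis
      by (cases "\<alpha> = loser (D n)")
        (simp_all add: special_birkhoff_extend[OF assms] special_birkhoff_step[OF D])
  qed (simp add: special_birkhoff_outside)
qed

lemma special_birkhoff_linear:
  "special_birkhoff D m n (\<lambda>x. a * f x + b * g x) =
    (\<lambda>x. a * special_birkhoff D m n f x + b * special_birkhoff D m n g x)"
  by (auto simp: special_birkhoff_def sum.distrib sum_distrib_left)

section \<open>Step functions and the jump at a compatible point\<close>

definition step_fun :: "('a::finite) rv_datum \<Rightarrow> real ^ 'a \<Rightarrow> real \<Rightarrow> real" where
  "step_fun P v x = (\<Sum>\<alpha>\<in>UNIV. v $ \<alpha> * indicator (int_top P \<alpha>) x)"

lemma step_fun_eq: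
  assumes "valid_datum P" "x \<in> int_top P \<alpha>"
  shows "step_fun P v x = v $ \<alpha>"
proof -
  have "v $ \<beta> * indicator (int_top P \<beta>) x = (if \<beta> = \<alpha> then v $ \<alpha> else 0)" for \<beta>
    using int_top_unique[OF assms, of \<beta>] assms(2) by (cases "x \<in> int_top P \<beta>") auto
  then show ?thesis by (simp only: step_fun_def) simp
qed

lemma step_fun_outside:
  assumes "valid_datum P" "x \<notin> base P"
  shows "step_fun P v x = 0"
proof -
  have "x \<notin> int_top P \<beta>" for \<beta>
    using int_top_subset_base[OF assms(1)] assms(2) by blast
  then have "v $ \<beta> * indicator (int_top P \<beta>) x = 0" for \<beta> by simp
  then show ?thesis by (simp only: step_fun_def sum.neutral_const)
qed

lemma eq_on_int_tops:
  assumes "valid_datum P" "\<And>x. x \<notin> base P \<Longrightarrow> f x = g x" "\<And>\<alpha> x. x \<in> int_top P \<alpha> \<Longrightarrow> f x = g x"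
  shows "f = g"
proof
  fix x
  show "f x = g x" using assms by (cases "x \<in> base P") (auto simp: base_eq_Union_int_top)
qed

lemma Gam_eq_range:
  assumes "valid_datum P"
  shows "Gam P = range (step_fun P)"
proof (intro set_eqI iffI)
  fix f assume f: "f \<in> Gam P"
  then have "\<forall>\<alpha>. \<exists>c. \<forall>x\<in>int_top P \<alpha>. f x = c" by (simp add: Gam_def)
  then obtain c where "\<And>\<alpha> x. x \<in> int_top P \<alpha> \<Longrightarrow> f x = c \<alpha>" unfolding choice_iff by blast
  then have "f = step_fun P (\<chi> \<alpha>. c \<alpha>)"
    using f by (intro eq_on_int_tops[OF assms]) (auto simp: step_fun_eq step_fun_outside assms Gam_def)
  then show "f \<in> range (step_fun P)" by blast
qed (auto simp: Gam_def step_fun_eq step_fun_outside assms)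

lemma step_fun_left_top: "valid_datum P \<Longrightarrow> step_fun P v (left_top P \<alpha>) = v $ \<alpha>"
  by (simp add: step_fun_eq left_top_mem)

lemma inj_step_fun: "valid_datum P \<Longrightarrow> inj (step_fun P)"
  by (rule injI) (simp add: vec_eq_iff flip: step_fun_left_top)

lemma step_fun_linear:
  "step_fun P (a *s v + b *s w) x = a * step_fun P v x + b * step_fun P w x"
  unfolding step_fun_def
  by (simp only: vector_add_component vector_smult_component sum.distrib sum_distrib_left
      distrib_right mult.assoc)

lemma step_matrix_mult:
  "(step_matrix P *v v) $ \<alpha> = v $ \<alpha> + (if \<alpha> = loser P then v $ winner P else 0)"
proof -
  have "(step_matrix P *v v) = v + (\<chi> \<alpha> \<beta>. if \<alpha> = loser P \<and> \<beta> = winner P then 1 else 0) *v v"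
    by (simp add: step_matrix_def matrix_vector_mult_add_rdistrib)
  moreover have "(\<Sum>j\<in>UNIV. (if \<alpha> = loser P \<and> j = winner P then 1 else 0) * v $ j) =
      (if \<alpha> = loser P then v $ winner P else 0)"
    by (simp add: if_distrib[of "\<lambda>x. x * _"] cong: if_cong)
  ultimately show ?thesis by (simp add: matrix_vector_mult_def)
qed

text \<open>
  Orbit segments over the loser visit the intervals of both the loser and the winner, all others
  have length one; this is the matrix \<open>Id + E\<close> of the step.
\<close>

lemma special_birkhoff_step_fun:
  assumes D: "rv_sequence D"
  shows "special_birkhoff D n (n + 1) (step_fun (D n) v) = step_fun (D (n + 1)) (step_matrix (D n) *v v)"
proof (rule eq_on_int_tops[of "D (n + 1)"])
  note st = rv_sequenceD[OF D]
  show "valid_datum (D (n + 1))" by (rule st)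
  fix \<alpha> x assume x: "x \<in> int_top (D (n + 1)) \<alpha>"
  show "special_birkhoff D n (n + 1) (step_fun (D n) v) x
      = step_fun (D (n + 1)) (step_matrix (D n) *v v) x"
  proof (cases "\<alpha> = loser (D n)")
    case False
    then show ?thesis
      using x iem_step_other(1)[OF st(1), of x n \<alpha>]
      by (simp add: special_birkhoff_step[OF D] step_fun_eq[OF st(2)] step_matrix_mult st(3))
  next
    case True
    then show ?thesis
      using x iem_step_loser(1,3)[OF st(1), of x n]
      by (auto simp: special_birkhoff_step[OF D] step_fun_eq[OF st(2)] step_matrix_mult st(3)
          split: if_splits)
  qed
qed (simp add: special_birkhoff_outside step_fun_outside rv_sequenceD[OF D])

lemma chi_tilde_eq: "y \<in> base P \<Longrightarrow> chi_tilde P x y = (if y < x then 1 else 0)"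
  by (auto simp: chi_tilde_def base_def indicator_def)

text \<open>
  The rule for compatible sequences moves the jump to where the special Birkhoff sum puts it. If
  \<open>\<xi> n\<close> stays in the shortened interval, the second points of the orbit segments lie to the right of
  \<open>\<xi> n\<close> and nothing changes. If \<open>\<xi> n\<close> is cut off, all first points lie to the left of \<open>\<xi> n\<close>, and
  a second point lies to the left of \<open>\<xi> n\<close> exactly if the first one lies to the left of its preimage
  \<open>\<xi> (n + 1)\<close>, which is a point over the loser.
\<close>

lemma special_birkhoff_chi_tilde:
  assumes D: "rv_sequence D" and comp: "compatible D \<xi>0 \<xi>"
  shows "\<exists>c. (\<forall>\<alpha>. 0 \<le> c $ \<alpha> \<and> c $ \<alpha> \<le> 1) \<and> special_birkhoff D n (n + 1) (chi_tilde (D n) (\<xi> n)) =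
     (\<lambda>x. chi_tilde (D (n + 1)) (\<xi> (n + 1)) x + step_fun (D (n + 1)) c x)"
proof -
  note st = rv_sequenceD[OF D]
  let ?Q = "D (n + 1)" and ?l = "loser (D n)"
  have \<xi>: "\<xi> n \<in> base (D n)" for n using comp by (simp add: compatible_def)
  obtain k where k: "\<xi> (n + 1) = (iem_inv (D n) ^^ k) (\<xi> n)"
      "\<And>j. j < k \<Longrightarrow> (iem_inv (D n) ^^ j) (\<xi> n) \<notin> base ?Q"
  proof -
    have "n \<le> n + 1" by simp
    with comp have "\<exists>k. \<xi> (n + 1) = (iem_inv (D n) ^^ k) (\<xi> n) \<and>
        (\<forall>j<k. (iem_inv (D n) ^^ j) (\<xi> n) \<notin> base ?Q)"
      unfolding compatible_def by blast
    then show ?thesis using that by blast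
  qed
  have sub: "x \<in> int_top ?Q \<alpha> \<Longrightarrow> x \<in> base ?Q" "x \<in> base ?Q \<Longrightarrow> x \<in> base (D n)" for x \<alpha>
    using base_step_subset[OF st(1), of n] st(3) int_top_subset_base[OF st(2)] by auto
  have loser_out: "iem (D n) x \<in> base (D n) - base ?Q" if "x \<in> int_top ?Q ?l" for x
    using iem_loser_notin[OF st(1), of x n] that st(3) by simp
  have outside: "special_birkhoff D n (n + 1) (chi_tilde (D n) (\<xi> n)) x =
      chi_tilde ?Q (\<xi> (n + 1)) x + step_fun ?Q c x" if "x \<notin> base ?Q" for x c
    using that by (simp add: special_birkhoff_outside step_fun_outside st(2) chi_tilde_def)
  show ?thesis
  proof (cases "\<xi> n \<in> base ?Q")
    case True
    then have "k = 0" using k(2)[of 0] by (cases k) auto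
    then have \<xi>': "\<xi> (n + 1) = \<xi> n" using k(1) by simp
    have "special_birkhoff D n (n + 1) (chi_tilde (D n) (\<xi> n)) =
        (\<lambda>x. chi_tilde ?Q (\<xi> (n + 1)) x + step_fun ?Q 0 x)"
    proof (rule eq_on_int_tops[OF st(2)[of "n + 1"]])
      fix \<alpha> x assume x: "x \<in> int_top ?Q \<alpha>"
      show "special_birkhoff D n (n + 1) (chi_tilde (D n) (\<xi> n)) x =
        chi_tilde ?Q (\<xi> (n + 1)) x + step_fun ?Q 0 x"
      proof (cases "\<alpha> = ?l")
        case False
        then show ?thesis
          using x sub by (simp add: special_birkhoff_step[OF D] step_fun_eq[OF st(2)] chi_tilde_eq \<xi>')
      next
        case l: True
        then have "\<not> iem (D n) x < \<xi> n" "iem (D n) x \<in> base (D n)"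
          using loser_out[of x] x True by (auto simp: base_eq)
        then show ?thesis
          using x l sub
          by (simp add: special_birkhoff_step(2)[OF D] step_fun_eq[OF st(2)] chi_tilde_eq \<xi>')
      qed
    qed (rule outside)
    then show ?thesis by (intro exI[of _ 0]) simp
  next
    case False
    then have \<xi>out: "\<xi> n \<in> base (D n) - base (rv_step (D n))" using \<xi> st(3) by simp
    define y where "y = iem_inv (D n) (\<xi> n)"
    have y: "y \<in> int_top ?Q ?l" "iem (D n) y = \<xi> n"
      using surj_loser[OF st(1) \<xi>out] st(3) by (auto simp: y_def)
    have "k \<noteq> 0" using k(1) \<xi>[of "n + 1"] False by (cases k) auto
    moreover have "\<not> 1 < k" using k(2)[of 1] y(1) sub by (auto simp: y_def)
    ultimately have "k = 1" by simp
    then have \<xi>': "\<xi> (n + 1) = y" using k(1) by (simp add: y_def)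
    \<comment> \<open>The first points contribute 1 everywhere. Left of the loser this is already the value of the
      new characteristic function, and over the loser the new jump comes from the second points.\<close>
    define c :: "real ^ 'a" where "c = (\<chi> \<alpha>. if \<alpha> = ?l \<or> \<not> left_top ?Q \<alpha> < y then 1 else 0)"
    have lt: "x < \<xi> n" if "x \<in> base ?Q" for x using that \<xi>out st(3) by (auto simp: base_eq)
    have "special_birkhoff D n (n + 1) (chi_tilde (D n) (\<xi> n)) =
        (\<lambda>x. chi_tilde ?Q (\<xi> (n + 1)) x + step_fun ?Q c x)"
    proof (rule eq_on_int_tops[OF st(2)[of "n + 1"]])
      fix \<alpha> x assume x: "x \<in> int_top ?Q \<alpha>"
      show "special_birkhoff D n (n + 1) (chi_tilde (D n) (\<xi> n)) x =
        chi_tilde ?Q (\<xi> (n + 1)) x + step_fun ?Q c x"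
      proof (cases "\<alpha> = ?l")
        case nl: False
        then have "y \<notin> int_top ?Q \<alpha>" using y(1) int_top_unique[OF st(2)] by blast
        then have "x < y \<longleftrightarrow> left_top ?Q \<alpha> < y" using x by (auto simp: int_top_def)
        then show ?thesis
          using x nl sub lt[of x]
          by (simp add: special_birkhoff_step[OF D] step_fun_eq[OF st(2)] chi_tilde_eq \<xi>' c_def)
      next
        case l: True
        then have "iem (D n) x < \<xi> n \<longleftrightarrow> x < y" "iem (D n) x \<in> base (D n)"
          using loser_out[of x] x y iem_step_loser(2)[OF st(1), of x n]
            iem_step_loser(2)[OF st(1), of y n] by (auto simp: st(3))
        then show ?thesis
          using x l sub lt[of x]
          by (simp add: special_birkhoff_step(2)[OF D] step_fun_eq[OF st(2)] chi_tilde_eq \<xi>' c_def)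
      qed
    qed (rule outside)
    then show ?thesis by (intro exI[of _ c]) (simp add: c_def)
  qed
qed

section \<open>Bounded perturbations of a cocycle without zero exponents\<close>

lemma summable_on_int_inverse_square:
  "(\<lambda>k::int. 1 / (1 + \<bar>real_of_int k\<bar>)\<^sup>2) summable_on UNIV"
proof -
  let ?f = "\<lambda>k::int. 1 / (1 + \<bar>real_of_int k\<bar>)\<^sup>2"
  have "summable (\<lambda>n. 1 / (real (Suc n))\<^sup>2)"
    using inverse_power_summable[of 2, where 'a=real] summable_Suc_iff[of "\<lambda>n. inverse (real n ^ 2)"]
    by (simp add: inverse_eq_divide)
  then have s: "(\<lambda>n. 1 / (1 + real n)\<^sup>2) summable_on UNIV"
    by (subst summable_on_UNIV_nonneg_real_iff) (auto simp: add.commute)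
  have "?f summable_on range int" "?f summable_on range (\<lambda>n. - int n)"
    using s by (subst summable_on_reindex; simp add: inj_on_def comp_def)+
  then have "?f summable_on range int \<union> (range (\<lambda>n. - int n) - range int)"
    by (intro summable_on_Un_disjoint) (auto intro: summable_on_subset_banach)
  moreover have "range int \<union> (range (\<lambda>n. - int n) - range int) = UNIV"
  proof -
    have "k \<in> range int \<union> range (\<lambda>n. - int n)" for k by (cases k rule: int_cases2) auto
    then show ?thesis by auto
  qed
  ultimately show ?thesis by simp
qed

lemma matrix_inv_both:
  assumes "invertible M"
  shows "M ** matrix_inv M = mat 1" and "matrix_inv M ** M = mat 1"
  using someI_ex[OF assms[unfolded invertible_def]] unfolding matrix_inv_def by blast+

text \<open>
  The matrices \<open>B n\<close> are the products of the steps \<open>A n\<close> normalised at index 0, extended to negative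
  indices by inverses, and \<open>Z\<close> is the clock in which growth is measured. The vector \<open>pr \<theta> u\<close> is the
  component of \<open>u\<close> for the exponent \<open>\<theta>\<close>. The estimate \<open>growth\<close> unites the growth rate along an
  exponent with the bound for the projections that comes from the angles: transport from \<open>m\<close> to
  \<open>n\<close> of the \<open>\<theta>\<close>-component of a vector has the expected size up to a subexponential factor, for
  either order of \<open>m\<close> and \<open>n\<close>. The two assumptions on vectors with entries at least 1 hold for
  nonnegative elementary matrices and make products of many steps large.
\<close>

locale expanding_cocycle =
  fixes A B :: "int \<Rightarrow> real ^ 'a ^ 'a::finite" and Z :: "int \<Rightarrow> int"
    and \<Lambda> :: "real set" and pr :: "real \<Rightarrow> real ^ 'a \<Rightarrow> real ^ 'a"
  assumes B_step: "B (n + 1) = A n ** B n"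
    and B_inv: "invertible (B n)"
    and Z_0: "Z 0 = 0"
    and Z_step: "Z (n + 1) = Z n \<or> Z (n + 1) = Z n + 1"
    and A_pos: "(\<And>\<alpha>. v $ \<alpha> \<ge> 1) \<Longrightarrow> (A n *v v) $ \<beta> \<ge> 1"
    and A_sum: "(\<And>\<alpha>. v $ \<alpha> \<ge> 1) \<Longrightarrow> (\<Sum>\<alpha>\<in>UNIV. (A n *v v) $ \<alpha>) \<ge> (\<Sum>\<alpha>\<in>UNIV. v $ \<alpha>) + 1"
    and finite_exponents: "finite \<Lambda>" and nonzero_exponents: "0 \<notin> \<Lambda>"
    and pr_sum: "(\<Sum>\<theta>\<in>\<Lambda>. pr \<theta> u) = u"
    and growth: "(\<epsilon> :: real) > 0 \<Longrightarrow> \<exists>C>0. \<forall>\<theta>\<in>\<Lambda>. \<forall>m n u. norm (B n *v pr \<theta> u) \<le>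
      C * exp (\<theta> * (Z n - Z m) + \<epsilon> * (\<bar>Z n\<bar> + \<bar>Z m\<bar>)) * norm (B m *v u)"
begin

definition Bi :: "int \<Rightarrow> real ^ 'a ^ 'a" where
  "Bi n = matrix_inv (B n)"

lemma B_Bi [simp]: "B n *v (Bi n *v x) = x" and Bi_B [simp]: "Bi n *v (B n *v x) = x"
  using B_inv[of n] unfolding Bi_def
  by (simp_all add: matrix_vector_mul_assoc matrix_inv_both)

lemma A_B: "A n *v (B n *v x) = B (n + 1) *v x"
  by (simp add: B_step matrix_vector_mul_assoc)

lemma A_inj:
  assumes "A n *v x = A n *v y"
  shows "x = y"
proof -
  have "B (n + 1) *v (Bi n *v x) = B (n + 1) *v (Bi n *v y)"
    using A_B[of n "Bi n *v x"] A_B[of n "Bi n *v y"] assms by simp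
  then have "Bi n *v x = Bi n *v y" using Bi_B by metis
  then show ?thesis using B_Bi by metis
qed

lemma mono_Z: "m \<le> n \<Longrightarrow> Z m \<le> Z n"
proof (induction n rule: int_ge_induct)
  case (step n)
  then show ?case using Z_step[of n] by auto
qed simp

lemma Z_between: "0 \<le> z \<and> z \<le> Z n \<or> Z n \<le> z \<and> z \<le> 0 \<Longrightarrow> z \<in> range Z"
proof (induction n arbitrary: z rule: int_induct[where k = 0])
  case base
  then show ?case using Z_0 by (auto intro: range_eqI[of _ _ 0])
next
  case (step1 n)
  have "Z n \<ge> 0" using mono_Z[of 0 n] step1 Z_0 by simp
  then consider "0 \<le> z \<and> z \<le> Z n" | "z = Z (n + 1)" using step1(3) Z_step[of n] by force
  then show ?case using step1(2) by cases auto
next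
  case (step2 n)
  have "Z n \<le> 0" using mono_Z[of n 0] step2 Z_0 by simp
  then consider "Z n \<le> z \<and> z \<le> 0" | "z = Z (n - 1)"
    using step2(3) Z_step[of "n - 1"] by force
  then show ?case using step2(2) by cases auto
qed

lemma norm_le_sum_growth:
  assumes "\<And>\<theta>. \<theta> \<in> \<Lambda> \<Longrightarrow> norm (B n *v pr \<theta> u) \<le> K \<theta>"
  shows "norm (B n *v u) \<le> (\<Sum>\<theta>\<in>\<Lambda>. K \<theta>)"
proof -
  have "B n *v u = (\<Sum>\<theta>\<in>\<Lambda>. B n *v pr \<theta> u)"
    using linear_sum[OF matrix_vector_mul_linear[of "B n"], of "\<lambda>\<theta>. pr \<theta> u" \<Lambda>]
    by (simp add: pr_sum)
  then show ?thesis using sum_norm_le[of \<Lambda> "\<lambda>\<theta>. B n *v pr \<theta> u" K] assms by simp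
qed

lemma sum_ge_time:
  assumes "m \<le> n"
  shows "(\<forall>\<alpha>. (B n *v (Bi m *v 1)) $ \<alpha> \<ge> 1) \<and> (\<Sum>\<alpha>\<in>UNIV. (B n *v (Bi m *v 1)) $ \<alpha>) \<ge> n - m"
  using assms
proof (induction n rule: int_ge_induct)
  case base
  then show ?case by simp
next
  case (step n)
  define v where "v = B n *v (Bi m *v 1)"
  have v: "v $ \<alpha> \<ge> 1" "(\<Sum>\<alpha>\<in>UNIV. v $ \<alpha>) \<ge> n - m" for \<alpha>
    using step.IH by (auto simp: v_def)
  have "B (n + 1) *v (Bi m *v 1) = A n *v v" by (simp add: A_B v_def)
  then show ?case using A_pos[OF v(1)] A_sum[OF v(1), of n] v(2) by simp
qed

text \<open>
  A product of \<open>n - m\<close> steps maps the vector with all entries 1 to a vector whose entries have a sum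
  of at least \<open>n - m\<close>. If the clock advances by at most 1 meanwhile, the norm of that vector is
  subexponential by \<open>growth\<close>, since no exponent contributes more than \<open>exp \<bar>\<theta>\<bar>\<close>. So there are few
  steps in one block.
\<close>

lemma time_gap_le:
  fixes \<epsilon> :: real
  assumes "\<epsilon> > 0"
  shows "\<exists>K>0. \<forall>m n. \<bar>Z n - Z m\<bar> \<le> 1 \<longrightarrow> \<bar>n - m\<bar> \<le> K * exp (\<epsilon> * (\<bar>Z n\<bar> + \<bar>Z m\<bar>))"
proof -
  obtain C where C: "C > 0" "\<And>\<theta> m n u. \<theta> \<in> \<Lambda> \<Longrightarrow> norm (B n *v pr \<theta> u) \<le>
      C * exp (\<theta> * (Z n - Z m) + \<epsilon> * (\<bar>Z n\<bar> + \<bar>Z m\<bar>)) * norm (B m *v u)"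
    using growth[OF assms] by blast
  define N where "N = norm (1 :: real ^ 'a)"
  define K where "K = CARD('a) * (\<Sum>\<theta>\<in>\<Lambda>. C * exp \<bar>\<theta>\<bar> * N) + 1"
  have K0: "K > 0" unfolding K_def N_def using C(1)
    by (intro add_nonneg_pos mult_nonneg_nonneg sum_nonneg) auto
  have *: "real_of_int (n - m) \<le> K * exp (\<epsilon> * (\<bar>Z n\<bar> + \<bar>Z m\<bar>))"
    if mn: "m \<le> n" "\<bar>Z n - Z m\<bar> \<le> 1" for m n
  proof -
    define u where "u = Bi m *v (1 :: real ^ 'a)"
    define E where "E = exp (\<epsilon> * (\<bar>Z n\<bar> + \<bar>Z m\<bar>))"
    have b: "norm (B n *v pr \<theta> u) \<le> C * exp \<bar>\<theta>\<bar> * N * E" if "\<theta> \<in> \<Lambda>" for \<theta>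
    proof -
      have "\<theta> * (Z n - Z m) \<le> \<bar>\<theta>\<bar> * \<bar>Z n - Z m\<bar>"
        using abs_ge_self[of "\<theta> * (Z n - Z m)"] by (simp add: abs_mult)
      also have "\<dots> \<le> \<bar>\<theta>\<bar> * 1" using mn by (intro mult_left_mono) auto
      finally have "exp (\<theta> * (Z n - Z m) + \<epsilon> * (\<bar>Z n\<bar> + \<bar>Z m\<bar>)) \<le> exp \<bar>\<theta>\<bar> * E"
        unfolding E_def exp_add[symmetric] by simp
      then have "C * exp (\<theta> * (Z n - Z m) + \<epsilon> * (\<bar>Z n\<bar> + \<bar>Z m\<bar>)) * N \<le> C * (exp \<bar>\<theta>\<bar> * E) * N"
        using C(1) by (intro mult_right_mono mult_left_mono) (auto simp: N_def)
      with C(2)[OF that, of n u m] show ?thesis by (simp add: u_def N_def mult_ac)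
    qed
    have "n - m \<le> (\<Sum>\<alpha>\<in>UNIV. (B n *v u) $ \<alpha>)" using sum_ge_time[OF mn(1)] by (simp add: u_def)
    also have "\<dots> \<le> (\<Sum>\<alpha>\<in>(UNIV :: 'a set). norm (B n *v u))"
      by (intro sum_mono) (rule order_trans[OF abs_ge_self component_le_norm_cart])
    also have "\<dots> = CARD('a) * norm (B n *v u)" by simp
    also have "\<dots> \<le> CARD('a) * (\<Sum>\<theta>\<in>\<Lambda>. C * exp \<bar>\<theta>\<bar> * N * E)"
      by (intro mult_left_mono norm_le_sum_growth b) auto
    also have "\<dots> = (K - 1) * E" by (simp add: K_def sum_distrib_right)
    also have "\<dots> \<le> K * E" by (simp add: E_def)
    finally show ?thesis by (simp add: E_def)
  qed
  have "\<bar>n - m\<bar> \<le> K * exp (\<epsilon> * (\<bar>Z n\<bar> + \<bar>Z m\<bar>))" if "\<bar>Z n - Z m\<bar> \<le> 1" for m n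
  proof (cases "m \<le> n")
    case True
    then show ?thesis using *[of m n] that by simp
  next
    case False
    then show ?thesis using *[of n m] that by (simp add: add.commute abs_minus_commute)
  qed
  with K0 show ?thesis by blast
qed

text \<open>
  Summing the preceding estimate over the blocks between 0 and \<open>n\<close>; the number \<open>\<bar>Z n\<bar>\<close> of blocks is
  absorbed by the exponential.
\<close>

lemma time_le:
  fixes \<epsilon> :: real
  assumes "\<epsilon> > 0"
  shows "\<exists>C>0. \<forall>n. 1 + \<bar>n\<bar> \<le> C * exp (\<epsilon> * \<bar>Z n\<bar>)"
proof -
  \<comment> \<open>Two thirds for the two terms \<open>\<bar>Z n\<bar>\<close> and \<open>\<bar>Z m\<bar>\<close> of \<open>time_gap_le\<close>, one third for the number of blocks.\<close>
  define \<delta> where "\<delta> = \<epsilon> / 3"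
  have \<delta>: "\<delta> > 0" using assms by (simp add: \<delta>_def)
  obtain K where K: "K > 0" "\<And>m n. \<bar>Z n - Z m\<bar> \<le> 1 \<Longrightarrow> \<bar>n - m\<bar> \<le> K * exp (\<delta> * (\<bar>Z n\<bar> + \<bar>Z m\<bar>))"
    using time_gap_le[OF \<delta>] by blast
  have *: "\<bar>n\<bar> \<le> K * (1 + real z) * exp (2 * \<delta> * z)" if "\<bar>Z n\<bar> = int z" for n and z :: nat
    using that
  proof (induction z arbitrary: n)
    case 0
    then show ?case using K(2)[of n 0] Z_0 by simp
  next
    case (Suc z)
    \<comment> \<open>One block nearer to 0 than \<open>n\<close>.\<close>
    define y where "y = Z n - sgn (Z n)"
    have y: "\<bar>y\<bar> = int z" "\<bar>Z n - y\<bar> \<le> 1" "0 \<le> y \<and> y \<le> Z n \<or> Z n \<le> y \<and> y \<le> 0"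
      using Suc.prems by (auto simp: y_def sgn_if)
    then obtain m where m: "Z m = y" using Z_between by (metis rangeE)
    have "\<bar>n\<bar> \<le> real_of_int \<bar>m\<bar> + real_of_int \<bar>n - m\<bar>" by linarith
    also have "real_of_int \<bar>n - m\<bar> \<le> K * exp (\<delta> * (\<bar>Z n\<bar> + \<bar>Z m\<bar>))"
      using K(2)[of n m] m y by simp
    also have "\<dots> \<le> K * exp (2 * \<delta> * Suc z)"
      using K(1) \<delta> m y Suc.prems by (simp add: algebra_simps)
    also have "real_of_int \<bar>m\<bar> \<le> K * (1 + real z) * exp (2 * \<delta> * z)" using Suc.IH m y by simp
    also have "\<dots> \<le> K * (1 + real z) * exp (2 * \<delta> * Suc z)"
      using K(1) \<delta> by simp
    finally show ?case by (simp add: algebra_simps)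
  qed
  define C where "C = 1 + K * (1 + 1 / \<delta>)"
  have "1 + \<bar>n\<bar> \<le> C * exp (\<epsilon> * \<bar>Z n\<bar>)" for n
  proof -
    define z where "z = nat \<bar>Z n\<bar>"
    have z: "real z = \<bar>Z n\<bar>" by (simp add: z_def)
    have "1 + real z \<le> (1 + 1 / \<delta>) * (1 + \<delta> * z)" using \<delta> by (simp add: field_simps)
    also have "\<dots> \<le> (1 + 1 / \<delta>) * exp (\<delta> * z)"
      using \<delta> by (intro mult_left_mono exp_ge_add_one_self) auto
    finally have "K * (1 + real z) * exp (2 * \<delta> * z) \<le> K * ((1 + 1 / \<delta>) * exp (\<delta> * z)) * exp (2 * \<delta> * z)"
      using K(1) by (intro mult_right_mono mult_left_mono) auto
    also have "\<dots> = K * (1 + 1 / \<delta>) * exp (\<epsilon> * z)"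
      by (simp add: \<delta>_def exp_add[symmetric] mult.assoc)
    finally have "\<bar>n\<bar> \<le> K * (1 + 1 / \<delta>) * exp (\<epsilon> * z)" using *[of n z] by (simp add: z_def)
    moreover have "1 \<le> exp (\<epsilon> * z)" using assms by simp
    ultimately show ?thesis unfolding z[symmetric] C_def
      by (simp add: distrib_right del: one_le_exp_iff)
  qed
  moreover have "C > 0" using K(1) \<delta> by (simp add: C_def add_pos_pos)
  ultimately show ?thesis by blast
qed

lemma Z_unbounded: "filterlim (\<lambda>n. real_of_int \<bar>Z n\<bar>) at_top at_top"
  "filterlim (\<lambda>n. real_of_int \<bar>Z n\<bar>) at_top at_bot"
proof -
  obtain C where C: "C > 0" "\<And>n. 1 + \<bar>n\<bar> \<le> C * exp (1 * \<bar>Z n\<bar>)"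
    using time_le[of 1] by auto
  have *: "x \<le> real_of_int \<bar>Z n\<bar>" if "\<bar>real_of_int n\<bar> \<ge> C * exp x" for n x
  proof -
    have "C * exp x \<le> C * exp \<bar>Z n\<bar>" using C(2)[of n] that by simp
    with C(1) show ?thesis by simp
  qed
  show "filterlim (\<lambda>n. real_of_int \<bar>Z n\<bar>) at_top at_top"
    unfolding filterlim_at_top
  proof
    fix x :: real
    show "\<forall>\<^sub>F n in at_top. x \<le> real_of_int \<bar>Z n\<bar>"
      using eventually_ge_at_top[of "\<lceil>C * exp x\<rceil>"]
    proof eventually_elim
      case (elim n)
      then have "C * exp x \<le> real_of_int n" by (simp add: ceiling_le_iff)
      then show ?case by (intro *) linarith
    qed
  qed
  show "filterlim (\<lambda>n. real_of_int \<bar>Z n\<bar>) at_top at_bot"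
    unfolding filterlim_at_top
  proof
    fix x :: real
    show "\<forall>\<^sub>F n in at_bot. x \<le> real_of_int \<bar>Z n\<bar>"
      using eventually_le_at_bot[of "- \<lceil>C * exp x\<rceil>"]
    proof eventually_elim
      case (elim n)
      then have "\<lceil>C * exp x\<rceil> \<le> - n" by simp
      then have "C * exp x \<le> - real_of_int n" by (simp add: ceiling_le_iff)
      then show ?case by (intro *) linarith
    qed
  qed
qed

text \<open>
  An orbit of the cocycle that is subexponential in both time directions vanishes: its component for
  a positive exponent would have to grow in the future, its component for a negative exponent in the
  past.
\<close>

lemma bounded_solution_zero:
  assumes f: "\<And>n. f (n + 1) = A n *v f n"
    and small: "\<And>(\<epsilon> :: real) F. \<epsilon> > 0 \<Longrightarrow> F \<in> {at_top, at_bot} \<Longrightarrow> \<exists>C. \<forall>\<^sub>F n in F. norm (f n) \<le> C * exp (\<epsilon> * \<bar>Z n\<bar>)"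
  shows "f n = 0"
proof -
  define u where "u = Bi 0 *v f 0"
  have fB: "f n = B n *v u" for n
  proof (induction n rule: int_induct[where k = 0])
    case (step1 n)
    then show ?case by (simp add: f A_B)
  next
    case (step2 n)
    have "A (n - 1) *v f (n - 1) = A (n - 1) *v (B (n - 1) *v u)"
      using f[of "n - 1"] A_B[of "n - 1" u] step2 by simp
    then show ?case by (rule A_inj)
  qed (simp add: u_def)
  have "B 0 *v pr \<theta> u = 0" if \<theta>: "\<theta> \<in> \<Lambda>" for \<theta>
  proof -
    \<comment> \<open>One third each for \<open>growth\<close> and for the size of \<open>f\<close>; the last third is the decay that remains.\<close>
    define \<epsilon> where "\<epsilon> = \<bar>\<theta>\<bar> / 3"
    have \<epsilon>: "\<epsilon> > 0" "\<bar>\<theta>\<bar> = 3 * \<epsilon>" using \<theta> nonzero_exponents by (auto simp: \<epsilon>_def)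
    obtain C where C: "C > 0" "\<And>m n u. norm (B n *v pr \<theta> u) \<le>
      C * exp (\<theta> * (Z n - Z m) + \<epsilon> * (\<bar>Z n\<bar> + \<bar>Z m\<bar>)) * norm (B m *v u)"
      using growth[OF \<epsilon>(1)] \<theta> by blast
    define F where "F = (if \<theta> > 0 then at_top else at_bot :: int filter)"
    obtain C' where C': "\<forall>\<^sub>F n in F. norm (f n) \<le> C' * exp (\<epsilon> * \<bar>Z n\<bar>)"
      using small[OF \<epsilon>(1), of F] unfolding F_def by (cases "\<theta> > 0") auto
    have sgn: "\<forall>\<^sub>F n in F. \<theta> * Z n = \<bar>\<theta>\<bar> * \<bar>Z n\<bar>"
    proof (cases "\<theta> > 0")
      case True
      have "\<forall>\<^sub>F n in at_top. Z n \<ge> 0"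
        using eventually_ge_at_top[of 0] by eventually_elim (use mono_Z Z_0 in metis)
      then show ?thesis using True unfolding F_def by (auto elim: eventually_mono)
    next
      case False
      have "\<forall>\<^sub>F n in at_bot. Z n \<le> 0"
        using eventually_le_at_bot[of 0] by eventually_elim (use mono_Z Z_0 in metis)
      then show ?thesis using False unfolding F_def by (auto elim: eventually_mono)
    qed
    have "\<forall>\<^sub>F n in F. norm (B 0 *v pr \<theta> u) \<le> C * C' * exp (- (\<epsilon> * \<bar>Z n\<bar>))"
      using C' sgn
    proof eventually_elim
      case (elim n)
      have "norm (B 0 *v pr \<theta> u) \<le> C * exp (- (\<theta> * Z n) + \<epsilon> * \<bar>Z n\<bar>) * norm (f n)"
        using C(2)[of 0 u n] Z_0 fB by simp
      also have "\<dots> \<le> C * exp (- (\<theta> * Z n) + \<epsilon> * \<bar>Z n\<bar>) * (C' * exp (\<epsilon> * \<bar>Z n\<bar>))"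
        using elim C(1) by (intro mult_left_mono) auto
      also have "\<dots> = C * C' * (exp (- (\<theta> * Z n) + \<epsilon> * \<bar>Z n\<bar>) * exp (\<epsilon> * \<bar>Z n\<bar>))" by simp
      also have "exp (- (\<theta> * Z n) + \<epsilon> * \<bar>Z n\<bar>) * exp (\<epsilon> * \<bar>Z n\<bar>) = exp (- (\<epsilon> * \<bar>Z n\<bar>))"
        unfolding exp_add[symmetric] elim(2) \<epsilon>(2) by simp
      finally show ?case .
    qed
    moreover have "((\<lambda>n. C * C' * exp (- (\<epsilon> * \<bar>Z n\<bar>))) \<longlongrightarrow> C * C' * 0) F"
    proof (intro tendsto_mult_left)
      have "filterlim (\<lambda>n. real_of_int \<bar>Z n\<bar>) at_top F" using Z_unbounded by (simp add: F_def)
      then have "filterlim (\<lambda>n. \<epsilon> * real_of_int \<bar>Z n\<bar>) at_top F"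
        using \<epsilon>(1) by (intro filterlim_tendsto_pos_mult_at_top[OF tendsto_const])
      then show "((\<lambda>n. exp (- (\<epsilon> * \<bar>Z n\<bar>))) \<longlongrightarrow> 0) F"
        by (intro filterlim_compose[OF exp_at_bot]) (simp add: filterlim_uminus_at_top)
    qed
    moreover have "F \<noteq> bot" by (simp add: F_def)
    ultimately have "norm (B 0 *v pr \<theta> u) \<le> C * C' * 0"
      by (intro tendsto_lowerbound[of _ _ F])
    then show ?thesis by simp
  qed
  then have "norm (B 0 *v u) \<le> (\<Sum>\<theta>\<in>\<Lambda>. 0)" by (intro norm_le_sum_growth) auto
  then have "B 0 *v u = 0" by simp
  then have "u = 0" by (metis Bi_B matrix_vector_mult_0_right)
  then show ?thesis by (simp add: fB)
qed


text \<open>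
  A vector of bounded size at index \<open>k\<close> is transported to \<open>n\<close> along the exponents that contract in
  this direction. The factor \<open>exp (- \<bar>\<theta>\<bar> * \<bar>Z n - Z k\<bar>)\<close> pays for the subexponential errors and for
  the weight \<open>1 / (1 + \<bar>k\<bar>)\<^sup>2\<close>, which is at least a constant times \<open>exp (- 2 * \<eta> * \<bar>Z k\<bar>)\<close>
  by \<open>time_le\<close>. What remains depends on \<open>n\<close> only and the weights are summable in
  \<open>k\<close>.
\<close>

lemma green_term_le:
  assumes u: "\<And>k. norm (B k *v u k) \<le> M" and "\<epsilon> > (0 :: real)"
  shows "\<exists>C>0. \<forall>n k. \<forall>\<theta>\<in>\<Lambda>. (if k \<le> n then \<theta> < 0 else \<theta> > 0) \<longrightarrow>
    norm (B n *v pr \<theta> (u k)) \<le> C * exp (\<epsilon> * \<bar>Z n\<bar>) * (1 / (1 + \<bar>real_of_int k\<bar>)\<^sup>2)"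
proof -
  \<comment> \<open>\<open>3 * \<eta>\<close> is to stay below every \<open>\<bar>\<theta>\<bar>\<close>; one \<open>\<eta>\<close> is spent in \<open>growth\<close>, two on the weight.
    Replacing \<open>\<bar>Z k\<bar>\<close> by \<open>\<bar>Z n\<bar>\<close> then leaves four of them to the factor in \<open>n\<close>.\<close>
  define \<eta> where "\<eta> = Min (insert (\<epsilon> / 4) ((\<lambda>\<theta>. \<bar>\<theta>\<bar> / 3) ` \<Lambda>))"
  have fin: "finite (insert (\<epsilon> / 4) ((\<lambda>\<theta>. \<bar>\<theta>\<bar> / 3) ` \<Lambda>))" using finite_exponents by simp
  have "\<eta> \<in> insert (\<epsilon> / 4) ((\<lambda>\<theta>. \<bar>\<theta>\<bar> / 3) ` \<Lambda>)"
    unfolding \<eta>_def by (rule Min_in[OF fin]) simp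
  then have \<eta>0: "\<eta> > 0" using assms(2) nonzero_exponents by auto
  have \<eta>\<epsilon>: "4 * \<eta> \<le> \<epsilon>" using Min_le[OF fin, of "\<epsilon> / 4"] by (simp add: \<eta>_def)
  have \<eta>\<theta>: "3 * \<eta> \<le> \<bar>\<theta>\<bar>" if "\<theta> \<in> \<Lambda>" for \<theta>
    using Min_le[OF fin, of "\<bar>\<theta>\<bar> / 3"] that by (simp add: \<eta>_def)
  obtain C where C: "C > 0" "\<And>\<theta> m n u. \<theta> \<in> \<Lambda> \<Longrightarrow> norm (B n *v pr \<theta> u) \<le>
      C * exp (\<theta> * (Z n - Z m) + \<eta> * (\<bar>Z n\<bar> + \<bar>Z m\<bar>)) * norm (B m *v u)"
    using growth[OF \<eta>0] by blast
  obtain K where K: "K > 0" "\<And>n. 1 + \<bar>n\<bar> \<le> K * exp (\<eta> * \<bar>Z n\<bar>)"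
    using time_le[OF \<eta>0] by blast
  have M: "M \<ge> 0" using norm_ge_zero u by (rule order_trans)
  have "norm (B n *v pr \<theta> (u k)) \<le>
      C * (M + 1) * K\<^sup>2 * exp (\<epsilon> * \<bar>Z n\<bar>) * (1 / (1 + \<bar>real_of_int k\<bar>)\<^sup>2)"
    if \<theta>: "\<theta> \<in> \<Lambda>" and sgn: "if k \<le> n then \<theta> < 0 else \<theta> > 0" for n k \<theta>
  proof -
    define \<Delta> where "\<Delta> = \<bar>real_of_int (Z n - Z k)\<bar>"
    have expo: "\<theta> * (Z n - Z k) = - \<bar>\<theta>\<bar> * \<Delta>"
      using sgn mono_Z[of k n] mono_Z[of n k] by (auto simp: \<Delta>_def algebra_simps split: if_splits)
    have Zk: "\<bar>real_of_int (Z k)\<bar> \<le> \<bar>Z n\<bar> + \<Delta>" by (simp add: \<Delta>_def)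
    have "(1 + \<bar>real_of_int k\<bar>)\<^sup>2 \<le> (K * exp (\<eta> * \<bar>Z k\<bar>))\<^sup>2"
      using K(2)[of k] by (intro power_mono) auto
    also have "\<dots> = K\<^sup>2 * exp (2 * \<eta> * \<bar>Z k\<bar>)"
      by (simp add: power_mult_distrib mult_ac flip: exp_of_nat_mult)
    finally have k: "1 \<le> K\<^sup>2 * exp (2 * \<eta> * \<bar>Z k\<bar>) * (1 / (1 + \<bar>real_of_int k\<bar>)\<^sup>2)"
      by (simp add: field_simps add_pos_nonneg)
    have "norm (B n *v pr \<theta> (u k)) \<le>
        C * exp (\<theta> * (Z n - Z k) + \<eta> * (\<bar>Z n\<bar> + \<bar>Z k\<bar>)) * norm (B k *v u k)"
      by (rule C(2)[OF \<theta>])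
    also have "\<dots> \<le> C * exp (\<theta> * (Z n - Z k) + \<eta> * (\<bar>Z n\<bar> + \<bar>Z k\<bar>)) * (M + 1)"
      using u[of k] C(1) by (intro mult_left_mono) auto
    also have "\<dots> \<le> (C * exp (\<theta> * (Z n - Z k) + \<eta> * (\<bar>Z n\<bar> + \<bar>Z k\<bar>)) * (M + 1)) *
        (K\<^sup>2 * exp (2 * \<eta> * \<bar>Z k\<bar>) * (1 / (1 + \<bar>real_of_int k\<bar>)\<^sup>2))"
      using k C(1) M by (subst mult_le_cancel_left1) (auto simp: mult_less_0_iff)
    also have "\<dots> = C * (M + 1) * K\<^sup>2 * exp (\<theta> * (Z n - Z k) + \<eta> * (\<bar>Z n\<bar> + \<bar>Z k\<bar>) + 2 * \<eta> * \<bar>Z k\<bar>)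
        * (1 / (1 + \<bar>real_of_int k\<bar>)\<^sup>2)"
      by (simp add: exp_add)
    also have "\<dots> \<le> C * (M + 1) * K\<^sup>2 * exp (\<epsilon> * \<bar>Z n\<bar>) * (1 / (1 + \<bar>real_of_int k\<bar>)\<^sup>2)"
    proof -
      have "3 * (\<eta> * \<bar>real_of_int (Z k)\<bar>) \<le> 3 * (\<eta> * (\<bar>Z n\<bar> + \<Delta>))"
        using Zk \<eta>0 by simp
      moreover have "3 * \<eta> * \<Delta> \<le> \<bar>\<theta>\<bar> * \<Delta>" using \<eta>\<theta>[OF \<theta>] by (intro mult_right_mono) (auto simp: \<Delta>_def)
      moreover have "4 * \<eta> * \<bar>real_of_int (Z n)\<bar> \<le> \<epsilon> * \<bar>real_of_int (Z n)\<bar>" using \<eta>\<epsilon> by (intro mult_right_mono) auto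
      ultimately have "\<theta> * (Z n - Z k) + \<eta> * (\<bar>Z n\<bar> + \<bar>Z k\<bar>) + 2 * \<eta> * \<bar>Z k\<bar> \<le> \<epsilon> * \<bar>Z n\<bar>"
        unfolding expo by (simp add: algebra_simps)
      then show ?thesis using C(1) M K(1) by (intro mult_right_mono mult_left_mono) auto
    qed
    finally show ?thesis .
  qed
  moreover have "C * (M + 1) * K\<^sup>2 > 0" using C(1) K(1) M by simp
  ultimately show ?thesis by blast
qed

text \<open>
  The solution is given by the Green function of the recursion. The inhomogeneity that enters at
  index \<open>k\<close> is split into its components; those with negative exponent are carried to the future,
  those with positive exponent are carried, with a minus sign, to the past. The contributions satisfy
  the homogeneous recursion except in the step to \<open>k\<close>, where the two halves differ by the whole
  inhomogeneity.
\<close>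

lemma bounded_perturbation_solution:
  assumes c: "\<And>n. norm (c n) \<le> M"
  shows "\<exists>f. (\<forall>n. f (n + 1) = A n *v f n + c n) \<and>
    (\<forall>\<epsilon>>0::real. \<exists>C>0. \<forall>n. norm (f n) \<le> C * exp (\<epsilon> * \<bar>Z n\<bar>))"
proof -
  define u where "u k = Bi k *v c (k - 1)" for k
  define L where "L k n = {\<theta>\<in>\<Lambda>. if k \<le> n then \<theta> < 0 else \<theta> > 0}" for k n :: int
  define h where "h n k = (if k \<le> n then 1 else -1 :: real) *\<^sub>R (\<Sum>\<theta>\<in>L k n. B n *v pr \<theta> (u k))" for n k
  define q where "q k = 1 / (1 + \<bar>real_of_int k\<bar>)\<^sup>2" for k
  have u: "norm (B k *v u k) \<le> M" for k using c by (simp add: u_def)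
  have h_le: "\<exists>C>0. \<forall>n k. norm (h n k) \<le> C * exp (\<epsilon> * \<bar>Z n\<bar>) * q k" if \<epsilon>: "\<epsilon> > 0" for \<epsilon> :: real
  proof -
    obtain C where C: "C > 0" "\<And>n k \<theta>. \<theta> \<in> L k n \<Longrightarrow>
        norm (B n *v pr \<theta> (u k)) \<le> C * exp (\<epsilon> * \<bar>Z n\<bar>) * q k"
      using green_term_le[of u M, OF u \<epsilon>] unfolding L_def q_def by blast
    have "norm (h n k) \<le> (card \<Lambda> + 1) * C * exp (\<epsilon> * \<bar>Z n\<bar>) * q k" for n k
    proof -
      have "norm (h n k) = norm (\<Sum>\<theta>\<in>L k n. B n *v pr \<theta> (u k))" by (simp add: h_def)
      also have "\<dots> \<le> (\<Sum>\<theta>\<in>L k n. C * exp (\<epsilon> * \<bar>Z n\<bar>) * q k)" by (intro sum_norm_le C(2))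
      also have "\<dots> = card (L k n) * (C * exp (\<epsilon> * \<bar>Z n\<bar>) * q k)" by simp
      also have "\<dots> \<le> (card \<Lambda> + 1) * (C * exp (\<epsilon> * \<bar>Z n\<bar>) * q k)"
        using C(1) card_mono[OF finite_exponents, of "L k n"]
        by (intro mult_right_mono) (auto simp: L_def q_def)
      finally show ?thesis by (simp add: mult_ac)
    qed
    moreover have "(card \<Lambda> + 1) * C > 0" using C(1) by simp
    ultimately show ?thesis by blast
  qed
  have q: "q summable_on UNIV" using summable_on_int_inverse_square by (simp add: q_def[abs_def])
  have q0: "q k \<ge> 0" for k by (simp add: q_def)
  have abs: "(\<lambda>k. norm (h n k)) summable_on UNIV" for n
  proof -
    obtain C where C: "C > 0" "\<And>n k. norm (h n k) \<le> C * exp (1 * \<bar>Z n\<bar>) * q k"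
      using h_le[of 1] by auto
    show ?thesis
      by (rule summable_on_comparison_test[OF summable_on_cmult_right[OF q, of "C * exp (1 * \<bar>Z n\<bar>)"]])
        (use C in auto)
  qed
  define f where "f n = infsum (h n) UNIV" for n
  have f: "(h n has_sum f n) UNIV" for n
    unfolding f_def using abs_summable_summable[OF abs] by (rule has_sum_infsum)
  have h_step: "h (n + 1) k = A n *v h n k + (if k = n + 1 then c n else 0)" for n k
  proof -
    have scale: "A n *v (r *\<^sub>R (\<Sum>\<theta>\<in>S. B n *v pr \<theta> (u k))) =
        r *\<^sub>R (\<Sum>\<theta>\<in>S. B (n + 1) *v pr \<theta> (u k))" for r S
      by (simp add: linear_cmul[OF matrix_vector_mul_linear] linear_sum[OF matrix_vector_mul_linear] A_B)
    show ?thesis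
    proof (cases "k = n + 1")
      case True
      have "(\<Sum>\<theta>\<in>\<Lambda>. B k *v pr \<theta> (u k)) = (\<Sum>\<theta>\<in>L k k. B k *v pr \<theta> (u k)) + (\<Sum>\<theta>\<in>L k n. B k *v pr \<theta> (u k))"
      proof (subst sum.union_disjoint[symmetric])
        have "\<theta> < 0 \<or> \<theta> > 0" if "\<theta> \<in> \<Lambda>" for \<theta>
          using that nonzero_exponents by (metis linorder_neqE)
        then have "\<Lambda> = L k k \<union> L k n" using True by (auto simp: L_def)
        then show "(\<Sum>\<theta>\<in>\<Lambda>. B k *v pr \<theta> (u k)) = (\<Sum>\<theta>\<in>L k k \<union> L k n. B k *v pr \<theta> (u k))"
          by simp
      qed (use True finite_exponents in \<open>auto simp: L_def\<close>)
      moreover have "(\<Sum>\<theta>\<in>\<Lambda>. B k *v pr \<theta> (u k)) = B k *v u k"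
        using linear_sum[OF matrix_vector_mul_linear[of "B k"], of "\<lambda>\<theta>. pr \<theta> (u k)" \<Lambda>]
        by (simp add: pr_sum)
      moreover have "B k *v u k = c n" using True by (simp add: u_def)
      ultimately show ?thesis using True scale[of "-1" "L k n"] by (simp add: h_def algebra_simps)
    next
      case False
      then have "L k (n + 1) = L k n" "k \<le> n + 1 \<longleftrightarrow> k \<le> n" by (auto simp: L_def)
      then show ?thesis using False by (simp add: h_def scale)
    qed
  qed
  have "f (n + 1) = A n *v f n + c n" for n
  proof -
    have "((\<lambda>k. A n *v h n k) has_sum (A n *v f n)) UNIV"
      by (rule has_sum_bounded_linear[OF matrix_vector_mul_bounded_linear f])
    moreover have "((\<lambda>k. if k = n + 1 then c n else 0) has_sum c n) UNIV"
      using has_sum_finite_neutralI[of "{n + 1}" UNIV "\<lambda>k. if k = n + 1 then c n else 0" "c n"] by simp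
    ultimately have "(h (n + 1) has_sum (A n *v f n + c n)) UNIV"
      unfolding h_step[abs_def] by (rule has_sum_add)
    with f[of "n + 1"] show ?thesis by (rule has_sum_unique)
  qed
  moreover have "\<exists>C>0. \<forall>n. norm (f n) \<le> C * exp (\<epsilon> * \<bar>Z n\<bar>)" if \<epsilon>: "\<epsilon> > 0" for \<epsilon> :: real
  proof -
    obtain C where C: "C > 0" "\<And>n k. norm (h n k) \<le> C * exp (\<epsilon> * \<bar>Z n\<bar>) * q k"
      using h_le[OF \<epsilon>] by auto
    have "norm (f n) \<le> C * (infsum q UNIV + 1) * exp (\<epsilon> * \<bar>Z n\<bar>)" for n
    proof -
      have "norm (f n) \<le> infsum (\<lambda>k. norm (h n k)) UNIV"
        unfolding f_def by (rule norm_infsum_bound[OF abs])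
      also have "\<dots> \<le> infsum (\<lambda>k. C * exp (\<epsilon> * \<bar>Z n\<bar>) * q k) UNIV"
        by (rule infsum_mono[OF abs summable_on_cmult_right[OF q] C(2)])
      also have "\<dots> = C * exp (\<epsilon> * \<bar>Z n\<bar>) * infsum q UNIV" by (rule infsum_cmult_right')
      also have "\<dots> \<le> C * exp (\<epsilon> * \<bar>Z n\<bar>) * (infsum q UNIV + 1)"
        using C(1) by (intro mult_left_mono) auto
      finally show ?thesis by (simp add: mult_ac)
    qed
    moreover have "C * (infsum q UNIV + 1) > 0"
      using C(1) infsum_nonneg[of UNIV q] q0 by (simp add: add_nonneg_pos)
    ultimately show ?thesis by blast
  qed
  ultimately show ?thesis by blast
qed

end

section \<open>The past of a datum is determined by the datum\<close>

text \<open>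
  The moved letter is found again as the one right behind \<open>w\<close>.
\<close>

lemma move_last_after_inj:
  assumes q: "q = move_last_after p w l" "q = move_last_after p' w l'"
    and ne: "l \<noteq> w" "l' \<noteq> w" and "inj q" and last: "p l = p' l'"
    and max: "\<And>\<beta>. p \<beta> \<le> p l" "\<And>\<beta>. p' \<beta> \<le> p' l'"
  shows "l = l' \<and> p = p'"
proof -
  have w: "q w = p w" by (subst q(1)) (simp add: move_last_after_def ne(1)[symmetric])
  have w': "q w = p' w" by (subst q(2)) (simp add: move_last_after_def ne(2)[symmetric])
  have "q l = q l'" using q(1) q(2) w w' by (metis move_last_after_def)
  then have l: "l = l'" using \<open>inj q\<close> by (simp add: inj_eq)
  have "p \<beta> = p' \<beta>" for \<beta>
  proof (cases "\<beta> = l")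
    case False
    have "q \<beta> = (if p w < p \<beta> then p \<beta> + 1 else p \<beta>)"
      by (subst q(1)) (simp add: move_last_after_def False)
    moreover have "q \<beta> = (if p w < p' \<beta> then p' \<beta> + 1 else p' \<beta>)"
      by (subst q(2)) (simp add: move_last_after_def False l[symmetric] w[symmetric] w'[symmetric])
    ultimately show ?thesis by (auto split: if_splits)
  qed (use l last in simp)
  with l show ?thesis by auto
qed

lemma subtract_loser_inj:
  assumes "subtract_loser P v = subtract_loser P' v'" "winner P = winner P'" "loser P = loser P'"
    "winner P \<noteq> loser P"
  shows "v = v'"
proof (rule vec_eq_iff[THEN iffD2], rule allI)
  fix \<alpha>
  have eq: "subtract_loser P v $ \<beta> = subtract_loser P' v' $ \<beta>" for \<beta> using assms(1) by simp
  show "v $ \<alpha> = v' $ \<alpha>"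
    using eq[of \<alpha>] eq[of "loser P"] assms(2-4) by (simp add: subtract_loser_def split: if_splits)
qed

lemma card_ge_2_if_steppable:
  fixes P :: "('a::finite) rv_datum"
  assumes "steppable P"
  shows "1 < CARD('a)"
  using card_mono[of UNIV "{winner P, loser P}"] winner_neq_loser[OF assms] by simp

text \<open>
  The step lowers the sum of \<open>\<tau>\<close> by the entry of the loser, which was the last letter of a row. The
  new sum is thus one of the partial sums before the step whose signs define the suspension cone.
\<close>

lemma sum_tau_step:
  fixes P :: "('a::finite) rv_datum"
  assumes P: "steppable P"
  shows "top_type P \<Longrightarrow> (\<Sum>\<alpha>\<in>UNIV. tau (rv_step P) $ \<alpha>) < 0"
    and "\<not> top_type P \<Longrightarrow> (\<Sum>\<alpha>\<in>UNIV. tau (rv_step P) $ \<alpha>) > 0"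
proof -
  have v: "valid_datum P" using P by (simp add: steppable_def)
  have cone: "(\<Sum>\<alpha> | ptop P \<alpha> < CARD('a). tau P $ \<alpha>) > 0" "(\<Sum>\<alpha> | pbot P \<alpha> < CARD('a). tau P $ \<alpha>) < 0"
    using v card_ge_2_if_steppable[OF P] by (auto simp: valid_datum_def suspension_cone_def)
  have "{\<alpha>. ptop P \<alpha> < CARD('a)} = UNIV - {last_top P}"
    using valid_le_card(1)[OF v] last_top_eq[OF v] valid_inj(1)[OF v]
    by (auto simp: less_le) (metis injD)
  moreover have "{\<alpha>. pbot P \<alpha> < CARD('a)} = UNIV - {last_bot P}"
    using valid_le_card(2)[OF v] last_bot_eq[OF v] valid_inj(2)[OF v]
    by (auto simp: less_le) (metis injD)
  ultimately have *: "(\<Sum>\<alpha>\<in>UNIV. tau P $ \<alpha>) - tau P $ last_top P > 0"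
      "(\<Sum>\<alpha>\<in>UNIV. tau P $ \<alpha>) - tau P $ last_bot P < 0"
    using cone by (simp_all add: sum_diff1)
  show "top_type P \<Longrightarrow> (\<Sum>\<alpha>\<in>UNIV. tau (rv_step P) $ \<alpha>) < 0"
    "\<not> top_type P \<Longrightarrow> (\<Sum>\<alpha>\<in>UNIV. tau (rv_step P) $ \<alpha>) > 0"
    using * by (simp_all add: rv_step_def sum_subtract_loser loser_def)
qed

text \<open>
  The sign of the sum of \<open>\<tau>\<close> reveals the type of the step. The row that the step leaves unchanged
  then shows the winner, and the other row shows the loser, which stands right behind the winner.
\<close>

lemma rv_step_inj:
  fixes P P' :: "('a::finite) rv_datum"
  assumes P: "steppable P" and P': "steppable P'" and eq: "rv_step P = rv_step P'"
  shows "P = P'"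
proof -
  have v: "valid_datum P" "valid_datum P'" "valid_datum (rv_step P)"
    using P P' by (simp_all add: steppable_def)
  have type: "top_type P = top_type P'"
    using sum_tau_step[OF P] sum_tau_step[OF P'] eq by fastforce
  have ne: "loser P \<noteq> winner P" "loser P' \<noteq> winner P'"
    using winner_neq_loser[OF P] winner_neq_loser[OF P'] by auto
  have fields: "ptop (rv_step P) = ptop (rv_step P')" "pbot (rv_step P) = pbot (rv_step P')"
    "lam (rv_step P) = lam (rv_step P')" "tau (rv_step P) = tau (rv_step P')"
    using eq by simp_all
  have "winner P = winner P' \<and> loser P = loser P' \<and> ptop P = ptop P' \<and> pbot P = pbot P'"
  proof (cases "top_type P")
    case True
    then have top: "ptop P = ptop P'" using fields(1) type by (simp add: rv_step_def)
    then have w: "winner P = winner P'" using True type by (simp add: winner_def last_top_def)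
    have "loser P = loser P' \<and> pbot P = pbot P'"
    proof (rule move_last_after_inj)
      show "pbot (rv_step P) = move_last_after (pbot P) (winner P) (loser P)"
        using True by (simp add: rv_step_def)
      show "pbot (rv_step P) = move_last_after (pbot P') (winner P) (loser P')"
        using True type fields(2) w by (simp add: rv_step_def)
      show "inj (pbot (rv_step P))" by (rule valid_inj(2)[OF v(3)])
    qed (use True type ne w v in \<open>auto simp: loser_def last_bot_eq valid_le_card\<close>)
    with w top show ?thesis by simp
  next
    case False
    then have bot: "pbot P = pbot P'" using fields(2) type by (simp add: rv_step_def)
    then have w: "winner P = winner P'" using False type by (simp add: winner_def last_bot_def)
    have "loser P = loser P' \<and> ptop P = ptop P'"
    proof (rule move_last_after_inj)
      show "ptop (rv_step P) = move_last_after (ptop P) (winner P) (loser P)"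
        using False by (simp add: rv_step_def)
      show "ptop (rv_step P) = move_last_after (ptop P') (winner P) (loser P')"
        using False type fields(1) w by (simp add: rv_step_def)
      show "inj (ptop (rv_step P))" by (rule valid_inj(1)[OF v(3)])
    qed (use False type ne w v in \<open>auto simp: loser_def last_top_eq valid_le_card\<close>)
    with w bot show ?thesis by simp
  qed
  moreover from this have "lam P = lam P'" "tau P = tau P'"
    using fields(3,4) ne by (auto simp: rv_step_def intro!: subtract_loser_inj[of P _ P'])
  ultimately show ?thesis by simp
qed

lemma rv_orbit_unique:
  assumes "rv_orbit P D" "rv_orbit P D'"
  shows "D = D'"
proof
  fix n
  have "D n = D' n"
  proof (induction n rule: int_induct[where k = 0])
    case base
    then show ?case using assms by (simp add: rv_orbit_def)
  next
    case (step1 n)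
    then show ?case using assms by (simp add: rv_orbit_def)
  next
    case (step2 n)
    have D: "rv_sequence D" "rv_sequence D'" using assms rv_orbit_imp_rv_sequence by blast+
    have "rv_step (D (n - 1)) = rv_step (D' (n - 1))"
      using rv_sequenceD(3)[OF D(1), of "n - 1"] rv_sequenceD(3)[OF D(2), of "n - 1"] step2 by simp
    then show ?case using rv_step_inj rv_sequenceD(1)[OF D(1)] rv_sequenceD(1)[OF D(2)] by blast
  qed
  then show "D n = D' n" .
qed

section \<open>The Kontsevich--Zorich cocycle and Zorich time\<close>

lemma invertible_step_matrix:
  assumes "steppable P"
  shows "invertible (step_matrix P)"
proof -
  have "v = 0" if "step_matrix P *v v = 0" for v
  proof (rule vec_eq_iff[THEN iffD2], rule allI)
    fix \<alpha>
    have *: "v $ \<beta> + (if \<beta> = loser P then v $ winner P else 0) = 0" for \<beta>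
      using that step_matrix_mult[of P v \<beta>] by simp
    show "v $ \<alpha> = 0 $ \<alpha>"
      using *[of \<alpha>] *[of "winner P"] winner_neq_loser[OF assms] by (simp split: if_splits)
  qed
  then show ?thesis using matrix_left_invertible_ker invertible_left_inverse by blast
qed

text \<open>
  Products are defined by adding factors at the late end. Negative indices of \<open>kz\<close> need the early end.
\<close>

lemma steps_matrix_shift:
  "steps_matrix D m (Suc k) = steps_matrix D (m + 1) k ** step_matrix (D m)"
proof (induction k)
  case (Suc k)
  have "steps_matrix D m (Suc (Suc k)) = step_matrix (D (m + int (Suc k))) ** steps_matrix D m (Suc k)"
    by simp
  also have "\<dots> = step_matrix (D (m + 1 + int k)) ** (steps_matrix D (m + 1) k ** step_matrix (D m))"
    unfolding Suc.IH by (simp add: algebra_simps)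
  finally show ?case by (simp add: matrix_mul_assoc)
qed simp

lemma invertible_steps_matrix:
  assumes "rv_sequence D"
  shows "invertible (steps_matrix D m k)"
proof (induction k)
  case 0
  show ?case by (simp add: invertible_def)
next
  case (Suc k)
  then show ?case by (simp add: invertible_mult invertible_step_matrix rv_sequenceD(1)[OF assms])
qed

lemma invertible_matrix_inv: "invertible M \<Longrightarrow> invertible (matrix_inv M)"
  for M :: "real ^ 'a ^ 'a::finite"
  using matrix_inv_both[of M] unfolding invertible_def by blast

lemma invertible_kz: "rv_sequence D \<Longrightarrow> invertible (kz D m n)"
  by (simp add: kz_def invertible_steps_matrix invertible_matrix_inv)

lemma kz_step:
  assumes D: "rv_sequence D"
  shows "kz D 0 (n + 1) = step_matrix (D n) ** kz D 0 n"
proof (cases "n \<ge> 0")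
  case True
  then have "nat (n + 1) = Suc (nat n)" by simp
  with True show ?thesis by (simp add: kz_def)
next
  case False
  define k where "k = nat (- n - 1)"
  have k: "n = - int (Suc k)" using False by (simp add: k_def)
  define S where "S = steps_matrix D (n + 1) k"
  have S: "invertible S" by (simp add: S_def invertible_steps_matrix D)
  have kz1: "kz D 0 (n + 1) = matrix_inv S"
  proof (cases "k = 0")
    case True
    have "matrix_inv (mat 1 :: real ^ 'a ^ 'a) = mat 1 ** matrix_inv (mat 1)" by simp
    also have "\<dots> = mat 1" by (rule matrix_inv_both) (auto simp: invertible_def)
    finally show ?thesis using True k by (simp add: kz_def S_def)
  next
    case False
    then show ?thesis using k by (simp add: kz_def S_def)
  qed
  define M where "M = steps_matrix D n (Suc k)"
  have M: "M = S ** step_matrix (D n)" unfolding M_def S_def by (rule steps_matrix_shift)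
  have Minv: "invertible M" unfolding M_def by (rule invertible_steps_matrix[OF D])
  have "step_matrix (D n) ** matrix_inv M = (matrix_inv S ** S) ** (step_matrix (D n) ** matrix_inv M)"
    using S by (simp add: matrix_inv_both)
  also have "\<dots> = matrix_inv S ** (M ** matrix_inv M)"
    unfolding M by (simp add: matrix_mul_assoc)
  also have "\<dots> = matrix_inv S" using Minv by (simp add: matrix_inv_both)
  finally have "step_matrix (D n) ** matrix_inv M = kz D 0 (n + 1)" by (simp add: kz1)
  moreover have "kz D 0 n = matrix_inv M"
  proof -
    have "nat (0 - n) = Suc k" "\<not> 0 \<le> n" using k by auto
    then show ?thesis by (simp only: kz_def M_def if_False)
  qed
  ultimately show ?thesis by simp
qed

lemma zorich_0: "zorich D 0 = 0"
  by (simp add: zorich_def)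

lemma zorich_neq_0: "n \<noteq> 0 \<Longrightarrow> zorich D n \<noteq> 0"
  by (simp add: zorich_def)

lemma zorich_step: "zorich D (n + 1) = zorich D n \<or> zorich D (n + 1) = zorich D n + 1"
proof -
  define C where "C i \<longleftrightarrow> top_type (D (i - 1)) \<noteq> top_type (D i)" for i
  have z: "zorich D n =
     (if n > 0 then 1 + int (card {i. 0 < i \<and> i < n \<and> C i})
      else if n < 0 then - (1 + int (card {i. n < i \<and> i < 0 \<and> C i})) else 0)" for n
    by (simp only: zorich_def C_def)
  consider "n = 0" | "n = -1" | "n > 0" | "n < -1" by linarith
  then show ?thesis
  proof cases
    case 1
    have empty: "{i. 0 < i \<and> i < (1::int) \<and> C i} = {}" by auto
    show ?thesis by (simp add: z 1 empty)
  next
    case 2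
    have empty: "{i. - 1 < i \<and> i < (0::int) \<and> C i} = {}" by auto
    show ?thesis by (simp add: z 2 empty)
  next
    case 3
    have "{i. 0 < i \<and> i < n + 1 \<and> C i} = (if C n then insert n else id) {i. 0 < i \<and> i < n \<and> C i}"
      using 3 by auto (metis order_le_less)
    moreover have "finite {i. 0 < i \<and> i < n \<and> C i}" by (rule finite_subset[of _ "{0..n}"]) auto
    ultimately have "card {i. 0 < i \<and> i < n + 1 \<and> C i} =
        card {i. 0 < i \<and> i < n \<and> C i} + (if C n then 1 else 0)" by simp
    with 3 show ?thesis by (simp add: z)
  next
    case 4
    have "{i. n < i \<and> i < 0 \<and> C i} =
        (if C (n + 1) then insert (n + 1) else id) {i. n + 1 < i \<and> i < 0 \<and> C i}"
      using 4 by auto (metis add.commute zless_add1_eq zle_add1_eq_le not_less order_le_less)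
    moreover have "finite {i. n + 1 < i \<and> i < 0 \<and> C i}" by (rule finite_subset[of _ "{n..0}"]) auto
    ultimately have "card {i. n < i \<and> i < 0 \<and> C i} =
        card {i. n + 1 < i \<and> i < 0 \<and> C i} + (if C (n + 1) then 1 else 0)" by simp
    with 4 show ?thesis by (simp add: z)
  qed
qed

lemma step_matrix_pos:
  assumes "\<And>\<alpha>. v $ \<alpha> \<ge> 1"
  shows "(step_matrix P *v v) $ \<beta> \<ge> 1"
    and "(\<Sum>\<alpha>\<in>UNIV. (step_matrix P *v v) $ \<alpha>) \<ge> (\<Sum>\<alpha>\<in>UNIV. v $ \<alpha>) + 1"
  using assms[of \<beta>] assms[of "winner P"] by (auto simp: step_matrix_mult sum.distrib)

section \<open>Growth rates and angles as uniform estimates\<close>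

text \<open>
  Estimates that hold near both ends of the integers hold everywhere after enlarging the constant,
  which takes care of the finitely many remaining indices.
\<close>

lemma uniform_constant_int:
  fixes Q :: "real \<Rightarrow> int \<Rightarrow> bool"
  assumes mono: "\<And>C C' n. Q C n \<Longrightarrow> C \<le> C' \<Longrightarrow> Q C' n"
    and ex: "\<And>n. \<exists>C. Q C n"
    and ev: "\<And>F. F \<in> {at_top, at_bot} \<Longrightarrow> \<forall>\<^sub>F n in F. Q K n"
  shows "\<exists>C>0. \<forall>n. Q C n"
proof -
  define c where "c n = (SOME C. Q C n)" for n
  have c: "Q (c n) n" for n unfolding c_def using ex by (rule someI_ex)
  obtain b where b: "\<And>n. n \<ge> b \<Longrightarrow> Q K n"
    using ev[of at_top] by (auto simp: eventually_at_top_linorder)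
  obtain a where a: "\<And>n. n \<le> a \<Longrightarrow> Q K n"
    using ev[of at_bot] by (auto simp: eventually_at_bot_linorder)
  define C where "C = Max (insert (max K 1) (c ` {a..b}))"
  have fin: "finite (insert (max K 1) (c ` {a..b}))" by simp
  have C: "K \<le> C" "1 \<le> C" "n \<in> {a..b} \<Longrightarrow> c n \<le> C" for n
    using Max_ge[OF fin, of "max K 1"] Max_ge[OF fin, of "c n"] unfolding C_def by simp_all
  have "Q C n" for n
  proof (cases "n \<in> {a..b}")
    case True
    then show ?thesis using mono[OF c C(3)] by blast
  next
    case False
    then have "Q K n" using a[of n] b[of n] by (cases "n \<le> a") auto
    then show ?thesis using mono C(1) by blast
  qed
  with C(2) show ?thesis by (intro exI[of _ C]) auto
qed

lemma sin_ge_third: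
  fixes x :: real
  assumes "0 \<le> x" "x \<le> pi / 2"
  shows "x / 3 \<le> sin x"
proof -
  have "x \<le> 2" using assms pi_less_4 by simp
  then have "x * x \<le> 2 * 2" using assms by (intro mult_mono) auto
  then have "x * (x * x) \<le> x * 4" using assms by (intro mult_left_mono) auto
  then have cube: "x ^ 3 \<le> 4 * x" by (simp add: power3_eq_cube mult.assoc)
  have "\<bar>sin x - (\<Sum>m<3. sin_coeff m * x ^ m)\<bar> \<le> inverse (fact 3) * \<bar>x\<bar> ^ 3"
    by (rule Maclaurin_sin_bound)
  also have "(\<Sum>m<3. sin_coeff m * x ^ m) = x" by (simp add: eval_nat_numeral sin_coeff_def)
  also have "inverse (fact 3) * \<bar>x\<bar> ^ 3 = x ^ 3 / 6"
    using assms by (simp add: fact_numeral)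
  finally show ?thesis using cube by linarith
qed

text \<open>
  An angle between unit vectors is comparable to the chord \<open>norm (u - w)\<close>, which is twice the sine of
  half the angle.
\<close>

lemma arccos_inner_le:
  fixes u w :: "'b::real_inner"
  assumes "norm u = 1" "norm w = 1"
  shows "0 \<le> arccos (u \<bullet> w)" "arccos (u \<bullet> w) \<le> 3 * norm (u - w)"
proof -
  have y: "-1 \<le> u \<bullet> w" "u \<bullet> w \<le> 1"
    using Cauchy_Schwarz_ineq2[of u w] assms by auto
  define t where "t = arccos (u \<bullet> w)"
  have t: "0 \<le> t" "t \<le> pi" "cos t = u \<bullet> w"
    using arccos_lbound[OF y] arccos_ubound[OF y] cos_arccos[OF y] by (auto simp: t_def)
  have "(norm (u - w))\<^sup>2 = 2 - 2 * cos t"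
    using assms by (simp add: power2_norm_eq_inner inner_diff_left inner_diff_right inner_commute t(3)
        norm_eq_1)
  also have "\<dots> = (2 * sin (t / 2))\<^sup>2"
    using cos_double_sin[of "t / 2"] by (simp add: power_mult_distrib)
  finally have "norm (u - w) = 2 * sin (t / 2)"
    by (rule power2_eq_imp_eq) (use t in \<open>auto intro: sin_ge_zero\<close>)
  then show "0 \<le> arccos (u \<bullet> w)" "arccos (u \<bullet> w) \<le> 3 * norm (u - w)"
    using sin_ge_third[of "t / 2"] t by (auto simp: t_def)
qed

lemma unit_vector_in_subspace:
  fixes U :: "'b::real_inner set"
  assumes "subspace U" "a \<in> U" "a \<noteq> 0"
  shows "(1 / norm a) *\<^sub>R a \<in> U" "norm ((1 / norm a) *\<^sub>R a) = 1"
  using assms by (auto intro: subspace_mul)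

lemma subspace_nonzeroE:
  assumes "subspace U" "U \<noteq> {0}"
  obtains a where "a \<in> U" "a \<noteq> 0"
  using assms subspace_0[of U] by blast

text \<open>
  The unit spheres of the subspaces are compact and disjoint. Positivity has to be known before
  limits of \<open>ln (min_angle U W)\<close> can be used, because of the convention \<open>ln 0 = 0\<close>.
\<close>

lemma min_angle_pos:
  fixes U W :: "'b::euclidean_space set"
  assumes U: "subspace U" "U \<noteq> {0}" and W: "subspace W" "W \<noteq> {0}" and UW: "U \<inter> W = {0}"
  shows "min_angle U W > 0"
proof -
  have "V \<inter> sphere 0 1 \<noteq> {}" if V: "subspace V" "V \<noteq> {0}" for V :: "'b set"
  proof -
    obtain a where "a \<in> V" "a \<noteq> 0" using subspace_nonzeroE[OF V] .
    from unit_vector_in_subspace[OF V(1) this] show ?thesis by force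
  qed
  then have ne: "U \<inter> sphere 0 1 \<noteq> {}" "W \<inter> sphere 0 1 \<noteq> {}" using U W by simp_all
  define S where "S = (U \<inter> sphere 0 1) \<times> (W \<inter> sphere 0 1)"
  have "compact S"
    unfolding S_def using U W
    by (intro compact_Times closed_Int_compact closed_subspace compact_sphere)
  moreover have "S \<noteq> {}" using ne by (simp add: S_def)
  moreover have "continuous_on S (\<lambda>p. fst p \<bullet> snd p)" by (intro continuous_intros)
  ultimately obtain p where p: "p \<in> S" "\<And>q. q \<in> S \<Longrightarrow> fst q \<bullet> snd q \<le> fst p \<bullet> snd p"
    using continuous_attains_sup[of S] by blast
  define u w where "u = fst p" and "w = snd p"
  have uw: "u \<in> U" "w \<in> W" "norm u = 1" "norm w = 1" using p(1) by (auto simp: S_def u_def w_def)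
  have "u \<noteq> w"
  proof
    assume "u = w"
    then have "u \<in> U \<inter> W" using uw by simp
    with UW uw(3) show False by simp
  qed
  have y: "-1 \<le> u \<bullet> w" "u \<bullet> w \<le> 1" using Cauchy_Schwarz_ineq2[of u w] uw by auto
  have "(norm (u - w))\<^sup>2 = 2 - 2 * (u \<bullet> w)"
    using uw by (simp add: power2_norm_eq_inner inner_diff_left inner_diff_right inner_commute norm_eq_1)
  moreover have "(norm (u - w))\<^sup>2 > 0" using \<open>u \<noteq> w\<close> by simp
  ultimately have "u \<bullet> w < 1" by simp
  then have pos: "0 < arccos (u \<bullet> w)" using arccos_less_arccos[of "u \<bullet> w" 1] y by simp
  have "arccos (u \<bullet> w) \<le> min_angle U W"
    unfolding min_angle_def
  proof (rule cInf_greatest)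
    show "{arccos (u \<bullet> w) |u w. u \<in> U \<and> w \<in> W \<and> norm u = 1 \<and> norm w = 1} \<noteq> {}" using uw by blast
    fix x assume "x \<in> {arccos (u \<bullet> w) |u w. u \<in> U \<and> w \<in> W \<and> norm u = 1 \<and> norm w = 1}"
    then obtain u' w' where x: "x = arccos (u' \<bullet> w')" "u' \<in> U" "w' \<in> W" "norm u' = 1" "norm w' = 1"
      by blast
    then have "u' \<bullet> w' \<le> u \<bullet> w" using p(2)[of "(u', w')"] by (simp add: S_def u_def w_def)
    moreover have "-1 \<le> u' \<bullet> w'" using Cauchy_Schwarz_ineq2[of u' w'] x by auto
    ultimately show "arccos (u \<bullet> w) \<le> x" using y x by (simp add: arccos_le_arccos)
  qed
  with pos show ?thesis by linarith
qed

text \<open>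
  The norm of the projection onto \<open>U\<close> along \<open>W\<close> is bounded by the inverse of the angle. With the unit
  vectors \<open>u\<close> of \<open>a\<close> and \<open>w\<close> of \<open>- b\<close>, scaling \<open>u - w\<close> by \<open>norm a\<close> gives \<open>a + b\<close> up to an error of norm
  \<open>\<bar>norm a - norm b\<bar>\<close>, which is at most \<open>norm (a + b)\<close>.
\<close>

lemma min_angle_mult_norm_le:
  fixes U W :: "'b::euclidean_space set"
  assumes U: "subspace U" and W: "subspace W" "W \<noteq> {0}" and ab: "a \<in> U" "b \<in> W"
  shows "min_angle U W * norm a \<le> 6 * norm (a + b)"
proof (cases "a = 0")
  case False
  have le: "min_angle U W \<le> 3 * norm (u - w)" if "u \<in> U" "w \<in> W" "norm u = 1" "norm w = 1" for u w
  proof -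
    have "min_angle U W \<le> arccos (u \<bullet> w)"
      unfolding min_angle_def
      by (intro cInf_lower bdd_belowI[of _ 0]) (use that arccos_inner_le(1) in blast)+
    then show ?thesis using arccos_inner_le(2)[OF that(3,4)] by linarith
  qed
  define u where "u = (1 / norm a) *\<^sub>R a"
  have u: "u \<in> U" "norm u = 1" "a = norm a *\<^sub>R u"
    using unit_vector_in_subspace[OF U ab(1) False] False by (simp_all add: u_def)
  obtain w where w: "w \<in> W" "norm w = 1" "b = - (norm b *\<^sub>R w)"
  proof (cases "b = 0")
    case True
    obtain c where c: "c \<in> W" "c \<noteq> 0" using subspace_nonzeroE[OF W] .
    show ?thesis using that unit_vector_in_subspace[OF W(1) c] True by simp
  next
    case False
    have "- b \<in> W" using W ab by (simp add: subspace_neg)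
    then show ?thesis
      using that[of "(1 / norm (- b)) *\<^sub>R (- b)"] unit_vector_in_subspace[OF W(1), of "- b"] False by simp
  qed
  have "norm a * norm (u - w) = norm (norm a *\<^sub>R (u - w))" by simp
  also have "norm a *\<^sub>R (u - w) = (a + b) + (norm b - norm a) *\<^sub>R w"
  proof -
    define r s where "r = norm a" and "s = norm b"
    have a: "a = r *\<^sub>R u" and b: "b = - (s *\<^sub>R w)" using u(3) w(3) by (simp_all add: r_def s_def)
    have "r *\<^sub>R (u - w) = (a + b) + (s - r) *\<^sub>R w" unfolding a b by (simp add: algebra_simps)
    then show ?thesis by (simp add: r_def s_def)
  qed
  also have "norm \<dots> \<le> norm (a + b) + \<bar>norm b - norm a\<bar>"
    using norm_triangle_ineq[of "a + b" "(norm b - norm a) *\<^sub>R w"] w by simp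
  also have "\<bar>norm b - norm a\<bar> \<le> norm (a + b)"
    using norm_triangle_ineq3[of b "- a"] by (simp add: add.commute)
  finally have "norm a * norm (u - w) \<le> 2 * norm (a + b)" by simp
  moreover have "min_angle U W * norm a \<le> 3 * norm (u - w) * norm a"
    using le[OF u(1) w(1) u(2) w(2)] by (intro mult_right_mono) auto
  ultimately show ?thesis by (simp add: mult_ac)
qed simp

lemma matrix_inv_cancel:
  fixes M :: "real ^ 'a ^ 'a::finite"
  assumes "invertible M"
  shows "matrix_inv M *v (M *v x) = x"
  using matrix_inv_both[OF assms] by (simp add: matrix_vector_mul_assoc)

lemma matrix_norm_bound:
  fixes M :: "real ^ 'a ^ 'a::finite"
  obtains K where "K \<ge> 0" "\<And>v. norm (M *v v) \<le> K * norm v"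
proof -
  obtain K where "\<forall>v. norm (M *v v) \<le> norm v * K"
    using bounded_linear.bounded[OF matrix_vector_mul_bounded_linear[of M]] by blast
  then have "norm (M *v v) \<le> max K 0 * norm v" for v
    by (metis max.cobounded1 mult.commute mult_right_mono norm_ge_zero order_trans)
  then show ?thesis using that[of "max K 0"] by simp
qed

text \<open>
  A growth rate that is uniform on the unit sphere gives estimates from both sides for all vectors,
  also for small \<open>\<bar>n\<bar>\<close>, where invertibility of \<open>B n\<close> suffices.
\<close>

lemma lyapunov_bounds:
  fixes B :: "int \<Rightarrow> real ^ 'a ^ 'a::finite" and Z :: "int \<Rightarrow> int" and \<epsilon> \<theta> :: real
  assumes inv: "\<And>n. invertible (B n)" and Z: "\<And>n. n \<noteq> 0 \<Longrightarrow> Z n \<noteq> 0" and E: "subspace E"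
    and lim: "\<And>F. F \<in> {at_top, at_bot} \<Longrightarrow> uniform_limit (E \<inter> sphere 0 1)
      (\<lambda>n v. ln (norm (B n *v v)) / real_of_int (Z n)) (\<lambda>v. \<theta>) F"
    and \<epsilon>: "\<epsilon> > 0"
  shows "\<exists>C>0. \<forall>n. \<forall>v\<in>E. norm (B n *v v) \<le> C * exp (\<theta> * Z n + \<epsilon> * \<bar>Z n\<bar>) * norm v \<and>
    norm v \<le> C * exp (- (\<theta> * Z n) + \<epsilon> * \<bar>Z n\<bar>) * norm (B n *v v)"
proof (rule uniform_constant_int)
  fix n
  obtain K K' where K: "K \<ge> 0" "\<And>v. norm (B n *v v) \<le> K * norm v"
    and K': "K' \<ge> 0" "\<And>v. norm (matrix_inv (B n) *v v) \<le> K' * norm v"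
    using matrix_norm_bound[of "B n"] matrix_norm_bound[of "matrix_inv (B n)"] by metis
  define e e' where "e = exp (\<theta> * Z n + \<epsilon> * \<bar>Z n\<bar>)" and "e' = exp (- (\<theta> * Z n) + \<epsilon> * \<bar>Z n\<bar>)"
  have e: "e > 0" "e' > 0" by (simp_all add: e_def e'_def)
  define C where "C = max (K / e) (K' / e')"
  have C: "K \<le> C * e" "K' \<le> C * e'" using e by (simp_all add: C_def flip: pos_divide_le_eq)
  have "norm (B n *v v) \<le> C * e * norm v" for v
    by (rule order_trans[OF K(2) mult_right_mono[OF C(1)]]) simp
  moreover have "norm v \<le> C * e' * norm (B n *v v)" for v
    using order_trans[OF K'(2) mult_right_mono[OF C(2)], of "B n *v v"]
    by (simp add: matrix_inv_cancel inv)
  ultimately show "\<exists>C. \<forall>v\<in>E. norm (B n *v v) \<le> C * exp (\<theta> * Z n + \<epsilon> * \<bar>Z n\<bar>) * norm v \<and>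
    norm v \<le> C * exp (- (\<theta> * Z n) + \<epsilon> * \<bar>Z n\<bar>) * norm (B n *v v)"
    unfolding e_def e'_def by blast
next
  fix F :: "int filter" assume F: "F \<in> {at_top, at_bot}"
  have "\<forall>\<^sub>F n in F. n \<noteq> 0"
    using F eventually_gt_at_top[of "0::int"] eventually_gt_at_bot[of "0::int"]
    by (auto elim: eventually_mono)
  moreover have "\<forall>\<^sub>F n in F. \<forall>v\<in>E \<inter> sphere 0 1. dist (ln (norm (B n *v v)) / real_of_int (Z n)) \<theta> < \<epsilon>"
    using lim[OF F] \<epsilon> by (simp add: uniform_limit_iff)
  ultimately show "\<forall>\<^sub>F n in F. \<forall>v\<in>E. norm (B n *v v) \<le> 1 * exp (\<theta> * Z n + \<epsilon> * \<bar>Z n\<bar>) * norm v \<and>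
    norm v \<le> 1 * exp (- (\<theta> * Z n) + \<epsilon> * \<bar>Z n\<bar>) * norm (B n *v v)"
  proof eventually_elim
    case (elim n)
    have Zn: "real_of_int (Z n) \<noteq> 0" using Z elim by simp
    show ?case
    proof
      fix v assume v: "v \<in> E"
      show "norm (B n *v v) \<le> 1 * exp (\<theta> * Z n + \<epsilon> * \<bar>Z n\<bar>) * norm v \<and>
        norm v \<le> 1 * exp (- (\<theta> * Z n) + \<epsilon> * \<bar>Z n\<bar>) * norm (B n *v v)"
      proof (cases "v = 0")
        case False
        define u where "u = (1 / norm v) *\<^sub>R v"
        have u: "u \<in> E" "norm u = 1" "v = norm v *\<^sub>R u"
          using unit_vector_in_subspace[OF E v False] False by (simp_all add: u_def)
        define x where "x = norm (B n *v u)"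
        have "B n *v u \<noteq> 0"
          using u(2) matrix_inv_cancel[OF inv, of n u] by (metis matrix_vector_mult_0_right norm_zero zero_neq_one)
        then have x0: "x > 0" by (simp add: x_def)
        have "\<bar>ln x / Z n - \<theta>\<bar> < \<epsilon>" using elim(2) u by (simp add: x_def dist_real_def)
        then have "\<bar>ln x / Z n - \<theta>\<bar> * \<bar>real_of_int (Z n)\<bar> \<le> \<epsilon> * \<bar>real_of_int (Z n)\<bar>"
          by (intro mult_right_mono) auto
        then have "\<bar>ln x - \<theta> * Z n\<bar> \<le> \<epsilon> * \<bar>real_of_int (Z n)\<bar>"
          using Zn by (simp add: abs_mult[symmetric] left_diff_distrib)
        then have ln: "ln x \<le> \<theta> * Z n + \<epsilon> * \<bar>Z n\<bar>" "- ln x \<le> - (\<theta> * Z n) + \<epsilon> * \<bar>Z n\<bar>" by auto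
        have x1: "x \<le> exp (\<theta> * Z n + \<epsilon> * \<bar>Z n\<bar>)" using ln(1) x0 by (metis exp_le_cancel_iff exp_ln)
        have "exp (- ln x) \<le> exp (- (\<theta> * Z n) + \<epsilon> * \<bar>Z n\<bar>)" using ln(2) by simp
        then have x2: "1 \<le> exp (- (\<theta> * Z n) + \<epsilon> * \<bar>Z n\<bar>) * x"
          using x0 by (simp add: exp_minus field_simps)
        have Bv: "norm (B n *v v) = x * norm v"
          by (subst u(3)) (simp add: linear_cmul[OF matrix_vector_mul_linear] x_def)
        show ?thesis
          using mult_right_mono[OF x1, of "norm v"] mult_right_mono[OF x2, of "norm v"]
          unfolding Bv by (simp add: mult_ac)
      qed simp
    qed
  qed
next
  fix C C' n
  assume *: "\<forall>v\<in>E. norm (B n *v v) \<le> C * exp (\<theta> * Z n + \<epsilon> * \<bar>Z n\<bar>) * norm v \<and>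
    norm v \<le> C * exp (- (\<theta> * Z n) + \<epsilon> * \<bar>Z n\<bar>) * norm (B n *v v)" and "C \<le> C'"
  have "C * exp a * norm v \<le> C' * exp a * norm v" for a and v :: "real ^ 'a"
    using \<open>C \<le> C'\<close> by (intro mult_right_mono) auto
  with * show "\<forall>v\<in>E. norm (B n *v v) \<le> C' * exp (\<theta> * Z n + \<epsilon> * \<bar>Z n\<bar>) * norm v \<and>
    norm v \<le> C' * exp (- (\<theta> * Z n) + \<epsilon> * \<bar>Z n\<bar>) * norm (B n *v v)"
    by (meson order_trans)
qed

lemma angle_bounds:
  fixes B :: "int \<Rightarrow> real ^ 'a ^ 'a::finite" and Z :: "int \<Rightarrow> int" and \<epsilon> :: real
  assumes inv: "\<And>n. invertible (B n)" and Z: "\<And>n. n \<noteq> 0 \<Longrightarrow> Z n \<noteq> 0"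
    and U: "subspace U" "U \<noteq> {0}" and W: "subspace W" "W \<noteq> {0}" and UW: "U \<inter> W = {0}"
    and lim: "\<And>F. F \<in> {at_top, at_bot} \<Longrightarrow>
      ((\<lambda>n. ln (min_angle ((*v) (B n) ` U) ((*v) (B n) ` W)) / real_of_int (Z n)) \<longlongrightarrow> 0) F"
    and \<epsilon>: "\<epsilon> > 0"
  shows "\<exists>C>0. \<forall>n. \<forall>a\<in>U. \<forall>b\<in>W. norm (B n *v a) \<le> C * exp (\<epsilon> * \<bar>Z n\<bar>) * norm (B n *v (a + b))"
proof (rule uniform_constant_int)
  define m where "m n = min_angle ((*v) (B n) ` U) ((*v) (B n) ` W)" for n
  have inj: "B n *v x = B n *v y \<longleftrightarrow> x = y" for n x y
    using matrix_inv_cancel[OF inv] by metis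
  have sub: "subspace ((*v) (B n) ` U)" "subspace ((*v) (B n) ` W)" for n
    using U W by (auto intro: linear_subspace_image)
  have ne: "(*v) (B n) ` V \<noteq> {0}" if V: "subspace V" "V \<noteq> {0}" for n and V :: "(real ^ 'a) set"
  proof -
    obtain x where "x \<in> V" "x \<noteq> 0" using subspace_nonzeroE[OF V] .
    then have "B n *v x \<in> (*v) (B n) ` V" "B n *v x \<noteq> 0" using inj[of n x 0] by auto
    then show ?thesis by blast
  qed
  have "(*v) (B n) ` U \<inter> (*v) (B n) ` W = {0}" for n
  proof -
    have "(*v) (B n) ` U \<inter> (*v) (B n) ` W = (*v) (B n) ` (U \<inter> W)"
      by (rule image_Int[symmetric]) (simp add: inj_def inj)
    then show ?thesis using UW by simp
  qed
  then have m0: "m n > 0" for n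
    unfolding m_def using U W by (intro min_angle_pos sub ne)
  have m: "m n * norm (B n *v a) \<le> 6 * norm (B n *v (a + b))" if "a \<in> U" "b \<in> W" for n a b
    using min_angle_mult_norm_le[OF sub ne[OF W], of "B n *v a" n "B n *v b"] that
    by (simp add: m_def matrix_vector_right_distrib)
  have bound: "norm (B n *v a) \<le> C * exp (\<epsilon> * \<bar>Z n\<bar>) * norm (B n *v (a + b))"
    if "6 \<le> C * exp (\<epsilon> * \<bar>Z n\<bar>) * m n" "a \<in> U" "b \<in> W" for C n a b
  proof -
    have "norm (B n *v a) \<le> 6 / m n * norm (B n *v (a + b))"
      using m[OF that(2,3), of n] m0[of n] by (simp add: field_simps)
    also have "\<dots> \<le> C * exp (\<epsilon> * \<bar>Z n\<bar>) * norm (B n *v (a + b))"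
      using that(1) m0[of n] by (intro mult_right_mono) (auto simp: pos_divide_le_eq)
    finally show ?thesis .
  qed
  {
    fix n
    have "6 \<le> 6 / (exp (\<epsilon> * \<bar>Z n\<bar>) * m n) * exp (\<epsilon> * \<bar>Z n\<bar>) * m n" using m0[of n] by simp
    then show "\<exists>C. \<forall>a\<in>U. \<forall>b\<in>W. norm (B n *v a) \<le> C * exp (\<epsilon> * \<bar>Z n\<bar>) * norm (B n *v (a + b))"
      using bound by blast
  }
  fix F :: "int filter" assume F: "F \<in> {at_top, at_bot}"
  have "\<forall>\<^sub>F n in F. n \<noteq> 0"
    using F eventually_gt_at_top[of "0::int"] eventually_gt_at_bot[of "0::int"]
    by (auto elim: eventually_mono)
  moreover have "\<forall>\<^sub>F n in F. dist (ln (m n) / real_of_int (Z n)) 0 < \<epsilon>"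
    using tendstoD[OF lim[OF F] \<epsilon>] by (simp add: m_def)
  ultimately show "\<forall>\<^sub>F n in F. \<forall>a\<in>U. \<forall>b\<in>W.
      norm (B n *v a) \<le> 6 * exp (\<epsilon> * \<bar>Z n\<bar>) * norm (B n *v (a + b))"
  proof eventually_elim
    case (elim n)
    have "real_of_int (Z n) \<noteq> 0" using Z elim by simp
    then have "\<bar>ln (m n)\<bar> < \<epsilon> * \<bar>real_of_int (Z n)\<bar>"
      using elim(2) by (simp add: dist_real_def abs_divide pos_divide_less_eq)
    then have "exp (- ln (m n)) \<le> exp (\<epsilon> * \<bar>Z n\<bar>)" by simp
    then have "6 \<le> 6 * exp (\<epsilon> * \<bar>Z n\<bar>) * m n" using m0[of n] by (simp add: exp_minus field_simps)
    then show ?case using bound by blast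
  qed
next
  fix C C' n
  assume *: "\<forall>a\<in>U. \<forall>b\<in>W. norm (B n *v a) \<le> C * exp (\<epsilon> * \<bar>Z n\<bar>) * norm (B n *v (a + b))" and "C \<le> C'"
  have "C * exp (\<epsilon> * \<bar>Z n\<bar>) * norm v \<le> C' * exp (\<epsilon> * \<bar>Z n\<bar>) * norm v" for v :: "real ^ 'a"
    using \<open>C \<le> C'\<close> by (intro mult_right_mono) auto
  with * show "\<forall>a\<in>U. \<forall>b\<in>W. norm (B n *v a) \<le> C' * exp (\<epsilon> * \<bar>Z n\<bar>) * norm (B n *v (a + b))"
    by (meson order_trans)
qed

section \<open>The Oseledets splitting\<close>

lemma span_Union_sum:
  assumes "finite K" "\<And>\<theta>. \<theta> \<in> K \<Longrightarrow> subspace (E \<theta>)" "x \<in> span (\<Union>\<theta>\<in>K. E \<theta>)"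
  shows "\<exists>w. (\<forall>\<theta>\<in>K. w \<theta> \<in> E \<theta>) \<and> x = (\<Sum>\<theta>\<in>K. w \<theta>)"
  using assms
proof (induction K arbitrary: x rule: finite_induct)
  case empty
  then show ?case by simp
next
  case (insert \<eta> K)
  have "x \<in> span (E \<eta> \<union> (\<Union>\<theta>\<in>K. E \<theta>))" using insert.prems by simp
  then obtain a b where ab: "x = a + b" "a \<in> span (E \<eta>)" "b \<in> span (\<Union>\<theta>\<in>K. E \<theta>)"
    unfolding span_Un by blast
  have a: "a \<in> E \<eta>" using ab(2) insert.prems(1)[of \<eta>] span_eq_iff by blast
  obtain w where w: "\<forall>\<theta>\<in>K. w \<theta> \<in> E \<theta>" "b = (\<Sum>\<theta>\<in>K. w \<theta>)"
    using insert.IH[OF _ ab(3)] insert.prems(1) by blast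
  have "(\<Sum>\<theta>\<in>insert \<eta> K. (w(\<eta> := a)) \<theta>) = a + (\<Sum>\<theta>\<in>K. (w(\<eta> := a)) \<theta>)"
    using insert.hyps by simp
  also have "(\<Sum>\<theta>\<in>K. (w(\<eta> := a)) \<theta>) = (\<Sum>\<theta>\<in>K. w \<theta>)"
    using insert.hyps by (intro sum.cong) auto
  finally have "x = (\<Sum>\<theta>\<in>insert \<eta> K. (w(\<eta> := a)) \<theta>)" using ab w by simp
  moreover have "\<forall>\<theta>\<in>insert \<eta> K. (w(\<eta> := a)) \<theta> \<in> E \<theta>" using a w by simp
  ultimately show ?case by blast
qed

text \<open>
  \<open>'v\<close> is the direct sum of the nonzero subspaces \<open>E \<theta>\<close> for \<open>\<theta> \<in> \<Lambda>\<close>.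
\<close>

definition splits :: "real set \<Rightarrow> (real \<Rightarrow> 'v::euclidean_space set) \<Rightarrow> bool" where
  "splits \<Lambda> E \<longleftrightarrow> finite \<Lambda> \<and> (\<forall>\<theta>\<in>\<Lambda>. subspace (E \<theta>) \<and> E \<theta> \<noteq> {0}) \<and>
     (\<forall>v. \<exists>!w. (\<forall>\<theta>\<in>\<Lambda>. w \<theta> \<in> E \<theta>) \<and> (\<forall>\<theta>. \<theta> \<notin> \<Lambda> \<longrightarrow> w \<theta> = 0) \<and> v = (\<Sum>\<theta>\<in>\<Lambda>. w \<theta>))"

text \<open>
  A common vector has two decompositions, one supported at \<open>\<eta>\<close> and one supported on \<open>K\<close>.
\<close>

lemma splits_disjoint:
  assumes S: "splits \<Lambda> E" and "\<eta> \<in> \<Lambda>" "K \<subseteq> \<Lambda>" "\<eta> \<notin> K"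
  shows "E \<eta> \<inter> span (\<Union>\<theta>\<in>K. E \<theta>) = {0}"
proof (intro equalityI subsetI)
  fix x assume x: "x \<in> E \<eta> \<inter> span (\<Union>\<theta>\<in>K. E \<theta>)"
  have sub: "subspace (E \<theta>)" if "\<theta> \<in> \<Lambda>" for \<theta>
    using S that by (simp add: splits_def)
  have fin: "finite \<Lambda>" using S by (simp add: splits_def)
  have finK: "finite K" using fin assms by (meson finite_subset)
  obtain w where w: "\<forall>\<theta>\<in>K. w \<theta> \<in> E \<theta>" "x = (\<Sum>\<theta>\<in>K. w \<theta>)"
    using span_Union_sum[OF finK, of E x] sub assms x by blast
  define w1 where "w1 \<theta> = (if \<theta> = \<eta> then x else 0)" for \<theta>
  define w2 where "w2 \<theta> = (if \<theta> \<in> K then w \<theta> else 0)" for \<theta>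
  have zero: "0 \<in> E \<theta>" if "\<theta> \<in> \<Lambda>" for \<theta> using sub[OF that] by (rule subspace_0)
  have "(\<forall>\<theta>\<in>\<Lambda>. w1 \<theta> \<in> E \<theta>) \<and> (\<forall>\<theta>. \<theta> \<notin> \<Lambda> \<longrightarrow> w1 \<theta> = 0) \<and> x = (\<Sum>\<theta>\<in>\<Lambda>. w1 \<theta>)"
    using x assms fin zero by (auto simp: w1_def)
  moreover have "(\<Sum>\<theta>\<in>\<Lambda>. w2 \<theta>) = (\<Sum>\<theta>\<in>K. w \<theta>)"
    using assms(3) fin by (simp add: w2_def sum.If_cases Int_absorb1)
  then have "(\<forall>\<theta>\<in>\<Lambda>. w2 \<theta> \<in> E \<theta>) \<and> (\<forall>\<theta>. \<theta> \<notin> \<Lambda> \<longrightarrow> w2 \<theta> = 0) \<and> x = (\<Sum>\<theta>\<in>\<Lambda>. w2 \<theta>)"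
    using w assms zero by (auto simp: w2_def)
  ultimately have "w1 = w2" using S unfolding splits_def by blast
  then have "w1 \<eta> = w2 \<eta>" by simp
  then show "x \<in> {0}" using assms by (simp add: w1_def w2_def)
next
  fix x :: 'a assume "x \<in> {0}"
  then show "x \<in> E \<eta> \<inter> span (\<Union>\<theta>\<in>K. E \<theta>)"
    using S assms by (auto simp: splits_def subspace_0 span_zero)
qed

lemma splits_dim:
  assumes S: "splits \<Lambda> E" and "finite K" "K \<subseteq> \<Lambda>"
  shows "dim (span (\<Union>\<theta>\<in>K. E \<theta>)) = (\<Sum>\<theta>\<in>K. dim (E \<theta>))"
  using assms(2,3)
proof (induction K rule: finite_induct)
  case (insert \<eta> K)
  let ?V = "span (\<Union>\<theta>\<in>K. E \<theta>)"
  have sub: "subspace (E \<eta>)" using S insert by (simp add: splits_def)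
  then have span_E: "span (E \<eta>) = E \<eta>" by simp
  have "span (\<Union>\<theta>\<in>insert \<eta> K. E \<theta>) = {a + b | a b. a \<in> E \<eta> \<and> b \<in> ?V}"
    by (simp add: span_Un span_E)
  moreover have "dim {a + b | a b. a \<in> E \<eta> \<and> b \<in> ?V} + dim (E \<eta> \<inter> ?V) = dim (E \<eta>) + dim ?V"
    by (rule dim_sums_Int[OF sub subspace_span])
  moreover have "E \<eta> \<inter> ?V = {0}" using insert by (intro splits_disjoint[OF S]) auto
  ultimately show ?case using insert by (simp del: dim_span)
qed simp

text \<open>
  If the positive and negative exponents already account for the full dimension, there is no room for
  a nonzero subspace with exponent 0. This is where \<open>s = 1\<close> enters.
\<close>

lemma splits_nonzero_exponents:
  fixes E :: "real \<Rightarrow> (real ^ 'a::finite) set"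
  assumes S: "splits \<Lambda> E"
    and full: "(\<Sum>\<theta> | \<theta> \<in> \<Lambda> \<and> \<theta> > 0. dim (E \<theta>)) + (\<Sum>\<theta> | \<theta> \<in> \<Lambda> \<and> \<theta> < 0. dim (E \<theta>)) = CARD('a)"
  shows "0 \<notin> \<Lambda>"
proof
  assume 0: "0 \<in> \<Lambda>"
  have fin: "finite \<Lambda>" using S by (simp add: splits_def)
  have "\<Lambda> = {0} \<union> ({\<theta>. \<theta> \<in> \<Lambda> \<and> \<theta> > 0} \<union> {\<theta>. \<theta> \<in> \<Lambda> \<and> \<theta> < 0})" using 0 by auto
  then have "(\<Sum>\<theta>\<in>\<Lambda>. dim (E \<theta>)) =
      (\<Sum>\<theta>\<in>{0} \<union> ({\<theta>. \<theta> \<in> \<Lambda> \<and> \<theta> > 0} \<union> {\<theta>. \<theta> \<in> \<Lambda> \<and> \<theta> < 0}). dim (E \<theta>))" by simp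
  also have "\<dots> = dim (E 0) + CARD('a)"
    using fin by (subst sum.union_disjoint, simp, simp, simp, subst sum.union_disjoint) (auto simp: full)
  finally have "dim (span (\<Union>\<theta>\<in>\<Lambda>. E \<theta>)) = dim (E 0) + CARD('a)"
    by (simp only: splits_dim[OF S fin subset_refl])
  moreover have "dim (E 0) \<noteq> 0"
    using S 0 subspace_0[of "E 0"] by (auto simp: splits_def dim_eq_0)
  ultimately have "CARD('a) < dim (span (\<Union>\<theta>\<in>\<Lambda>. E \<theta>))" by linarith
  then show False using dim_subset_UNIV_cart[of "span (\<Union>\<theta>\<in>\<Lambda>. E \<theta>)"] by simp
qed

text \<open>
  Transport from \<open>m\<close> to \<open>n\<close> passes through index 0: projecting at \<open>m\<close> costs the inverse of the angle
  between \<open>E \<theta>\<close> and the sum of the other subspaces, going back to 0 and on to \<open>n\<close> is controlled by the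
  two halves of \<open>lyapunov_bounds\<close>.
\<close>

lemma splitting_growth:
  fixes B :: "int \<Rightarrow> real ^ 'a ^ 'a::finite" and Z :: "int \<Rightarrow> int" and \<epsilon> :: real
    and pr :: "real \<Rightarrow> real ^ 'a \<Rightarrow> real ^ 'a"
  assumes inv: "\<And>n. invertible (B n)" and Z: "\<And>n. n \<noteq> 0 \<Longrightarrow> Z n \<noteq> 0"
    and S: "splits \<Lambda> E"
    and lim: "\<And>F \<theta>. F \<in> {at_top, at_bot} \<Longrightarrow> \<theta> \<in> \<Lambda> \<Longrightarrow> uniform_limit (E \<theta> \<inter> sphere 0 1)
      (\<lambda>n v. ln (norm (B n *v v)) / real_of_int (Z n)) (\<lambda>v. \<theta>) F"
    and angle: "\<And>F J K. F \<in> {at_top, at_bot} \<Longrightarrow> J \<subseteq> \<Lambda> \<Longrightarrow> K \<subseteq> \<Lambda> \<Longrightarrow> J \<noteq> {} \<Longrightarrow> K \<noteq> {} \<Longrightarrow> J \<inter> K = {} \<Longrightarrow>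
      ((\<lambda>n. ln (min_angle ((*v) (B n) ` span (\<Union>\<theta>\<in>J. E \<theta>)) ((*v) (B n) ` span (\<Union>\<theta>\<in>K. E \<theta>)))
         / real_of_int (Z n)) \<longlongrightarrow> 0) F"
    and comp: "\<And>\<theta> u. \<theta> \<in> \<Lambda> \<Longrightarrow> pr \<theta> u \<in> E \<theta>" "\<And>u. (\<Sum>\<theta>\<in>\<Lambda>. pr \<theta> u) = u"
    and \<epsilon>: "\<epsilon> > 0"
  shows "\<exists>C>0. \<forall>\<theta>\<in>\<Lambda>. \<forall>m n u. norm (B n *v pr \<theta> u) \<le>
    C * exp (\<theta> * (Z n - Z m) + \<epsilon> * (\<bar>Z n\<bar> + \<bar>Z m\<bar>)) * norm (B m *v u)"
proof -
  have fin: "finite \<Lambda>" using S by (simp add: splits_def)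
  define \<delta> where "\<delta> = \<epsilon> / 2"
  have \<delta>: "\<delta> > 0" using \<epsilon> by (simp add: \<delta>_def)
  have one: "\<exists>C>0. \<forall>m n u. norm (B n *v pr \<theta> u) \<le>
      C * exp (\<theta> * (Z n - Z m) + \<epsilon> * (\<bar>Z n\<bar> + \<bar>Z m\<bar>)) * norm (B m *v u)" if \<theta>: "\<theta> \<in> \<Lambda>" for \<theta>
  proof -
    have E: "subspace (E \<theta>)" "E \<theta> \<noteq> {0}" using S \<theta> by (auto simp: splits_def)
    obtain C where C: "C > 0"
      "\<And>n v. v \<in> E \<theta> \<Longrightarrow> norm (B n *v v) \<le> C * exp (\<theta> * Z n + \<delta> * \<bar>Z n\<bar>) * norm v"
      "\<And>n v. v \<in> E \<theta> \<Longrightarrow> norm v \<le> C * exp (- (\<theta> * Z n) + \<delta> * \<bar>Z n\<bar>) * norm (B n *v v)"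
      using lyapunov_bounds[OF inv Z E(1) lim[OF _ \<theta>] \<delta>] by blast
    have "\<exists>A>0. \<forall>n u. norm (B n *v pr \<theta> u) \<le> A * exp (\<delta> * \<bar>Z n\<bar>) * norm (B n *v u)"
    proof (cases "\<Lambda> = {\<theta>}")
      case True
      then have "pr \<theta> u = u" for u using comp(2)[of u] by simp
      moreover have "norm x \<le> 1 * exp (\<delta> * \<bar>Z n\<bar>) * norm x" for x :: "real ^ 'a" and n
        using \<delta> by (simp add: mult_le_cancel_right1)
      ultimately show ?thesis by (intro exI[of _ 1]) simp
    next
      case False
      define K where "K = \<Lambda> - {\<theta>}"
      have K: "K \<subseteq> \<Lambda>" "K \<noteq> {}" "\<theta> \<notin> K" "{\<theta>} \<inter> K = {}" using False \<theta> by (auto simp: K_def)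
      obtain \<eta> where \<eta>: "\<eta> \<in> K" using K by blast
      then have "E \<eta> \<noteq> {0}" "subspace (E \<eta>)" using S K by (auto simp: splits_def)
      then obtain x where "x \<in> E \<eta>" "x \<noteq> 0" using subspace_nonzeroE by blast
      then have W: "span (\<Union>\<theta>\<in>K. E \<theta>) \<noteq> {0}"
        using \<eta> span_base[of x "\<Union>\<theta>\<in>K. E \<theta>"] by blast
      have U: "span (\<Union>\<theta>\<in>{\<theta>}. E \<theta>) = E \<theta>" using E(1) by (simp add: span_eq_iff)
      have lim': "((\<lambda>n. ln (min_angle ((*v) (B n) ` E \<theta>) ((*v) (B n) ` span (\<Union>\<theta>\<in>K. E \<theta>)))
         / real_of_int (Z n)) \<longlongrightarrow> 0) F" if "F \<in> {at_top, at_bot}" for F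
        using angle[OF that, of "{\<theta>}" K] \<theta> K unfolding U by blast
      obtain A where A: "A > 0" "\<And>n a b. a \<in> E \<theta> \<Longrightarrow> b \<in> span (\<Union>\<theta>\<in>K. E \<theta>) \<Longrightarrow>
          norm (B n *v a) \<le> A * exp (\<delta> * \<bar>Z n\<bar>) * norm (B n *v (a + b))"
        using angle_bounds[OF inv Z E subspace_span W splits_disjoint[OF S \<theta> K(1,3)] lim' \<delta>] by blast
      have "norm (B n *v pr \<theta> u) \<le> A * exp (\<delta> * \<bar>Z n\<bar>) * norm (B n *v u)" for n u
      proof -
        define b where "b = (\<Sum>\<eta>\<in>K. pr \<eta> u)"
        have "pr \<theta> u + b = u"
          using comp(2)[of u] \<theta> fin by (simp add: b_def K_def sum.remove)
        moreover have "b \<in> span (\<Union>\<theta>\<in>K. E \<theta>)"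
          unfolding b_def using comp(1) K by (intro span_sum span_base) blast
        ultimately show ?thesis using A(2)[OF comp(1)[OF \<theta>], of b n u] by simp
      qed
      with A(1) show ?thesis by blast
    qed
    then obtain A where A: "A > 0" "\<And>n u. norm (B n *v pr \<theta> u) \<le> A * exp (\<delta> * \<bar>Z n\<bar>) * norm (B n *v u)"
      by blast
    have "norm (B n *v pr \<theta> u) \<le>
      (C * C * A) * exp (\<theta> * (Z n - Z m) + \<epsilon> * (\<bar>Z n\<bar> + \<bar>Z m\<bar>)) * norm (B m *v u)" for m n u
    proof -
      define p where "p = C * exp (\<theta> * Z n + \<delta> * \<bar>Z n\<bar>)"
      define q where "q = C * exp (- (\<theta> * Z m) + \<delta> * \<bar>Z m\<bar>)"
      have pq: "p \<ge> 0" "q \<ge> 0" using C(1) by (simp_all add: p_def q_def)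
      have "norm (B n *v pr \<theta> u) \<le> p * norm (pr \<theta> u)"
        unfolding p_def by (rule C(2)[OF comp(1)[OF \<theta>]])
      also have "\<dots> \<le> p * (q * norm (B m *v pr \<theta> u))"
        unfolding q_def by (rule mult_left_mono[OF C(3)[OF comp(1)[OF \<theta>]] pq(1)])
      also have "\<dots> \<le> p * (q * (A * exp (\<delta> * \<bar>Z m\<bar>) * norm (B m *v u)))"
        using pq A(2) by (intro mult_left_mono) auto
      also have "\<dots> = (C * C * A) * exp (\<theta> * (Z n - Z m) + (\<delta> * \<bar>Z n\<bar> + 2 * \<delta> * \<bar>Z m\<bar>)) * norm (B m *v u)"
        by (simp add: p_def q_def exp_add[symmetric] right_diff_distrib exp_diff exp_minus
            algebra_simps)
      also have "\<dots> \<le> (C * C * A) * exp (\<theta> * (Z n - Z m) + \<epsilon> * (\<bar>Z n\<bar> + \<bar>Z m\<bar>)) * norm (B m *v u)"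
      proof -
        have "\<delta> * \<bar>real_of_int (Z n)\<bar> \<le> \<epsilon> * \<bar>real_of_int (Z n)\<bar>"
          using \<epsilon> by (intro mult_right_mono) (auto simp: \<delta>_def)
        then have "\<delta> * \<bar>Z n\<bar> + 2 * \<delta> * \<bar>Z m\<bar> \<le> \<epsilon> * (\<bar>Z n\<bar> + \<bar>Z m\<bar>)"
          by (simp add: \<delta>_def distrib_left)
        then show ?thesis using C(1) A(1) by (intro mult_right_mono mult_left_mono) auto
      qed
      finally show ?thesis .
    qed
    moreover have "C * C * A > 0" using C(1) A(1) by simp
    ultimately show ?thesis by blast
  qed
  then obtain c where c: "\<And>\<theta>. \<theta> \<in> \<Lambda> \<Longrightarrow> c \<theta> > 0" "\<And>\<theta> m n u. \<theta> \<in> \<Lambda> \<Longrightarrow> norm (B n *v pr \<theta> u) \<le>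
      c \<theta> * exp (\<theta> * (Z n - Z m) + \<epsilon> * (\<bar>Z n\<bar> + \<bar>Z m\<bar>)) * norm (B m *v u)"
    by metis
  define C where "C = (\<Sum>\<theta>\<in>\<Lambda>. c \<theta>) + 1"
  have "norm (B n *v pr \<theta> u) \<le> C * exp (\<theta> * (Z n - Z m) + \<epsilon> * (\<bar>Z n\<bar> + \<bar>Z m\<bar>)) * norm (B m *v u)"
    if \<theta>: "\<theta> \<in> \<Lambda>" for \<theta> m n u
  proof -
    have "c \<theta> \<le> (\<Sum>\<theta>\<in>\<Lambda>. c \<theta>)" using fin \<theta> c(1) by (intro member_le_sum) (auto intro: less_imp_le)
    then have "c \<theta> \<le> C" by (simp add: C_def)
    then show ?thesis by (intro order_trans[OF c(2)[OF \<theta>, of n u m]] mult_right_mono) auto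
  qed
  moreover have "C > 0" unfolding C_def using c(1) by (intro add_nonneg_pos sum_nonneg) (auto intro: less_imp_le)
  ultimately show ?thesis by blast
qed

lemma expanding_cocycle_kz:
  fixes D :: "int \<Rightarrow> ('a::finite) rv_datum"
  assumes D: "rv_sequence D" and gen: "oseledets_generic D" and genus: "2 * genus (D 0) = CARD('a)"
  shows "\<exists>\<Lambda> pr. expanding_cocycle (\<lambda>n. step_matrix (D n)) (kz D 0) (zorich D) \<Lambda> pr"
proof -
  obtain \<Lambda> and E :: "real \<Rightarrow> (real ^ 'a) set" where
    S: "splits \<Lambda> E"
    and lims: "\<forall>F\<in>{at_top, at_bot}.
           (\<forall>\<theta>\<in>\<Lambda>. uniform_limit (E \<theta> \<inter> sphere 0 1)
              (\<lambda>n v. ln (norm (kz D 0 n *v v)) / real_of_int (zorich D n)) (\<lambda>v. \<theta>) F) \<and>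
           (\<forall>J K. J \<subseteq> \<Lambda> \<and> K \<subseteq> \<Lambda> \<and> J \<noteq> {} \<and> K \<noteq> {} \<and> J \<inter> K = {} \<longrightarrow>
              ((\<lambda>n. ln (min_angle ((*v) (kz D 0 n) ` span (\<Union>\<theta>\<in>J. E \<theta>))
                                   ((*v) (kz D 0 n) ` span (\<Union>\<theta>\<in>K. E \<theta>)))
                    / real_of_int (zorich D n)) \<longlongrightarrow> 0) F)"
    and dims: "(\<Sum>\<theta> | \<theta> \<in> \<Lambda> \<and> \<theta> > 0. dim (E \<theta>)) = genus (D 0)"
      "(\<Sum>\<theta> | \<theta> \<in> \<Lambda> \<and> \<theta> < 0. dim (E \<theta>)) = genus (D 0)"
    using gen unfolding oseledets_generic_def
    by (elim exE conjE) (rule that; (unfold splits_def, intro conjI)?; assumption)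
  have lim: "uniform_limit (E \<theta> \<inter> sphere 0 1)
      (\<lambda>n v. ln (norm (kz D 0 n *v v)) / real_of_int (zorich D n)) (\<lambda>v. \<theta>) F"
    if "F \<in> {at_top, at_bot}" "\<theta> \<in> \<Lambda>" for F \<theta>
    using lims that by blast
  have angle: "((\<lambda>n. ln (min_angle ((*v) (kz D 0 n) ` span (\<Union>\<theta>\<in>J. E \<theta>))
        ((*v) (kz D 0 n) ` span (\<Union>\<theta>\<in>K. E \<theta>))) / real_of_int (zorich D n)) \<longlongrightarrow> 0) F"
    if "F \<in> {at_top, at_bot}" "J \<subseteq> \<Lambda>" "K \<subseteq> \<Lambda>" "J \<noteq> {}" "K \<noteq> {}" "J \<inter> K = {}" for F J K
    using lims that by blast
  have "\<exists>w. (\<forall>\<theta>\<in>\<Lambda>. w \<theta> \<in> E \<theta>) \<and> (\<Sum>\<theta>\<in>\<Lambda>. w \<theta>) = v" for v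
    using S unfolding splits_def by metis
  then obtain W where W: "\<And>v. (\<forall>\<theta>\<in>\<Lambda>. W v \<theta> \<in> E \<theta>) \<and> (\<Sum>\<theta>\<in>\<Lambda>. W v \<theta>) = v" by metis
  have "expanding_cocycle (\<lambda>n. step_matrix (D n)) (kz D 0) (zorich D) \<Lambda> (\<lambda>\<theta> v. W v \<theta>)"
  proof
    show "0 \<notin> \<Lambda>" using dims genus by (intro splits_nonzero_exponents[OF S]) simp
    show "finite \<Lambda>" using S by (simp add: splits_def)
    show "\<exists>C>0. \<forall>\<theta>\<in>\<Lambda>. \<forall>m n u. norm (kz D 0 n *v W u \<theta>) \<le>
        C * exp (\<theta> * (zorich D n - zorich D m) + \<epsilon> * (\<bar>zorich D n\<bar> + \<bar>zorich D m\<bar>)) * norm (kz D 0 m *v u)"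
      if "\<epsilon> > 0" for \<epsilon> :: real
      by (rule splitting_growth[OF invertible_kz[OF D] zorich_neq_0 S lim angle _ _ that, where pr = "\<lambda>\<theta> v. W v \<theta>"])
        (use W in blast)+
    show "kz D 0 (n + 1) = step_matrix (D n) ** kz D 0 n" for n by (rule kz_step[OF D])
    show "invertible (kz D 0 n)" for n by (rule invertible_kz[OF D])
    show "zorich D (n + 1) = zorich D n \<or> zorich D (n + 1) = zorich D n + 1" for n by (rule zorich_step)
    show "(\<Sum>\<theta>\<in>\<Lambda>. W u \<theta>) = u" for u using W by blast
  qed (simp_all only: zorich_0 step_matrix_pos)
  then show ?thesis by blast
qed

section \<open>Isomorphisms between the function spaces\<close>

lemma bij_betw_conjugate:
  assumes "\<And>v. S (p v) = q (h v)" "bij h" "inj q"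
  shows "bij_betw S (range p) (range q)"
proof (rule bij_betwI')
  fix x y assume "x \<in> range p" "y \<in> range p"
  then obtain v w where vw: "x = p v" "y = p w" by blast
  show "S x = S y \<longleftrightarrow> x = y"
  proof
    assume "S x = S y"
    then have "v = w" using assms by (simp add: vw inj_eq bij_is_inj)
    then show "x = y" by (simp add: vw)
  qed simp
next
  fix x assume "x \<in> range p"
  then show "S x \<in> range q" using assms(1) by auto
next
  fix y assume "y \<in> range q"
  then obtain v where "y = q v" by blast
  moreover obtain w where "v = h w" using assms(2) by (metis bij_is_surj surjD)
  ultimately show "\<exists>x\<in>range p. y = S x" using assms(1) by auto
qed

lemma bij_step_matrix:
  assumes "steppable P"
  shows "bij (\<lambda>v. step_matrix P *v v + c)"
proof -
  define M where "M = step_matrix P"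
  have M: "matrix_inv M *v (M *v x) = x" "M *v (matrix_inv M *v x) = x" for x
    using matrix_inv_both[OF invertible_step_matrix[OF assms]]
    by (simp_all add: M_def matrix_vector_mul_assoc)
  show ?thesis unfolding M_def[symmetric]
    by (rule o_bij[of "\<lambda>v. matrix_inv M *v (v - c)"]) (auto simp: M fun_eq_iff)
qed

text \<open>
  Coordinates on the affine space \<open>Gam_at P x\<close>, with the heights \<open>v\<close> of the step function as parameters.
\<close>

definition jump_fun :: "('a::finite) rv_datum \<Rightarrow> real \<Rightarrow> real ^ 'a \<Rightarrow> real \<Rightarrow> real" where
  "jump_fun P x v y = chi_tilde P x y + step_fun P v y"

lemma Gam_at_eq_range:
  assumes "valid_datum P"
  shows "Gam_at P x = range (jump_fun P x)"
  unfolding Gam_at_def Gam_eq_range[OF assms] by (auto simp: jump_fun_def[abs_def])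

lemma inj_jump_fun:
  assumes "valid_datum P"
  shows "inj (jump_fun P x)"
proof (rule injI)
  fix v w assume "jump_fun P x v = jump_fun P x w"
  then have "step_fun P v = step_fun P w" by (auto simp: jump_fun_def fun_eq_iff)
  then show "v = w" using inj_step_fun[OF assms] by (simp add: inj_eq)
qed

lemma jump_fun_outside: "valid_datum P \<Longrightarrow> y \<notin> base P \<Longrightarrow> jump_fun P x v y = 0"
  by (simp add: jump_fun_def step_fun_outside chi_tilde_def)

lemma step_fun_add: "step_fun P (v + w) x = step_fun P v x + step_fun P w x"
  using step_fun_linear[of P 1 v 1 w x] by simp

lemma special_birkhoff_add:
  "special_birkhoff D m n (\<lambda>x. f x + g x) = (\<lambda>x. special_birkhoff D m n f x + special_birkhoff D m n g x)"
  using special_birkhoff_linear[of D m n 1 f 1 g] by simp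

text \<open>
  In these coordinates one step is the affine map \<open>v \<mapsto> A v + c\<close> with linear part the matrix of the
  step and bounded translation. Equivariant sections are the solutions of this recursion.
\<close>

lemma special_birkhoff_jump_fun:
  fixes D :: "int \<Rightarrow> ('a::finite) rv_datum"
  assumes D: "rv_sequence D" and comp: "compatible D \<xi>0 \<xi>"
  obtains c where "\<And>n. norm (c n :: real ^ 'a) \<le> CARD('a)"
    and "\<And>n v. special_birkhoff D n (n + 1) (jump_fun (D n) (\<xi> n) v) =
      jump_fun (D (n + 1)) (\<xi> (n + 1)) (step_matrix (D n) *v v + c n)"
proof -
  have "\<exists>c. \<forall>n. (\<forall>\<alpha>. 0 \<le> c n $ \<alpha> \<and> c n $ \<alpha> \<le> 1) \<and> special_birkhoff D n (n + 1) (chi_tilde (D n) (\<xi> n)) =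
     (\<lambda>x. chi_tilde (D (n + 1)) (\<xi> (n + 1)) x + step_fun (D (n + 1)) (c n) x)"
    by (intro choice allI special_birkhoff_chi_tilde[OF assms])
  then obtain c where c: "\<And>n \<alpha>. 0 \<le> c n $ \<alpha> \<and> c n $ \<alpha> \<le> 1"
    "\<And>n. special_birkhoff D n (n + 1) (chi_tilde (D n) (\<xi> n)) =
     (\<lambda>x. chi_tilde (D (n + 1)) (\<xi> (n + 1)) x + step_fun (D (n + 1)) (c n) x)"
    by blast
  have "norm (c n) \<le> CARD('a)" for n
  proof -
    have "norm (c n) \<le> (\<Sum>\<alpha>\<in>UNIV. \<bar>c n $ \<alpha>\<bar>)" by (rule norm_le_l1_cart)
    also have "\<dots> \<le> (\<Sum>\<alpha>\<in>(UNIV :: 'a set). 1)" using c(1) by (intro sum_mono) auto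
    finally show ?thesis by simp
  qed
  moreover have "special_birkhoff D n (n + 1) (jump_fun (D n) (\<xi> n) v) =
      jump_fun (D (n + 1)) (\<xi> (n + 1)) (step_matrix (D n) *v v + c n)" for n v
    unfolding jump_fun_def[abs_def] special_birkhoff_add c(2) special_birkhoff_step_fun[OF D]
    by (simp add: step_fun_add fun_eq_iff)
  ultimately show ?thesis using that by blast
qed

lemma special_birkhoff_bij_betw:
  assumes D: "rv_sequence D" and "m \<le> n"
    and outside: "\<And>n f x. f \<in> V n \<Longrightarrow> x \<notin> base (D n) \<Longrightarrow> f x = 0"
    and step: "\<And>n. bij_betw (special_birkhoff D n (n + 1)) (V n) (V (n + 1))"
  shows "bij_betw (special_birkhoff D m n) (V m) (V n)"
  using \<open>m \<le> n\<close>
proof (induction n rule: int_ge_induct)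
  case base
  have "special_birkhoff D m m f = id f" if f: "f \<in> V m" for f
    unfolding id_apply using special_birkhoff_refl[OF D outside[OF f]] .
  then have "bij_betw (special_birkhoff D m m) (V m) (V m) \<longleftrightarrow> bij_betw id (V m) (V m)"
    by (rule bij_betw_cong)
  then show ?case by simp
next
  case (step n)
  have "special_birkhoff D m (n + 1) = special_birkhoff D n (n + 1) \<circ> special_birkhoff D m n"
    using special_birkhoff_Suc[OF D step.hyps(1)] by (simp add: fun_eq_iff)
  then show ?case using bij_betw_trans[OF step.IH assms(4)] by (simp only:)
qed

lemma affine_iso_if_bij_betw:
  "bij_betw (special_birkhoff D m n) V W \<Longrightarrow> affine_iso (special_birkhoff D m n) V W"
  unfolding affine_iso_def by (simp add: special_birkhoff_linear)

lemma linear_iso_if_bij_betw: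
  "bij_betw (special_birkhoff D m n) V W \<Longrightarrow> linear_iso (special_birkhoff D m n) V W"
  unfolding linear_iso_def by (simp add: special_birkhoff_linear)

lemma special_birkhoff_isos:
  fixes D :: "int \<Rightarrow> ('a::finite) rv_datum"
  assumes D: "rv_sequence D" and comp: "compatible D \<xi>0 \<xi>" and "m \<le> n"
  shows "linear_iso (special_birkhoff D m n) (Gam (D m)) (Gam (D n))"
    and "affine_iso (special_birkhoff D m n) (Gam_at (D m) (\<xi> m)) (Gam_at (D n) (\<xi> n))"
proof -
  note st = rv_sequenceD[OF D]
  have "bij_betw (special_birkhoff D n (n + 1)) (Gam (D n)) (Gam (D (n + 1)))" for n
    unfolding Gam_eq_range[OF st(2)]
    using bij_step_matrix[OF st(1), of n 0] special_birkhoff_step_fun[OF D]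
    by (intro bij_betw_conjugate[where h = "\<lambda>v. step_matrix (D n) *v v"] inj_step_fun st) auto
  then show "linear_iso (special_birkhoff D m n) (Gam (D m)) (Gam (D n))"
    by (intro linear_iso_if_bij_betw special_birkhoff_bij_betw[OF D \<open>m \<le> n\<close>]) (auto simp: Gam_def)
  obtain c where "\<And>n. norm (c n :: real ^ 'a) \<le> CARD('a)" and c: "\<And>n v. special_birkhoff D n (n + 1) (jump_fun (D n) (\<xi> n) v) =
      jump_fun (D (n + 1)) (\<xi> (n + 1)) (step_matrix (D n) *v v + c n)"
    by (rule special_birkhoff_jump_fun[OF D comp]) (rule that; assumption)
  have "bij_betw (special_birkhoff D n (n + 1)) (Gam_at (D n) (\<xi> n)) (Gam_at (D (n + 1)) (\<xi> (n + 1)))" for n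
    unfolding Gam_at_eq_range[OF st(2)]
    by (rule bij_betw_conjugate[where h = "\<lambda>v. step_matrix (D n) *v v + c n"])
      (intro c bij_step_matrix inj_jump_fun st)+
  then show "affine_iso (special_birkhoff D m n) (Gam_at (D m) (\<xi> m)) (Gam_at (D n) (\<xi> n))"
    by (intro affine_iso_if_bij_betw special_birkhoff_bij_betw[OF D \<open>m \<le> n\<close>, of "\<lambda>n. Gam_at (D n) (\<xi> n)"])
      (auto simp: Gam_at_eq_range[OF st(2)] jump_fun_outside[OF st(2)])
qed

section \<open>Sup norms and growth rates\<close>

lemma abs_jump_fun_le:
  assumes "valid_datum P" "y \<in> base P"
  shows "\<bar>jump_fun P x v y\<bar> \<le> 1 + norm v"
proof -
  obtain \<alpha> where "y \<in> int_top P \<alpha>" using assms base_eq_Union_int_top by blast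
  then have "jump_fun P x v y = (if y < x then 1 else 0) + v $ \<alpha>"
    using assms by (simp add: jump_fun_def step_fun_eq chi_tilde_eq)
  then show ?thesis using component_le_norm_cart[of v \<alpha>] by auto
qed

lemma base_nonempty: "valid_datum P \<Longrightarrow> base P \<noteq> {}"
  using int_top_subset_base[OF _ left_top_mem] by blast

lemma sup_norm_jump_fun_le:
  assumes "valid_datum P"
  shows "sup_norm P (jump_fun P x v) \<le> 1 + norm v"
  unfolding sup_norm_def using abs_jump_fun_le[OF assms] base_nonempty[OF assms] by (intro cSUP_least)

lemma abs_le_sup_norm_jump_fun:
  assumes "valid_datum P" "y \<in> base P"
  shows "\<bar>jump_fun P x v y\<bar> \<le> sup_norm P (jump_fun P x v)"
  unfolding sup_norm_def using abs_jump_fun_le[OF assms(1)] assms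
  by (intro cSUP_upper bdd_aboveI2[where M = "1 + norm v"])

text \<open>
  A function with a jump of height 1 inside an interval on which it is otherwise constant cannot be
  smaller than \<open>1 / 2\<close> on both sides of the jump.
\<close>

lemma sup_norm_ge_half:
  assumes P: "valid_datum P" and x: "x \<in> base P" "\<And>\<alpha>. x \<noteq> left_top P \<alpha>"
  shows "1 / 2 \<le> sup_norm P (jump_fun P x v)"
proof -
  obtain \<alpha> where \<alpha>: "x \<in> int_top P \<alpha>" using x P base_eq_Union_int_top by blast
  have l: "left_top P \<alpha> \<in> int_top P \<alpha>" "left_top P \<alpha> \<in> base P"
    using left_top_mem[OF P] int_top_subset_base[OF P] by blast+
  have "left_top P \<alpha> < x" using \<alpha> x(2)[of \<alpha>] by (auto simp: int_top_def)
  then have "jump_fun P x v (left_top P \<alpha>) = 1 + v $ \<alpha>" "jump_fun P x v x = v $ \<alpha>"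
    using l \<alpha> x(1) P by (simp_all add: jump_fun_def step_fun_eq[OF P] chi_tilde_eq)
  then show ?thesis
    using abs_le_sup_norm_jump_fun[OF P l(2), of x v] abs_le_sup_norm_jump_fun[OF P x(1), of x v] by linarith
qed

text \<open>
  The difference of two functions with the same jump is a step function, whose heights are read off
  at the left ends of the intervals.
\<close>

lemma norm_diff_le_sup_norm:
  fixes v w :: "real ^ 'a::finite"
  assumes P: "valid_datum P"
  shows "norm (v - w) \<le> CARD('a) * (sup_norm P (jump_fun P x v) + sup_norm P (jump_fun P x w))"
proof -
  have "\<bar>(v - w) $ \<alpha>\<bar> \<le> sup_norm P (jump_fun P x v) + sup_norm P (jump_fun P x w)" for \<alpha>
  proof -
    have l: "left_top P \<alpha> \<in> base P" using left_top_mem[OF P] int_top_subset_base[OF P] by blast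
    have "(v - w) $ \<alpha> = jump_fun P x v (left_top P \<alpha>) - jump_fun P x w (left_top P \<alpha>)"
      by (simp add: jump_fun_def step_fun_left_top[OF P])
    then show ?thesis
      using abs_le_sup_norm_jump_fun[OF P l, of x v] abs_le_sup_norm_jump_fun[OF P l, of x w] by linarith
  qed
  then have "(\<Sum>\<alpha>\<in>UNIV. \<bar>(v - w) $ \<alpha>\<bar>) \<le>
      (\<Sum>\<alpha>\<in>(UNIV :: 'a set). sup_norm P (jump_fun P x v) + sup_norm P (jump_fun P x w))"
    by (intro sum_mono)
  with norm_le_l1_cart[of "v - w"] show ?thesis by simp
qed

lemma log_ratio_tendsto_0:
  fixes s Z :: "'b \<Rightarrow> real"
  assumes Z: "filterlim (\<lambda>n. \<bar>Z n\<bar>) at_top F" and lower: "\<And>n. 1 / 2 \<le> s n"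
    and upper: "\<And>\<epsilon>. \<epsilon> > 0 \<Longrightarrow> \<exists>C>0. \<forall>n. s n \<le> C * exp (\<epsilon> * \<bar>Z n\<bar>)"
  shows "((\<lambda>n. ln (s n) / Z n) \<longlongrightarrow> 0) F"
proof (rule tendstoI)
  fix e :: real assume e: "e > 0"
  obtain C where C: "C > 0" "\<And>n. s n \<le> C * exp (e / 2 * \<bar>Z n\<bar>)" using upper[of "e / 2"] e by auto
  define K where "K = \<bar>ln C\<bar> + ln 2"
  have K: "K > 0" by (simp add: K_def add_nonneg_pos)
  have "\<forall>\<^sub>F n in F. 2 * K / e < \<bar>Z n\<bar>" using Z by (simp add: filterlim_at_top_dense)
  then show "\<forall>\<^sub>F n in F. dist (ln (s n) / Z n) 0 < e"
  proof eventually_elim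
    case (elim n)
    have s0: "s n > 0" using lower[of n] by linarith
    have "ln (s n) \<le> ln (C * exp (e / 2 * \<bar>Z n\<bar>))" using C s0 by (subst ln_le_cancel_iff) auto
    also have "\<dots> = ln C + e / 2 * \<bar>Z n\<bar>" using C(1) by (simp add: ln_mult)
    finally have up: "ln (s n) \<le> ln C + e / 2 * \<bar>Z n\<bar>" .
    have "ln (1 / 2) \<le> ln (s n)" using lower[of n] s0 by (subst ln_le_cancel_iff) auto
    then have "- ln 2 \<le> ln (s n)" by (simp add: ln_div)
    moreover have "0 \<le> e / 2 * \<bar>Z n\<bar>" using e by simp
    moreover have "(0 :: real) < ln 2" by simp
    ultimately have "\<bar>ln (s n)\<bar> \<le> K + e / 2 * \<bar>Z n\<bar>" using up unfolding K_def by linarith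
    moreover have "K < e / 2 * \<bar>Z n\<bar>" using elim e by (simp add: field_simps)
    ultimately have "\<bar>ln (s n)\<bar> < e * \<bar>Z n\<bar>" by simp
    moreover have "\<bar>Z n\<bar> > 0" using elim K e by (meson divide_pos_pos less_trans mult_pos_pos zero_less_numeral)
    ultimately show ?case by (simp add: dist_real_def abs_divide pos_divide_less_eq)
  qed
qed

lemma eventually_le_exp:
  fixes s Z :: "'b \<Rightarrow> real"
  assumes lim: "((\<lambda>n. ln (s n) / Z n) \<longlongrightarrow> 0) F" and Z: "\<forall>\<^sub>F n in F. Z n \<noteq> 0"
    and "\<epsilon> > 0"
  shows "\<forall>\<^sub>F n in F. s n \<le> exp (\<epsilon> * \<bar>Z n\<bar>)"
  using tendstoD[OF lim \<open>\<epsilon> > 0\<close>] Z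
proof eventually_elim
  case (elim n)
  have "\<bar>ln (s n)\<bar> < \<epsilon> * \<bar>Z n\<bar>"
    using elim by (simp add: dist_real_def abs_divide pos_divide_less_eq)
  then have "ln (s n) \<le> \<epsilon> * \<bar>Z n\<bar>" by linarith
  then show ?case
  proof (cases "s n > 0")
    case True
    then show ?thesis using \<open>ln (s n) \<le> \<epsilon> * \<bar>Z n\<bar>\<close> by (metis exp_le_cancel_iff exp_ln)
  next
    case False
    then show ?thesis by (meson exp_ge_zero le_less_linear order_trans)
  qed
qed

section \<open>The equivariant section of growth rate zero\<close>

theorem proposition5p3:
  fixes P :: "('a::finite) rv_datum" and D :: "int \<Rightarrow> 'a rv_datum"
    and \<xi>0 :: real and \<xi> :: "int \<Rightarrow> real"
  assumes "CARD('a) \<ge> 2"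
    and "num_marked P = 1"
    and "typical_point P"
    and "rv_orbit P D"
    and "compatible D \<xi>0 \<xi>"
  shows "(\<forall>n' n. n' \<le> n \<longrightarrow>
            linear_iso (special_birkhoff D n' n) (Gam (D n')) (Gam (D n)) \<and>
            affine_iso (special_birkhoff D n' n) (Gam_at (D n') (\<xi> n')) (Gam_at (D n) (\<xi> n))) \<and>
         Uniq (subexponential_section D \<xi>) \<and>
         (nonsingular D \<xi> \<longrightarrow> (\<exists>!\<phi>. subexponential_section D \<xi> \<phi>))"
proof -
  have D: "rv_sequence D" using assms(4) by (rule rv_orbit_imp_rv_sequence)
  note st = rv_sequenceD[OF D]
  have gen: "oseledets_generic D"
    using assms(3,4) rv_orbit_unique unfolding typical_point_def by blast
  have "2 * genus (D 0) = CARD('a)"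
    using assms(2,4) by (simp add: num_marked_def rv_orbit_def)
  with expanding_cocycle_kz[OF D gen] obtain \<Lambda> pr
    where "expanding_cocycle (\<lambda>n. step_matrix (D n)) (kz D 0) (zorich D) \<Lambda> pr" by blast
  then interpret expanding_cocycle "\<lambda>n. step_matrix (D n)" "kz D 0" "zorich D" \<Lambda> pr .
  obtain c where c: "\<And>n. norm (c n :: real ^ 'a) \<le> CARD('a)"
    "\<And>n v. special_birkhoff D n (n + 1) (jump_fun (D n) (\<xi> n) v) =
      jump_fun (D (n + 1)) (\<xi> (n + 1)) (step_matrix (D n) *v v + c n)"
    by (rule special_birkhoff_jump_fun[OF D assms(5)]) (rule that; assumption)
  have Z: "filterlim (\<lambda>n. \<bar>real_of_int (zorich D n)\<bar>) at_top F" if "F \<in> {at_top, at_bot}" for F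
    using Z_unbounded that by auto
  have uniq: "Uniq (subexponential_section D \<xi>)"
  proof (rule Uniq_I)
    fix \<phi> \<psi> assume \<phi>: "subexponential_section D \<xi> \<phi>" and \<psi>: "subexponential_section D \<xi> \<psi>"
    have "\<forall>n. \<exists>v. \<phi> n = jump_fun (D n) (\<xi> n) v" "\<forall>n. \<exists>w. \<psi> n = jump_fun (D n) (\<xi> n) w"
      using \<phi> \<psi> unfolding subexponential_section_def Gam_at_eq_range[OF st(2)] by blast+
    then obtain v w where v: "\<And>n. \<phi> n = jump_fun (D n) (\<xi> n) (v n)"
      and w: "\<And>n. \<psi> n = jump_fun (D n) (\<xi> n) (w n)" by metis
    have rec: "u (n + 1) = step_matrix (D n) *v u n + c n"
      if u: "subexponential_section D \<xi> (\<lambda>n. jump_fun (D n) (\<xi> n) (u n))" for u n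
    proof -
      have "special_birkhoff D n (n + 1) (jump_fun (D n) (\<xi> n) (u n)) =
          jump_fun (D (n + 1)) (\<xi> (n + 1)) (u (n + 1))"
        using u by (simp add: subexponential_section_def)
      then show ?thesis using inj_jump_fun[OF st(2)] by (simp add: c(2) inj_eq)
    qed
    have v_rec: "v (n + 1) = step_matrix (D n) *v v n + c n" for n using \<phi> v by (intro rec) (simp flip: v)
    have w_rec: "w (n + 1) = step_matrix (D n) *v w n + c n" for n using \<psi> w by (intro rec) (simp flip: w)
    have "v n - w n = 0" for n
    proof (rule bounded_solution_zero[of "\<lambda>n. v n - w n"])
      show "v (n + 1) - w (n + 1) = step_matrix (D n) *v (v n - w n)" for n
        by (simp add: v_rec w_rec matrix_vector_mult_diff_distrib)
      fix \<epsilon> :: real and F :: "int filter" assume \<epsilon>: "\<epsilon> > 0" and F: "F \<in> {at_top, at_bot}"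
      have Z0: "\<forall>\<^sub>F n in F. real_of_int (zorich D n) \<noteq> 0"
        using Z[OF F] by (auto simp: filterlim_at_top_dense elim: eventually_mono dest!: spec[of _ 0])
      have "\<forall>\<^sub>F n in F. sup_norm (D n) (\<phi> n) \<le> exp (\<epsilon> * \<bar>real_of_int (zorich D n)\<bar>)"
        by (rule eventually_le_exp[OF _ Z0 \<epsilon>]) (use \<phi> F in \<open>auto simp: subexponential_section_def\<close>)
      moreover have "\<forall>\<^sub>F n in F. sup_norm (D n) (\<psi> n) \<le> exp (\<epsilon> * \<bar>real_of_int (zorich D n)\<bar>)"
        by (rule eventually_le_exp[OF _ Z0 \<epsilon>]) (use \<psi> F in \<open>auto simp: subexponential_section_def\<close>)
      ultimately have "\<forall>\<^sub>F n in F. norm (v n - w n) \<le> (CARD('a) * 2) * exp (\<epsilon> * \<bar>zorich D n\<bar>)"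
      proof eventually_elim
        case (elim n)
        have "norm (v n - w n) \<le> CARD('a) * (sup_norm (D n) (\<phi> n) + sup_norm (D n) (\<psi> n))"
          unfolding v w by (rule norm_diff_le_sup_norm[OF st(2)])
        also have "\<dots> \<le> CARD('a) * (exp (\<epsilon> * \<bar>real_of_int (zorich D n)\<bar>) + exp (\<epsilon> * \<bar>real_of_int (zorich D n)\<bar>))"
          using elim by (intro mult_left_mono add_mono) auto
        finally show ?case by simp
      qed
      then show "\<exists>C. \<forall>\<^sub>F n in F. norm (v n - w n) \<le> C * exp (\<epsilon> * \<bar>zorich D n\<bar>)" by blast
    qed
    then show "\<phi> = \<psi>" by (simp add: fun_eq_iff v w)
  qed
  have ex: "\<exists>\<phi>. subexponential_section D \<xi> \<phi>" if ns: "nonsingular D \<xi>"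
  proof -
    obtain f where f: "\<And>n. f (n + 1) = step_matrix (D n) *v f n + c n"
      "\<And>\<epsilon>. \<epsilon> > (0::real) \<Longrightarrow> \<exists>C>0. \<forall>n. norm (f n) \<le> C * exp (\<epsilon> * \<bar>zorich D n\<bar>)"
      using bounded_perturbation_solution[of c, OF c(1)] by blast
    define \<phi> where "\<phi> n = jump_fun (D n) (\<xi> n) (f n)" for n
    have "special_birkhoff D m n (\<phi> m) = \<phi> n" if "m \<le> n" for m n
      using that
    proof (induction n rule: int_ge_induct)
      case base
      show ?case by (rule special_birkhoff_refl[OF D]) (simp add: \<phi>_def jump_fun_outside st(2))
    next
      case (step n)
      then show ?case by (simp add: special_birkhoff_Suc[OF D] \<phi>_def c(2) f(1))
    qed
    moreover have "((\<lambda>n. ln (sup_norm (D n) (\<phi> n)) / real_of_int (zorich D n)) \<longlongrightarrow> 0) F"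
      if F: "F \<in> {at_top, at_bot}" for F
    proof (rule log_ratio_tendsto_0[OF Z[OF F]])
      have "\<xi> n \<in> base (D n)" for n using assms(5) by (simp add: compatible_def)
      then show "1 / 2 \<le> sup_norm (D n) (\<phi> n)" for n
        using ns unfolding \<phi>_def nonsingular_def by (intro sup_norm_ge_half[OF st(2)]) auto
      fix \<epsilon> :: real assume \<epsilon>: "\<epsilon> > 0"
      obtain C where C: "C > 0" "\<And>n. norm (f n) \<le> C * exp (\<epsilon> * \<bar>zorich D n\<bar>)" using f(2)[OF \<epsilon>] by blast
      have "sup_norm (D n) (\<phi> n) \<le> (1 + C) * exp (\<epsilon> * \<bar>real_of_int (zorich D n)\<bar>)" for n
      proof -
        have "sup_norm (D n) (\<phi> n) \<le> 1 + norm (f n)"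
          unfolding \<phi>_def by (rule sup_norm_jump_fun_le[OF st(2)])
        moreover have "1 \<le> exp (\<epsilon> * \<bar>real_of_int (zorich D n)\<bar>)" using \<epsilon> by simp
        ultimately show ?thesis using C(2)[of n] unfolding distrib_right by (simp del: one_le_exp_iff)
      qed
      with C(1) show "\<exists>C>0. \<forall>n. sup_norm (D n) (\<phi> n) \<le> C * exp (\<epsilon> * \<bar>real_of_int (zorich D n)\<bar>)"
        by (intro exI[of _ "1 + C"]) auto
    qed
    moreover have "\<phi> n \<in> Gam_at (D n) (\<xi> n)" for n
      by (simp add: \<phi>_def Gam_at_eq_range[OF st(2)])
    ultimately have "subexponential_section D \<xi> \<phi>" by (simp add: subexponential_section_def)
    then show ?thesis by blast
  qed
  show ?thesis
  proof (intro conjI allI impI)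
    assume "nonsingular D \<xi>"
    then show "\<exists>!\<phi>. subexponential_section D \<xi> \<phi>" using uniq ex unfolding Uniq_def by blast
  qed (use special_birkhoff_isos[OF D assms(5)] uniq in auto)
qed

end
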